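(* Let $\{\mathcal K_q,q\ge 0\}$ be a compact coverage of $\Theta$ and let $\boldsymbol\gamma=\{\gamma_k\}_{k\ge0}$ be a nonincreasing sequence of positive numbers with $\sum_{k=1}^\infty k^{-1}\gamma_k<\infty$. Let $\{Z_k=(X_k,\theta_k,\kappa_k,\nu_k),k\ge0\}$ be the time-homogeneous Markov chain with transition probability $R$ described in the context. Assume that there is a measurable function $V:\mathsf X\to[1,\infty)$ with $\sup_{x\in\mathsf K}V(x)<\infty$ such that for every compact set $\mathcal K\subset\Theta$: (a) there exist $\mathsf C\in\mathcal B(\mathsf X)$, $\epsilon>0$ and a probability measure $\varphi$ on $\mathsf X$ (all depending on $\mathcal K$) with $\varphi(\mathsf C)>0$ and $P_\theta(x,\mathsf A)\ge\epsilon\varphi(\mathsf A)$ for all $\mathsf A\in\mathcal B(\mathsf X)$, $\theta\in\mathcal K$, $x\in\mathsf C$; (b) there exist $\lambda\in[0,1)$ and $b\in(0,\infty)$ such that for all $\theta\in\mathcal K$, $P_\theta V(x)\le\lambda V(x)$ for $x\notin\mathsf C$ and $P_\theta V(x)\le b$ for $x\in\mathsf C$; (c) for every $r\in[0,1]$ there is a constant $C$ such that $\|P_\theta f-P_{\theta'}f\|_{V^r}\le C\|f\|_{V^r}|\theta-\theta'|$ for all $\theta,\theta'\in\mathcal K$ and $f\in\mathcal L_{V^r}$. Assume also that $\{H_\theta,\theta\in\Theta\}$ is $V^\beta$-Lipschitz for some $\beta\in[0,1/2]$. Let $f:\mathsf X\to\mathbb R$ be a measurable function with $\|f\|_{V^\alpha}<\infty$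 for some $\alpha\in[0,1-\beta)$. Assume in addition that $\overline{\mathbb P}_\star\{\lim_{n\to\infty}\kappa_n<\infty\}=1$. Then $$n^{-1}\sum_{k=1}^n[f(X_k)-\pi(f)]\longrightarrow 0\qquad \overline{\mathbb P}_\star\text{-almost surely.}$$
   Context: Setting. $\mathsf X\subset\mathbb R^{n_x}$ is equipped with a countably generated $\sigma$-field $\mathcal B(\mathsf X)$; $\pi$ is a probability measure on $\mathsf X$; $\Theta\subset\mathbb R^{n_\theta}$ is open; $\{P_\theta,\theta\in\Theta\}$ is a family of Markov transition kernels on $\mathsf X$, each $\pi$-irreducible and satisfying $\pi P_\theta=\pi$; $H:\Theta\times\mathsf X\to\mathbb R^{n_\theta}$ is a measurable update function, $H_\theta(x)=H(\theta,x)$; $\mathsf K$ is a fixed subset of $\mathsf X$. Notation: $P_\theta f(x)=\int P_\theta(x,dy)f(y)$, $\pi(f)=\int f\,d\pi$. Norms. For $W:\mathsf X\to[1,\infty)$, $\|f\|_W=\sup_{x\in\mathsf X}|f(x)|/W(x)$ and $\mathcal L_W=\{f:\|f\|_W<\infty\}$. A family $\{f_\theta,\theta\in\Theta\}$ of functions on $\mathsf X$ is $W$-Lipschitz if for every compact $\mathcal K\subset\Theta$, $\sup_{\theta\in\mathcal K}\|f_\theta\|_W<\infty$ and $\sup_{\theta\ne\theta'\in\mathcal K}|\theta-\theta'|^{-1}\|f_\theta-f_{\theta'}\|_W<\infty$. Elementary kernel. Let $\theta_c\notin\Theta$ be a cemetery point and $\overline\Theta=\Theta\cup\{\theta_c\}$.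 For $\tilde\gamma\ge0$, $(x,\theta)\in\mathsf X\times\Theta$, $A\in\mathcal B(\mathsf X)$, $B\in\mathcal B(\overline\Theta)$, $$Q_{\tilde\gamma}(x,\theta;A\times B)=\int_AP_\theta(x,dy)\mathbb 1\{\theta+\tilde\gamma H(\theta,y)\in B\}+\delta_{\theta_c}(B)\int_AP_\theta(x,dy)\mathbb 1\{\theta+\tilde\gamma H(\theta,y)\notin\Theta\}.$$ Compact coverage. Compact subsets $\{\mathcal K_q,q\ge0\}$ of $\Theta$ form a compact coverage of $\Theta$ if $\bigcup_q\mathcal K_q=\Theta$ and $\mathcal K_q\subset\mathrm{int}(\mathcal K_{q+1})$ for all $q\ge0$. Algorithm with reprojections. Let $\Pi:\mathsf X\times\overline\Theta\to\mathsf K\times\mathcal K_0$ be a measurable function. The homogeneous Markov chain $Z_k=(X_k,\theta_k,\kappa_k,\nu_k)$ on $\mathsf Z=\mathsf X\times\overline\Theta\times\mathbb N\times\mathbb N$ has transition probability $R$ defined as follows: from $(x,\theta,\kappa,\nu)$, (1) if $\nu=0$ draw $(X',\theta')\sim Q_{\gamma_\kappa}(\Pi(x,\theta);\cdot)$, otherwise draw $(X',\theta')\sim Q_{\gamma_{\kappa+\nu}}(x,\theta;\cdot)$; (2) if $\theta'\in\mathcal K_\kappa$ set $\kappa'=\kappa$, $\nu'=\nu+1$, otherwise set $\kappa'=\kappa+1$, $\nu'=0$. Thus $\kappa_n$ counts reinitializations. $\overline{\mathbb P}_\star$ is shorthand for the law $\overline{\mathbb P}_{x,\theta,0,0}$ of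 the chain started from $(x,\theta,0,0)$, for any $(x,\theta)\in\mathsf X\times\Theta$. *)

theory Defs
  imports "HOL-Probability.Probability"
begin

text \<open>
  A measurable space is represented by a measure, of which only \<open>space\<close> and \<open>sets\<close> matter. A Markov
  kernel \<open>N\<close> on \<open>M\<close> is an element of \<open>M \<rightarrow>\<^sub>M prob_algebra M\<close>.
\<close>

definition countably_generated :: "'a measure \<Rightarrow> bool" where
  "countably_generated M \<longleftrightarrow>
     (\<exists>G. countable G \<and> G \<subseteq> Pow (space M) \<and> sets M = sigma_sets (space M) G)"

primrec kernel_pow :: "'a measure \<Rightarrow> ('a \<Rightarrow> 'a measure) \<Rightarrow> nat \<Rightarrow> 'a \<Rightarrow> 'a measure" where
  "kernel_pow M N 0 x = return M x"
| "kernel_pow M N (Suc n) x = N x \<bind> kernel_pow M N n"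

text \<open>\<open>\<pi>\<close>-irreducibility: every \<open>\<pi>\<close>-positive set is charged by some positive power of the kernel.\<close>

definition irreducible_kernel :: "'a measure \<Rightarrow> ('a \<Rightarrow> 'a measure) \<Rightarrow> bool" where
  "irreducible_kernel \<pi> N \<longleftrightarrow>
     (\<forall>x\<in>space \<pi>. \<forall>A\<in>sets \<pi>. 0 < emeasure \<pi> A \<longrightarrow> (\<exists>n\<ge>1. 0 < emeasure (kernel_pow \<pi> N n x) A))"

definition kernel_app :: "('a \<Rightarrow> 'a measure) \<Rightarrow> ('a \<Rightarrow> real) \<Rightarrow> 'a \<Rightarrow> real" where
  "kernel_app N f x = (\<integral>y. f y \<partial>N x)"


text \<open>The norm takes values in \<open>ennreal\<close>, so that it is \<open>\<infinity>\<close> on functions that are not \<open>W\<close>-bounded.\<close>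

definition wnorm :: "'a measure \<Rightarrow> ('a \<Rightarrow> real) \<Rightarrow> ('a \<Rightarrow> 'b::real_normed_vector) \<Rightarrow> ennreal" where
  "wnorm M W f = (SUP x\<in>space M. ennreal (norm (f x) / W x))"

definition wspace :: "'a measure \<Rightarrow> ('a \<Rightarrow> real) \<Rightarrow> ('a \<Rightarrow> real) set" where
  "wspace M W = {f \<in> borel_measurable M. wnorm M W f < \<infinity>}"

definition W_Lipschitz ::
  "'a measure \<Rightarrow> ('t::real_normed_vector) set \<Rightarrow> ('a \<Rightarrow> real) \<Rightarrow>
     ('t \<Rightarrow> 'a \<Rightarrow> 'b::real_normed_vector) \<Rightarrow> bool" where
  "W_Lipschitz M \<Theta> W F \<longleftrightarrow>
     (\<forall>K. compact K \<and> K \<subseteq> \<Theta> \<longrightarrow>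
        (SUP \<theta>\<in>K. wnorm M W (F \<theta>)) < \<infinity> \<and>
        (SUP (\<theta>, \<theta>')\<in>{(\<theta>, \<theta>'). \<theta> \<in> K \<and> \<theta>' \<in> K \<and> \<theta> \<noteq> \<theta>'}.
            ennreal (1 / norm (\<theta> - \<theta>')) * wnorm M W (\<lambda>x. F \<theta> x - F \<theta>' x)) < \<infinity>)"


definition compact_coverage :: "('t::topological_space) set \<Rightarrow> (nat \<Rightarrow> 't set) \<Rightarrow> bool" where
  "compact_coverage \<Theta> \<K> \<longleftrightarrow>
     (\<forall>q. compact (\<K> q) \<and> \<K> q \<subseteq> \<Theta>) \<and> (\<Union>q. \<K> q) = \<Theta> \<and> (\<forall>q. \<K> q \<subseteq> interior (\<K> (Suc q)))"

text \<open>
  \<open>\<Theta> \<union> {\<theta>\<^sub>c}\<close> is represented in the option type: \<open>None\<close> is the cemetery point, and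
  \<open>Some \<theta>\<close> stands for \<open>\<theta> \<in> \<Theta>\<close>.
\<close>

definition param_bar :: "('t::topological_space) set \<Rightarrow> 't option measure" where
  "param_bar \<Theta> = sigma (insert None (Some ` \<Theta>))
     (insert {None} ((`) Some ` sets (restrict_space borel \<Theta>)))"


text \<open>
  \<open>Q\<close> is the image of \<open>P\<^sub>\<theta>(x, dy)\<close> under \<open>y \<mapsto> (y, \<theta> + g H(\<theta>, y))\<close>, with the second component
  replaced by the cemetery point when it leaves \<open>\<Theta>\<close>; \<open>emeasure_elementary_kernel\<close> below is
  the usual expression of its values on rectangles.
\<close>

definition param_update ::
  "('t::real_normed_vector) set \<Rightarrow> ('t \<Rightarrow> 'x \<Rightarrow> 't) \<Rightarrow> real \<Rightarrow> 't \<Rightarrow> 'x \<Rightarrow> 't option" where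
  "param_update \<Theta> H g \<theta> y =
     (if \<theta> + g *\<^sub>R H \<theta> y \<in> \<Theta> then Some (\<theta> + g *\<^sub>R H \<theta> y) else None)"

definition elementary_kernel ::
  "'x measure \<Rightarrow> ('t::real_normed_vector) set \<Rightarrow> ('t \<Rightarrow> 'x \<Rightarrow> 'x measure) \<Rightarrow> ('t \<Rightarrow> 'x \<Rightarrow> 't) \<Rightarrow>
     real \<Rightarrow> 'x \<times> 't \<Rightarrow> ('x \<times> 't option) measure" where
  "elementary_kernel M \<Theta> P H g = (\<lambda>(x, \<theta>).
     distr (P \<theta> x) (M \<Otimes>\<^sub>M param_bar \<Theta>) (\<lambda>y. (y, param_update \<Theta> H g \<theta> y)))"

type_synonym ('x, 't) reproj_state = "'x \<times> 't option \<times> nat \<times> nat"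

definition reproj_space :: "'x measure \<Rightarrow> ('t::topological_space) set \<Rightarrow> ('x, 't) reproj_state measure" where
  "reproj_space M \<Theta> = M \<Otimes>\<^sub>M param_bar \<Theta> \<Otimes>\<^sub>M count_space UNIV \<Otimes>\<^sub>M count_space UNIV"

text \<open>
  \<open>Q\<close> is only meaningful from parameters in \<open>\<Theta>\<close>. States \<open>(x, \<theta>\<^sub>c, \<kappa>, \<nu>)\<close> with \<open>\<nu> > 0\<close> are never
  reached from \<open>(x, \<theta>, 0, 0)\<close>, since a move to \<open>\<theta>\<^sub>c\<close> resets \<open>\<nu>\<close> to 0; there the draw
  is by convention the current position.
\<close>

definition reproj_draw ::
  "'x measure \<Rightarrow> ('t::real_normed_vector) set \<Rightarrow> ('t \<Rightarrow> 'x \<Rightarrow> 'x measure) \<Rightarrow> ('t \<Rightarrow> 'x \<Rightarrow> 't) \<Rightarrow>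
     (nat \<Rightarrow> real) \<Rightarrow> ('x \<times> 't option \<Rightarrow> 'x \<times> 't) \<Rightarrow>
     ('x, 't) reproj_state \<Rightarrow> ('x \<times> 't option) measure" where
  "reproj_draw M \<Theta> P H \<gamma> proj = (\<lambda>(x, \<tau>, \<kappa>, \<nu>).
     if \<nu> = 0 then elementary_kernel M \<Theta> P H (\<gamma> \<kappa>) (proj (x, \<tau>))
     else (case \<tau> of
         Some \<theta> \<Rightarrow> elementary_kernel M \<Theta> P H (\<gamma> (\<kappa> + \<nu>)) (x, \<theta>)
       | None \<Rightarrow> return (M \<Otimes>\<^sub>M param_bar \<Theta>) (x, None)))"

definition reproj_next ::
  "(nat \<Rightarrow> 't set) \<Rightarrow> nat \<Rightarrow> nat \<Rightarrow> 'x \<times> 't option \<Rightarrow> ('x, 't) reproj_state" where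
  "reproj_next \<K> \<kappa> \<nu> = (\<lambda>(x', \<tau>').
     if \<tau>' \<in> Some ` \<K> \<kappa> then (x', \<tau>', \<kappa>, \<nu> + 1) else (x', \<tau>', \<kappa> + 1, 0))"

definition reproj_kernel ::
  "'x measure \<Rightarrow> ('t::real_normed_vector) set \<Rightarrow> ('t \<Rightarrow> 'x \<Rightarrow> 'x measure) \<Rightarrow> ('t \<Rightarrow> 'x \<Rightarrow> 't) \<Rightarrow>
     (nat \<Rightarrow> real) \<Rightarrow> (nat \<Rightarrow> 't set) \<Rightarrow> ('x \<times> 't option \<Rightarrow> 'x \<times> 't) \<Rightarrow>
     ('x, 't) reproj_state \<Rightarrow> ('x, 't) reproj_state measure" where
  "reproj_kernel M \<Theta> P H \<gamma> \<K> proj z =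
     (case z of (x, \<tau>, \<kappa>, \<nu>) \<Rightarrow>
        distr (reproj_draw M \<Theta> P H \<gamma> proj z) (reproj_space M \<Theta>) (reproj_next \<K> \<kappa> \<nu>))"

definition state_X :: "('x, 't) reproj_state \<Rightarrow> 'x" where
  "state_X = (\<lambda>(x, \<tau>, \<kappa>, \<nu>). x)"

definition state_kappa :: "('x, 't) reproj_state \<Rightarrow> nat" where
  "state_kappa = (\<lambda>(x, \<tau>, \<kappa>, \<nu>). \<kappa>)"


text \<open>
  The law, on the sequence space, of the time-homogeneous Markov chain with kernel \<open>R\<close> started at \<open>z\<close>,
  given by the Ionescu-Tulcea theorem. The locale \<open>Ionescu_Tulcea\<close> takes as \<open>n\<close>-th argument
  the conditional law of the \<open>n\<close>-th coordinate given the coordinates \<open>0, \<dots>, n - 1\<close>.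
\<close>

definition chain_step :: "'z measure \<Rightarrow> ('z \<Rightarrow> 'z measure) \<Rightarrow> 'z \<Rightarrow> nat \<Rightarrow> (nat \<Rightarrow> 'z) \<Rightarrow> 'z measure" where
  "chain_step M R z n \<omega> = (case n of 0 \<Rightarrow> return M z | Suc m \<Rightarrow> R (\<omega> m))"

definition chain_law :: "'z measure \<Rightarrow> ('z \<Rightarrow> 'z measure) \<Rightarrow> 'z \<Rightarrow> (nat \<Rightarrow> 'z) measure" where
  "chain_law M R z =
     projective_family.lim UNIV (Ionescu_Tulcea.CI (chain_step M R z) (\<lambda>_. M)) (\<lambda>_. M)"


definition reproj_law ::
  "'x measure \<Rightarrow> ('t::real_normed_vector) set \<Rightarrow> ('t \<Rightarrow> 'x \<Rightarrow> 'x measure) \<Rightarrow> ('t \<Rightarrow> 'x \<Rightarrow> 't) \<Rightarrow>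
     (nat \<Rightarrow> real) \<Rightarrow> (nat \<Rightarrow> 't set) \<Rightarrow> ('x \<times> 't option \<Rightarrow> 'x \<times> 't) \<Rightarrow>
     'x \<Rightarrow> 't \<Rightarrow> (nat \<Rightarrow> ('x, 't) reproj_state) measure" where
  "reproj_law M \<Theta> P H \<gamma> \<K> proj x \<theta> =
     chain_law (reproj_space M \<Theta>) (reproj_kernel M \<Theta> P H \<gamma> \<K> proj) (x, Some \<theta>, 0, 0)"

lemma Ionescu_Tulcea_chain_step:
  assumes R: "R \<in> M \<rightarrow>\<^sub>M prob_algebra M" and z: "z \<in> space M"
  shows "Ionescu_Tulcea (chain_step M R z) (\<lambda>_. M)"
proof -
  have *: "chain_step M R z n \<in> PiM {0..<n} (\<lambda>_. M) \<rightarrow>\<^sub>M prob_algebra M" for n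
  proof (cases n)
    case 0
    have "(\<lambda>\<omega>. return M z) \<in> PiM {0..<n} (\<lambda>_. M) \<rightarrow>\<^sub>M prob_algebra M"
      using z by (intro measurable_const) (simp add: space_prob_algebra prob_space_return)
    then show ?thesis by (simp add: chain_step_def[abs_def] 0)
  next
    case (Suc m)
    have "(\<lambda>\<omega>. R (\<omega> m)) \<in> PiM {0..<n} (\<lambda>_. M) \<rightarrow>\<^sub>M prob_algebra M"
      by (rule measurable_compose[OF _ R], rule measurable_component_singleton) (simp add: Suc)
    then show ?thesis by (simp add: chain_step_def[abs_def] Suc)
  qed
  have "prob_space (chain_step M R z n \<omega>)" if "\<omega> \<in> space (PiM {0..<n} (\<lambda>_. M))" for n \<omega>
    using measurable_space[OF * that] by (simp add: space_prob_algebra)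
  with * show ?thesis
    by (intro Ionescu_Tulcea.intro measurable_prob_algebraD) auto
qed

lemma sets_param_bar:
  "sets (param_bar \<Theta>) =
     {B. B \<subseteq> insert None (Some ` \<Theta>) \<and> Some -` B \<in> sets (restrict_space borel \<Theta>)}"
    (is "_ = ?S")
proof -
  let ?B = "restrict_space borel \<Theta>"
  let ?T = "insert None (Some ` \<Theta>)"
  let ?G = "insert {None} ((`) Some ` sets ?B)"
  have space_B: "space ?B = \<Theta>" by (simp add: space_restrict_space)
  have G: "?G \<subseteq> Pow ?T" using sets.sets_into_space[of _ ?B] space_B by fastforce
  have sets_bar: "sets (param_bar \<Theta>) = sigma_sets ?T ?G"
    unfolding param_bar_def using G by (rule sets_measure_of)
  have "sigma_sets ?T ?G \<subseteq> ?S"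
  proof
    fix B assume "B \<in> sigma_sets ?T ?G"
    then show "B \<in> ?S"
    proof induction
      case (Basic B)
      then consider "B = {None}" | A where "A \<in> sets ?B" "B = Some ` A" by auto
      then show ?case
      proof cases
        case 1
        then have "Some -` B = {}" by auto
        with 1 show ?thesis by simp
      next
        case 2
        then have "Some -` B = A" by auto
        with 2 show ?thesis using G by auto
      qed
    next
      case (Compl B)
      have "Some -` (?T - B) = space ?B - Some -` B" using space_B by auto
      with Compl show ?case by auto
    next
      case (Union B)
      then show ?case by (auto simp: vimage_UN)
    qed simp
  qed
  moreover have "?S \<subseteq> sigma_sets ?T ?G"
  proof
    fix B assume B: "B \<in> ?S"
    have 1: "Some ` (Some -` B) \<in> sigma_sets ?T ?G"
      using B by (intro sigma_sets.Basic insertI2 imageI) simp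
    have 2: "{None} \<in> sigma_sets ?T ?G" by (intro sigma_sets.Basic) auto
    show "B \<in> sigma_sets ?T ?G"
    proof (cases "None \<in> B")
      case True
      have "b \<in> B \<longleftrightarrow> b \<in> {None} \<union> Some ` (Some -` B)" for b
        using True by (cases b) auto
      then have "B = {None} \<union> Some ` (Some -` B)" by blast
      then show ?thesis using sigma_sets_Un[OF 2 1] by simp
    next
      case False
      have "b \<in> B \<longleftrightarrow> b \<in> Some ` (Some -` B)" for b
        using False by (cases b) auto
      then have "B = Some ` (Some -` B)" by blast
      then show ?thesis using 1 by simp
    qed
  qed
  ultimately show ?thesis using sets_bar by blast
qed

lemma space_param_bar: "space (param_bar \<Theta>) = insert None (Some ` \<Theta>)"
  unfolding param_bar_def by (simp add: space_measure_of_conv)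

lemma measurable_param_update:
  fixes \<Theta> :: "('t::euclidean_space) set"
  assumes [measurable]: "\<Theta> \<in> sets borel" "H \<theta> \<in> borel_measurable M"
  shows "param_update \<Theta> H g \<theta> \<in> M \<rightarrow>\<^sub>M param_bar \<Theta>"
proof (rule measurableI)
  fix B assume "B \<in> sets (param_bar \<Theta>)"
  then have B: "B \<subseteq> insert None (Some ` \<Theta>)" "Some -` B \<in> sets borel"
    by (auto simp: sets_param_bar sets_restrict_space_iff)
  have "param_update \<Theta> H g \<theta> -` B \<inter> space M =
      {y \<in> space M. \<theta> + g *\<^sub>R H \<theta> y \<in> Some -` B} \<union>
      (if None \<in> B then {y \<in> space M. \<theta> + g *\<^sub>R H \<theta> y \<notin> \<Theta>} else {})"
    using B(1) by (auto simp: param_update_def split: if_splits)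
  also have "\<dots> \<in> sets M"
  proof (intro sets.Un)
    have "(\<lambda>y. \<theta> + g *\<^sub>R H \<theta> y) -` (Some -` B) \<inter> space M \<in> sets M"
      by (intro measurable_sets[OF _ B(2)]) measurable
    also have "(\<lambda>y. \<theta> + g *\<^sub>R H \<theta> y) -` (Some -` B) \<inter> space M =
        {y \<in> space M. \<theta> + g *\<^sub>R H \<theta> y \<in> Some -` B}" by auto
    finally show "{y \<in> space M. \<theta> + g *\<^sub>R H \<theta> y \<in> Some -` B} \<in> sets M" .
    have "{y \<in> space M. \<theta> + g *\<^sub>R H \<theta> y \<notin> \<Theta>} \<in> sets M" by measurable
    then show "(if None \<in> B then {y \<in> space M. \<theta> + g *\<^sub>R H \<theta> y \<notin> \<Theta>} else {}) \<in> sets M"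
      by simp
  qed
  finally show "param_update \<Theta> H g \<theta> -` B \<inter> space M \<in> sets M" .
qed (auto simp: space_param_bar param_update_def)

lemma emeasure_elementary_kernel:
  fixes \<Theta> :: "('t::euclidean_space) set"
  assumes \<Theta>[measurable]: "\<Theta> \<in> sets borel" and P: "P \<theta> \<in> M \<rightarrow>\<^sub>M prob_algebra M"
    and H[measurable]: "H \<theta> \<in> borel_measurable M"
    and x: "x \<in> space M" and A[measurable]: "A \<in> sets M" and B: "B \<in> sets (param_bar \<Theta>)"
  shows "emeasure (elementary_kernel M \<Theta> P H g (x, \<theta>)) (A \<times> B) =
     (\<integral>\<^sup>+y\<in>A. indicator B (Some (\<theta> + g *\<^sub>R H \<theta> y)) \<partial>P \<theta> x) +
     indicator B None * (\<integral>\<^sup>+y\<in>A. indicator (- \<Theta>) (\<theta> + g *\<^sub>R H \<theta> y) \<partial>P \<theta> x)"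
proof -
  note B[measurable]
  have B': "B \<subseteq> insert None (Some ` \<Theta>)" "Some -` B \<in> sets borel"
    using B by (auto simp: sets_param_bar sets_restrict_space_iff)
  note B'(2)[measurable]
  have sets_P[measurable_cong]: "sets (P \<theta> x) = sets M"
    using measurable_space[OF P x] by (simp add: space_prob_algebra)
  have upd[measurable]: "param_update \<Theta> H g \<theta> \<in> M \<rightarrow>\<^sub>M param_bar \<Theta>"
    by (rule measurable_param_update) measurable
  have ind: "(\<lambda>y. indicator B (Some (\<theta> + g *\<^sub>R H \<theta> y)) :: ennreal)
      = (\<lambda>y. indicator (Some -` B) (\<theta> + g *\<^sub>R H \<theta> y))"
    by (auto simp: indicator_def)
  have [measurable]: "(\<lambda>y. indicator B (Some (\<theta> + g *\<^sub>R H \<theta> y)) :: ennreal) \<in> borel_measurable M"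
    unfolding ind by measurable
  have "emeasure (elementary_kernel M \<Theta> P H g (x, \<theta>)) (A \<times> B) =
      (\<integral>\<^sup>+z. indicator (A \<times> B) z \<partial>elementary_kernel M \<Theta> P H g (x, \<theta>))"
    by (simp add: elementary_kernel_def)
  also have "\<dots> = (\<integral>\<^sup>+y. indicator (A \<times> B) (y, param_update \<Theta> H g \<theta> y) \<partial>P \<theta> x)"
    unfolding elementary_kernel_def prod.case by (subst nn_integral_distr) simp_all
  also have "\<dots> = (\<integral>\<^sup>+y. indicator B (Some (\<theta> + g *\<^sub>R H \<theta> y)) * indicator A y +
      indicator B None * (indicator (- \<Theta>) (\<theta> + g *\<^sub>R H \<theta> y) * indicator A y) \<partial>P \<theta> x)"
    using B'(1) by (intro nn_integral_cong) (auto simp: param_update_def indicator_def)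
  also have "\<dots> = (\<integral>\<^sup>+y\<in>A. indicator B (Some (\<theta> + g *\<^sub>R H \<theta> y)) \<partial>P \<theta> x) +
     indicator B None * (\<integral>\<^sup>+y\<in>A. indicator (- \<Theta>) (\<theta> + g *\<^sub>R H \<theta> y) \<partial>P \<theta> x)"
    by (subst nn_integral_add) (auto simp: nn_integral_cmult)
  finally show ?thesis .
qed

lemma measurable_the_param:
  "the \<in> restrict_space (param_bar \<Theta>) {\<tau>. \<tau> \<noteq> None} \<rightarrow>\<^sub>M restrict_space borel \<Theta>"
proof (rule measurableI)
  fix A assume A: "A \<in> sets (restrict_space borel \<Theta>)"
  then have "A \<subseteq> \<Theta>" using sets.sets_into_space by (fastforce simp: space_restrict_space)
  then have *: "the -` A \<inter> space (restrict_space (param_bar \<Theta>) {\<tau>. \<tau> \<noteq> None}) = Some ` A"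
    by (auto simp: space_restrict_space space_param_bar)
  have "Some -` (Some ` A) = A" by auto
  then have "Some ` A \<in> sets (param_bar \<Theta>)"
    using A \<open>A \<subseteq> \<Theta>\<close> by (auto simp: sets_param_bar)
  then show "the -` A \<inter> space (restrict_space (param_bar \<Theta>) {\<tau>. \<tau> \<noteq> None})
      \<in> sets (restrict_space (param_bar \<Theta>) {\<tau>. \<tau> \<noteq> None})"
    unfolding * by (auto simp: sets_restrict_space image_iff intro!: bexI[of _ "Some ` A"])
qed (auto simp: space_restrict_space space_param_bar)

lemma measurable_param_update2:
  fixes \<Theta> :: "('t::euclidean_space) set"
  assumes T: "open \<Theta>" and H: "(\<lambda>(\<theta>, x). H \<theta> x) \<in> borel_measurable (restrict_space borel \<Theta> \<Otimes>\<^sub>M M)"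
  shows "(\<lambda>(\<theta>, y). param_update \<Theta> H g \<theta> y) \<in> restrict_space borel \<Theta> \<Otimes>\<^sub>M M \<rightarrow>\<^sub>M param_bar \<Theta>"
proof -
  let ?N = "restrict_space borel \<Theta> \<Otimes>\<^sub>M M"
  let ?h = "\<lambda>z. (fst z + g *\<^sub>R H (fst z) (snd z)) :: 't"
  have [measurable]: "\<Theta> \<in> sets borel" using T by simp
  have h: "?h \<in> borel_measurable ?N"
  proof (intro borel_measurable_add borel_measurable_scaleR)
    have "(\<lambda>x. x) \<in> borel_measurable (restrict_space borel \<Theta>)" by (rule measurable_restrict_space1) simp
    then show "fst \<in> borel_measurable ?N" by (rule measurable_compose[OF measurable_fst])
    show "(\<lambda>z. H (fst z) (snd z)) \<in> borel_measurable ?N" using H by (simp add: split_beta')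
  qed simp
  have "param_update \<Theta> (\<lambda>_ z. ?h z) 1 0 \<in> ?N \<rightarrow>\<^sub>M param_bar \<Theta>"
    by (rule measurable_param_update) (use h in simp_all)
  also have "param_update \<Theta> (\<lambda>_ z. ?h z) 1 0 = (\<lambda>(\<theta>, y). param_update \<Theta> H g \<theta> y)"
    by (auto simp: param_update_def)
  finally show ?thesis .
qed

lemma measurable_elementary_kernel:
  fixes \<Theta> :: "('t::euclidean_space) set"
  assumes T: "open \<Theta>" and H: "(\<lambda>(\<theta>, x). H \<theta> x) \<in> borel_measurable (restrict_space borel \<Theta> \<Otimes>\<^sub>M M)"
    and P: "(\<lambda>(\<theta>, x). P \<theta> x) \<in> restrict_space borel \<Theta> \<Otimes>\<^sub>M M \<rightarrow>\<^sub>M prob_algebra M"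
  shows "elementary_kernel M \<Theta> P H g \<in> M \<Otimes>\<^sub>M restrict_space borel \<Theta> \<rightarrow>\<^sub>M prob_algebra (M \<Otimes>\<^sub>M param_bar \<Theta>)"
  unfolding elementary_kernel_def split_beta'
proof (rule measurable_distr_prob_space2)
  show "(\<lambda>p. P (snd p) (fst p)) \<in> M \<Otimes>\<^sub>M restrict_space borel \<Theta> \<rightarrow>\<^sub>M prob_algebra M"
    using measurable_compose[OF measurable_pair_swap' P] by (simp add: split_beta')
  have "(\<lambda>q. (snd (fst q), snd q)) \<in> (M \<Otimes>\<^sub>M restrict_space borel \<Theta>) \<Otimes>\<^sub>M M \<rightarrow>\<^sub>M restrict_space borel \<Theta> \<Otimes>\<^sub>M M"
    by measurable
  from measurable_compose[OF this measurable_param_update2[OF T H]]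
  show "(\<lambda>(p, y). (y, param_update \<Theta> H g (snd p) y)) \<in>
      (M \<Otimes>\<^sub>M restrict_space borel \<Theta>) \<Otimes>\<^sub>M M \<rightarrow>\<^sub>M M \<Otimes>\<^sub>M param_bar \<Theta>"
    by (simp add: split_beta')
qed

lemma measurable_reproj_kernel:
  fixes \<Theta> :: "('t::euclidean_space) set"
  assumes T: "open \<Theta>" and H: "(\<lambda>(\<theta>, x). H \<theta> x) \<in> borel_measurable (restrict_space borel \<Theta> \<Otimes>\<^sub>M M)"
    and P: "(\<lambda>(\<theta>, x). P \<theta> x) \<in> restrict_space borel \<Theta> \<Otimes>\<^sub>M M \<rightarrow>\<^sub>M prob_algebra M"
    and K: "compact_coverage \<Theta> \<K>"
    and pr: "proj \<in> M \<Otimes>\<^sub>M param_bar \<Theta> \<rightarrow>\<^sub>M restrict_space (M \<Otimes>\<^sub>M restrict_space borel \<Theta>) S"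
  shows "reproj_kernel M \<Theta> P H \<gamma> \<K> proj \<in> reproj_space M \<Theta> \<rightarrow>\<^sub>M prob_algebra (reproj_space M \<Theta>)"
proof -
  let ?B = "M \<Otimes>\<^sub>M param_bar \<Theta>"
  let ?R = "\<lambda>\<kappa> \<nu> (p :: 'a \<times> 't option). reproj_kernel M \<Theta> P H \<gamma> \<K> proj (fst p, snd p, \<kappa>, \<nu>)"
  note Q = measurable_elementary_kernel[OF T H P]
  have pr': "proj \<in> ?B \<rightarrow>\<^sub>M M \<Otimes>\<^sub>M restrict_space borel \<Theta>"
    using pr by (rule measurable_restrict_space2_iff[THEN iffD1, THEN conjunct1])
  have bar: "{\<tau> \<in> space (param_bar \<Theta>). \<tau> = None} \<in> sets (param_bar \<Theta>)"
  proof -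
    have "{\<tau> \<in> space (param_bar \<Theta>). \<tau> = None} = {None}"
      by (auto simp: space_param_bar)
    moreover have "Some -` {None} = ({} :: 't set)" by auto
    ultimately show ?thesis by (simp only: sets_param_bar) simp
  qed
  have SK: "{\<tau> \<in> space (param_bar \<Theta>). \<tau> \<in> Some ` \<K> \<kappa>} \<in> sets (param_bar \<Theta>)" for \<kappa>
  proof -
    have "\<K> \<kappa> \<subseteq> \<Theta>" "\<K> \<kappa> \<in> sets borel"
      using K by (auto simp: compact_coverage_def borel_compact)
    moreover from this have "{\<tau> \<in> space (param_bar \<Theta>). \<tau> \<in> Some ` \<K> \<kappa>} = Some ` \<K> \<kappa>"
      by (auto simp: space_param_bar)
    moreover have "Some -` Some ` \<K> \<kappa> = \<K> \<kappa>" by auto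
    ultimately show ?thesis using T by (auto simp: sets_param_bar sets_restrict_space_iff)
  qed
  have nxt: "reproj_next \<K> \<kappa> \<nu> \<in> ?B \<rightarrow>\<^sub>M reproj_space M \<Theta>" for \<kappa> \<nu>
  proof -
    have "Measurable.pred (param_bar \<Theta>) (\<lambda>\<tau>. \<tau> \<in> Some ` \<K> \<kappa>)" using SK by (simp only: pred_def)
    from measurable_compose[OF measurable_snd this]
    have [measurable]: "Measurable.pred ?B (\<lambda>p. snd p \<in> Some ` \<K> \<kappa>)" .
    show ?thesis
      unfolding reproj_next_def reproj_space_def split_beta' by measurable
  qed
  have draw: "(\<lambda>p. reproj_draw M \<Theta> P H \<gamma> proj (fst p, snd p, \<kappa>, \<nu>)) \<in> ?B \<rightarrow>\<^sub>M prob_algebra ?B" for \<kappa> \<nu>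
  proof (cases "\<nu> = 0")
    case True
    then show ?thesis using measurable_compose[OF pr' Q] by (simp add: reproj_draw_def)
  next
    case False
    have D: "{p \<in> space ?B. snd p \<noteq> None} \<in> sets ?B"
    proof -
      have "Measurable.pred (param_bar \<Theta>) (\<lambda>\<tau>. \<tau> = None)" using bar by (simp add: pred_def)
      from measurable_compose[OF measurable_snd this]
      have "Measurable.pred ?B (\<lambda>p. snd p \<noteq> None)" by (rule pred_intros_logic(2))
      then show ?thesis by (simp only: pred_def)
    qed
    have s: "snd \<in> restrict_space ?B {p. snd p \<noteq> None} \<rightarrow>\<^sub>M restrict_space (param_bar \<Theta>) {\<tau>. \<tau> \<noteq> None}"
      by (intro measurable_restrict_space3) auto
    have 1: "(\<lambda>p. elementary_kernel M \<Theta> P H (\<gamma> (\<kappa> + \<nu>)) (fst p, the (snd p)))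
        \<in> restrict_space ?B {p. snd p \<noteq> None} \<rightarrow>\<^sub>M prob_algebra ?B"
      by (intro measurable_compose[OF _ Q] measurable_Pair measurable_restrict_space1 measurable_fst
          measurable_compose[OF s measurable_the_param])
    have "(\<lambda>p. return ?B (fst p, None)) \<in> ?B \<rightarrow>\<^sub>M prob_algebra ?B"
      by (intro measurable_compose[OF _ measurable_return_prob_space] measurable_Pair measurable_fst measurable_const)
         (simp add: space_param_bar)
    then have 2: "(\<lambda>p. return ?B (fst p, None)) \<in> restrict_space ?B {p. \<not> snd p \<noteq> None} \<rightarrow>\<^sub>M prob_algebra ?B"
      by (rule measurable_restrict_space1)
    have "(\<lambda>p. if snd p \<noteq> None then elementary_kernel M \<Theta> P H (\<gamma> (\<kappa> + \<nu>)) (fst p, the (snd p))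
        else return ?B (fst p, None)) \<in> ?B \<rightarrow>\<^sub>M prob_algebra ?B"
      by (rule measurable_If_restrict_space_iff[OF D, THEN iffD2]) (use 1 2 in simp)
    moreover have "(\<lambda>p. reproj_draw M \<Theta> P H \<gamma> proj (fst p, snd p, \<kappa>, \<nu>)) =
        (\<lambda>p. if snd p \<noteq> None then elementary_kernel M \<Theta> P H (\<gamma> (\<kappa> + \<nu>)) (fst p, the (snd p))
        else return ?B (fst p, None))"
      using False by (auto simp: reproj_draw_def fun_eq_iff split: option.split)
    ultimately show ?thesis by simp
  qed
  have "?R \<kappa> \<nu> \<in> ?B \<rightarrow>\<^sub>M prob_algebra (reproj_space M \<Theta>)" for \<kappa> \<nu>
    unfolding reproj_kernel_def prod.case
    by (rule measurable_compose[OF draw measurable_distr_prob_space[OF nxt]])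
  then have R: "(\<lambda>z. ?R \<kappa> \<nu> (fst z, fst (snd z))) \<in> reproj_space M \<Theta> \<rightarrow>\<^sub>M prob_algebra (reproj_space M \<Theta>)" for \<kappa> \<nu>
    by (rule measurable_compose[rotated]) (simp add: reproj_space_def)
  have "(\<lambda>z. (\<lambda>i z. ?R (fst i) (snd i) (fst z, fst (snd z))) (snd (snd z)) z)
      \<in> reproj_space M \<Theta> \<rightarrow>\<^sub>M prob_algebra (reproj_space M \<Theta>)"
    by (rule measurable_compose_countable[OF R])
       (simp add: reproj_space_def pair_measure_countable)
  then show ?thesis by simp
qed

end

theory Submission
  imports Defs "HOL-Library.Discrete_Functions" "HOL-Real_Asymp.Real_Asymp"
begin

text \<open>
  Almost surely there are \<open>m\<close> and \<open>q\<close> such that from time \<open>m\<close> on the parameter stays in the compact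
  set \<open>\<K> q\<close>, so it suffices to control the averages on such excursions. There the drift condition
  bounds \<open>E[V(X\<^sub>k)]\<close>, and a truncation at level \<open>2\<^sup>j\<close> for the first \<open>2\<^sup>j\<close> steps shows
  that the averages of \<open>V\<^sup>r(X\<^sub>k)\<close> are almost surely bounded for every \<open>r < 1\<close>. This disposes
  of the unbounded part of \<open>f\<close>, so \<open>f\<close> may be taken bounded. For bounded centred \<open>f\<close>, the partial
  sum \<open>g\<^sub>\<theta> = \<Sum>i<N. P\<^sub>\<theta>\<^sup>i f\<close> solves the Poisson equation up to \<open>P\<^sub>\<theta>\<^sup>N f\<close>, which by
  Hairer and Mattingly's contraction argument is at most \<open>\<epsilon> V\<^sup>r\<close> uniformly over \<open>\<theta> \<in> \<K> q\<close>. The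
  function \<open>g\<^sub>\<theta>\<close> is bounded and Lipschitz in \<open>\<theta>\<close>, so the martingale part averages out, and the
  increments of \<open>\<theta>\<close> contribute \<open>O(\<gamma>\<^sub>k V\<^sup>\<beta>(X\<^sub>k\<^sub>+\<^sub>1))\<close>, whose averages vanish because
  \<open>\<gamma>\<^sub>k \<rightarrow> 0\<close>.
\<close>

section \<open>Orthogonal random variables\<close>

text \<open>The drift supplies a bound on the first moment of V(X_k) only. For r > 1/2 the function
  V^r need not be square integrable, so a direct variance argument fails. Truncated at 2^j, it has a
  second moment of order 2^(j(2 - 1/r)); over 2^j steps the normalised variance and the expected
  number of exceedances are then both of order 2^(-j(1/r - 1)), summable because r < 1. Almost sure
  boundedness of the averages of V^r is enough, since they always come with a factor that can be
  made small: the tail factor of the truncated \<open>f\<close>, the error in the approximate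
  Poisson equation, or \<gamma>_k. The full Poisson solution would be controlled only by a power of
  V, and so would its variation in \<theta>. A finite partial sum gets boundedness and the Lipschitz
  property from the case r = 0 of the kernel Lipschitz condition. The price is a remainder, which
  must be small uniformly over the compact set because \<theta> moves at every step; hence no
  ergodicity constant may depend on the individual kernel.\<close>

lemma integral_measurable_subprob_algebra2:
  fixes f :: "'a \<Rightarrow> 'b \<Rightarrow> 'c::{banach, second_countable_topology}"
  assumes f[measurable]: "(\<lambda>(x, y). f x y) \<in> borel_measurable (M \<Otimes>\<^sub>M N)"
    and L[measurable]: "L \<in> M \<rightarrow>\<^sub>M subprob_algebra N"
  shows "(\<lambda>x. \<integral>y. f x y \<partial>L x) \<in> borel_measurable M"
proof -
  note measurable_distr2[measurable]
  \<comment> \<open>Pushing \<open>L x\<close> forward to the pair (x, y) moves the dependence on x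
    from the integrand into a measure that varies measurably with x.\<close>
  have "(\<lambda>x. integral\<^sup>L (distr (L x) (M \<Otimes>\<^sub>M N) (\<lambda>y. (x, y))) (\<lambda>(x, y). f x y)) \<in> borel_measurable M"
    by measurable
  then show ?thesis
    by (rule measurable_cong[THEN iffD1, rotated]) (simp add: integral_distr)
qed

lemma (in prob_space) abs_expectation_le_const:
  fixes X :: "'a \<Rightarrow> real"
  assumes bound: "\<And>\<omega>. \<omega> \<in> space M \<Longrightarrow> \<bar>X \<omega>\<bar> \<le> c"
  shows "\<bar>expectation X\<bar> \<le> c"
proof (cases "integrable M X")
  case True
  have "\<bar>expectation X\<bar> \<le> expectation (\<lambda>\<omega>. \<bar>X \<omega>\<bar>)" by (rule integral_abs_bound)
  also have "\<dots> \<le> expectation (\<lambda>\<omega>. c)"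
    using True bound by (intro integral_mono) auto
  finally show ?thesis by (simp add: prob_space)
next
  \<comment> \<open>Without integrability the Bochner integral is 0 by convention, and 0 \<le> c
    because the space has a point.\<close>
  case False
  obtain \<omega> where "\<omega> \<in> space M" using not_empty by auto
  from bound[OF this] False show ?thesis by (simp add: not_integrable_integral_eq)
qed

text \<open>By Tonelli the total has finite mean, so it is almost surely finite. This takes the
  place of Borel-Cantelli: the terms are eventually below any positive level.\<close>

lemma AE_summable_of_summable_expectation:
  fixes Y :: "nat \<Rightarrow> 'a \<Rightarrow> real"
  assumes [measurable]: "\<And>j. Y j \<in> borel_measurable M"
    and nonneg: "\<And>j \<omega>. \<omega> \<in> space M \<Longrightarrow> 0 \<le> Y j \<omega>"
    and bound: "\<And>j. (\<integral>\<^sup>+\<omega>. ennreal (Y j \<omega>) \<partial>M) \<le> ennreal (a j)" "\<And>j. 0 \<le> a j" "summable a"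
  shows "AE \<omega> in M. summable (\<lambda>j. Y j \<omega>)"
proof -
  have "(\<integral>\<^sup>+\<omega>. (\<Sum>j. ennreal (Y j \<omega>)) \<partial>M) = (\<Sum>j. \<integral>\<^sup>+\<omega>. ennreal (Y j \<omega>) \<partial>M)"
    by (rule nn_integral_suminf) simp
  also have "\<dots> \<le> (\<Sum>j. ennreal (a j))"
    by (rule suminf_le[OF bound(1)]) auto
  also have "\<dots> = ennreal (\<Sum>j. a j)"
    using bound by (intro suminf_ennreal2)
  finally have "(\<integral>\<^sup>+\<omega>. (\<Sum>j. ennreal (Y j \<omega>)) \<partial>M) \<noteq> \<infinity>"
    by (auto simp: top_unique)
  then have "AE \<omega> in M. (\<Sum>j. ennreal (Y j \<omega>)) \<noteq> \<infinity>"
    by (intro nn_integral_noteq_infinite) simp_all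
  then show ?thesis
    using AE_space
    by eventually_elim (rule summable_suminf_not_top, use nonneg in auto)
qed

lemma (in prob_space) expectation_power2_sum_orthogonal:
  fixes X :: "nat \<Rightarrow> 'a \<Rightarrow> real"
  assumes [measurable]: "\<And>k. X k \<in> borel_measurable M"
    and bound: "\<And>k \<omega>. \<omega> \<in> space M \<Longrightarrow> \<bar>X k \<omega>\<bar> \<le> c"
    and orth: "\<And>j k. j < k \<Longrightarrow> expectation (\<lambda>\<omega>. X j \<omega> * X k \<omega>) = 0"
  shows "expectation (\<lambda>\<omega>. (\<Sum>k<n. X k \<omega>)\<^sup>2) = (\<Sum>k<n. expectation (\<lambda>\<omega>. (X k \<omega>)\<^sup>2))"
proof -
  have int: "integrable M (\<lambda>\<omega>. X j \<omega> * X k \<omega>)" for j k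
  proof (rule integrable_const_bound[where B="c * c"])
    show "AE \<omega> in M. norm (X j \<omega> * X k \<omega>) \<le> c * c"
    proof (rule AE_I2)
      fix \<omega> assume "\<omega> \<in> space M"
      from bound[OF this, of j] bound[OF this, of k]
      show "norm (X j \<omega> * X k \<omega>) \<le> c * c"
        by (auto simp: abs_mult intro!: mult_mono)
    qed
  qed simp
  have "expectation (\<lambda>\<omega>. (\<Sum>k<n. X k \<omega>)\<^sup>2) = (\<Sum>j<n. \<Sum>k<n. expectation (\<lambda>\<omega>. X j \<omega> * X k \<omega>))"
    by (simp add: power2_eq_square sum_product int)
  also have "\<dots> = (\<Sum>j<n. \<Sum>k<n. if k = j then expectation (\<lambda>\<omega>. (X j \<omega>)\<^sup>2) else 0)"
  proof (intro sum.cong refl)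
    fix j k
    have "expectation (\<lambda>\<omega>. X j \<omega> * X k \<omega>) = 0" if "j \<noteq> k"
      using orth[of j k] orth[of k j] that by (cases "j < k") (auto simp: mult.commute)
    then show "expectation (\<lambda>\<omega>. X j \<omega> * X k \<omega>) = (if k = j then expectation (\<lambda>\<omega>. (X j \<omega>)\<^sup>2) else 0)"
      by (auto simp: power2_eq_square)
  qed
  also have "\<dots> = (\<Sum>k<n. expectation (\<lambda>\<omega>. (X k \<omega>)\<^sup>2))"
    by simp
  finally show ?thesis .
qed

lemma filterlim_floor_sqrt: "filterlim floor_sqrt at_top sequentially"
  unfolding filterlim_at_top eventually_sequentially
proof
  fix m
  show "\<exists>N. \<forall>n\<ge>N. m \<le> floor_sqrt n"
    by (rule exI[of _ "m\<^sup>2"]) (simp add: le_floor_sqrt_iff)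
qed

text \<open>Chebyshev's inequality is summable along the squares, and the gaps between consecutive
  squares are negligible because the summands are bounded.\<close>

lemma (in prob_space) bounded_orthogonal_slln:
  fixes X :: "nat \<Rightarrow> 'a \<Rightarrow> real"
  assumes [measurable]: "\<And>k. X k \<in> borel_measurable M"
    and bound: "\<And>k \<omega>. \<omega> \<in> space M \<Longrightarrow> \<bar>X k \<omega>\<bar> \<le> c"
    and orth: "\<And>j k. j < k \<Longrightarrow> expectation (\<lambda>\<omega>. X j \<omega> * X k \<omega>) = 0"
  shows "AE \<omega> in M. (\<lambda>n. (\<Sum>k<n. X k \<omega>) / real n) \<longlonglongrightarrow> 0"
proof -
  define S where "S n \<omega> = (\<Sum>k<n. X k \<omega>)" for n \<omega>
  have [measurable]: "S n \<in> borel_measurable M" for n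
    unfolding S_def by measurable
  have S_bound: "\<bar>S n \<omega>\<bar> \<le> real n * c" if "\<omega> \<in> space M" for n \<omega>
    unfolding S_def using sum_bounded_above[of "{..<n}" "\<lambda>k. \<bar>X k \<omega>\<bar>" c, OF bound[OF that]]
    by (intro order_trans[OF sum_abs]) simp
  have sq: "a\<^sup>2 \<le> b\<^sup>2" if "\<bar>a\<bar> \<le> b" for a b :: real
    using power_mono[OF that, of 2] by simp
  have int: "integrable M (\<lambda>\<omega>. (S n \<omega>)\<^sup>2)" for n
  proof (rule integrable_const_bound[where B="(real n * c)\<^sup>2"])
    show "AE \<omega> in M. norm ((S n \<omega>)\<^sup>2) \<le> (real n * c)\<^sup>2"
      using sq[OF S_bound[of _ n]] by (intro AE_I2) simp
  qed simp
  have intX: "integrable M (\<lambda>\<omega>. (X k \<omega>)\<^sup>2)" for k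
  proof (rule integrable_const_bound[where B="c\<^sup>2"])
    show "AE \<omega> in M. norm ((X k \<omega>)\<^sup>2) \<le> c\<^sup>2"
      using sq[OF bound[of _ k]] by (intro AE_I2) simp
  qed simp
  have ES: "expectation (\<lambda>\<omega>. (S n \<omega>)\<^sup>2) \<le> real n * c\<^sup>2" for n
  proof -
    have "expectation (\<lambda>\<omega>. (S n \<omega>)\<^sup>2) = (\<Sum>k<n. expectation (\<lambda>\<omega>. (X k \<omega>)\<^sup>2))"
      unfolding S_def by (rule expectation_power2_sum_orthogonal[OF assms])
    also have "\<dots> \<le> (\<Sum>k<n. c\<^sup>2)"
    proof (rule sum_mono)
      fix k
      have "expectation (\<lambda>\<omega>. (X k \<omega>)\<^sup>2) \<le> expectation (\<lambda>\<omega>. c\<^sup>2)"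
        using sq[OF bound[of _ k]] intX by (intro integral_mono) auto
      then show "expectation (\<lambda>\<omega>. (X k \<omega>)\<^sup>2) \<le> c\<^sup>2" by (simp add: prob_space)
    qed
    finally show ?thesis by simp
  qed
  have "AE \<omega> in M. summable (\<lambda>j. (S ((Suc j)\<^sup>2) \<omega> / real ((Suc j)\<^sup>2))\<^sup>2)"
  proof (rule AE_summable_of_summable_expectation)
    fix j
    let ?n = "(Suc j)\<^sup>2"
    have "(\<integral>\<^sup>+\<omega>. ennreal ((S ?n \<omega> / real ?n)\<^sup>2) \<partial>M) = ennreal (expectation (\<lambda>\<omega>. (S ?n \<omega> / real ?n)\<^sup>2))"
      using int[of ?n] by (intro nn_integral_eq_integral) (simp_all add: power_divide)
    also have "expectation (\<lambda>\<omega>. (S ?n \<omega> / real ?n)\<^sup>2) \<le> real ?n * c\<^sup>2 / (real ?n)\<^sup>2"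
      using ES[of ?n] by (simp add: power_divide divide_right_mono)
    also have "\<dots> = c\<^sup>2 * inverse (real ?n)"
      by (simp only: power2_eq_square[of "real ?n"]) (simp del: of_nat_power of_nat_Suc add: divide_inverse)
    finally show "(\<integral>\<^sup>+\<omega>. ennreal ((S ?n \<omega> / real ?n)\<^sup>2) \<partial>M) \<le> ennreal (c\<^sup>2 * inverse (real ((Suc j)\<^sup>2)))"
      by (simp add: ennreal_leI)
  next
    show "summable (\<lambda>j. c\<^sup>2 * inverse (real ((Suc j)\<^sup>2)))"
      unfolding of_nat_power by (intro summable_mult summable_Suc_iff[of "\<lambda>j. inverse (real j ^ 2)", THEN iffD2] inverse_power_summable) simp
  qed auto
  then show ?thesis
    using AE_space
  proof eventually_elim
    fix \<omega> assume sm: "summable (\<lambda>j. (S ((Suc j)\<^sup>2) \<omega> / real ((Suc j)\<^sup>2))\<^sup>2)" and \<omega>: "\<omega> \<in> space M"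
    have "(\<lambda>j. (S ((Suc j)\<^sup>2) \<omega> / real ((Suc j)\<^sup>2))\<^sup>2) \<longlonglongrightarrow> 0"
      by (rule summable_LIMSEQ_zero[OF sm])
    then have "(\<lambda>j. \<bar>S ((Suc j)\<^sup>2) \<omega> / real ((Suc j)\<^sup>2)\<bar>) \<longlonglongrightarrow> 0"
      using tendsto_real_sqrt by fastforce
    then have sq: "(\<lambda>j. \<bar>S (j\<^sup>2) \<omega> / real (j\<^sup>2)\<bar>) \<longlonglongrightarrow> 0"
      by (subst (asm) filterlim_sequentially_Suc)
    have inv: "(\<lambda>j. 2 * c / real j) \<longlonglongrightarrow> 0" by real_asymp
    have "(\<lambda>j. \<bar>S (j\<^sup>2) \<omega> / real (j\<^sup>2)\<bar> + 2 * c / real j) \<longlonglongrightarrow> 0"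
      using tendsto_add[OF sq inv] by simp
    from filterlim_compose[OF this filterlim_floor_sqrt]
    have lim: "(\<lambda>n. \<bar>S ((floor_sqrt n)\<^sup>2) \<omega> / real ((floor_sqrt n)\<^sup>2)\<bar> + 2 * c / real (floor_sqrt n)) \<longlonglongrightarrow> 0" .
    have "\<forall>\<^sub>F n in sequentially. norm (S n \<omega> / real n) \<le>
        \<bar>S ((floor_sqrt n)\<^sup>2) \<omega> / real ((floor_sqrt n)\<^sup>2)\<bar> + 2 * c / real (floor_sqrt n)"
      using eventually_gt_at_top[of 0]
    proof eventually_elim
      fix n :: nat assume n: "0 < n"
      define j where "j = floor_sqrt n"
      \<comment> \<open>At most 2j summands lie between j^2 and n, so the two partial sums differ by
        at most 2jc; dividing by n \<ge> j^2 leaves 2c/j.\<close>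
      have j: "0 < j" "j\<^sup>2 \<le> n" "n \<le> j\<^sup>2 + 2 * j"
        using n Suc_floor_sqrt_power2_gt[of n] floor_sqrt_power2_le[of n]
        by (auto simp: j_def power2_eq_square simp del: floor_sqrt_power2_le)
      have c: "0 \<le> c" using bound[OF \<omega>, of 0] by linarith
      have "S n \<omega> = S (j\<^sup>2) \<omega> + (\<Sum>k\<in>{j\<^sup>2..<n}. X k \<omega>)"
        unfolding S_def using sum.atLeastLessThan_concat[of 0 "j\<^sup>2" n "\<lambda>k. X k \<omega>"] j
        by (simp add: atLeast0LessThan)
      moreover have "\<bar>\<Sum>k\<in>{j\<^sup>2..<n}. X k \<omega>\<bar> \<le> (\<Sum>k\<in>{j\<^sup>2..<n}. c)"
        using bound[OF \<omega>] by (intro order_trans[OF sum_abs] sum_mono)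
      moreover have "(\<Sum>k\<in>{j\<^sup>2..<n}. c) \<le> 2 * real j * c"
      proof -
        have "real n \<le> real (j\<^sup>2 + 2 * j)" using j(3) by (simp only: of_nat_le_iff)
        then show ?thesis using j c by (auto simp: of_nat_diff intro!: mult_right_mono)
      qed
      ultimately have "\<bar>S n \<omega>\<bar> \<le> \<bar>S (j\<^sup>2) \<omega>\<bar> + 2 * real j * c" by linarith
      then have "\<bar>S n \<omega>\<bar> / real n \<le> (\<bar>S (j\<^sup>2) \<omega>\<bar> + 2 * real j * c) / real (j\<^sup>2)"
        using j c n by (intro frac_le) auto
      also have "\<dots> = \<bar>S (j\<^sup>2) \<omega> / real (j\<^sup>2)\<bar> + 2 * c / real j"
        using j by (simp add: field_simps power2_eq_square)
      finally show "norm (S n \<omega> / real n) \<le> \<bar>S ((floor_sqrt n)\<^sup>2) \<omega> / real ((floor_sqrt n)\<^sup>2)\<bar> + 2 * c / real (floor_sqrt n)"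
        by (simp add: j_def)
    qed
    from Lim_null_comparison[OF this lim]
    show "(\<lambda>n. (\<Sum>k<n. X k \<omega>) / real n) \<longlonglongrightarrow> 0"
      by (simp add: S_def)
  qed
qed

section \<open>Markov chains on the sequence space\<close>

locale markov_chain =
  fixes M :: "'z measure" and R :: "'z \<Rightarrow> 'z measure" and z :: 'z
  assumes R: "R \<in> M \<rightarrow>\<^sub>M prob_algebra M" and z: "z \<in> space M"
begin

sublocale IT: Ionescu_Tulcea "chain_step M R z" "\<lambda>_. M"
  by (rule Ionescu_Tulcea_chain_step[OF R z])

abbreviation law :: "(nat \<Rightarrow> 'z) measure" where
  "law \<equiv> chain_law M R z"

lemma sets_law [simp, measurable_cong]: "sets law = sets (PiM UNIV (\<lambda>_. M))"
  by (simp add: chain_law_def)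

lemma space_law: "space law = space (PiM UNIV (\<lambda>_. M))"
  by (simp add: chain_law_def)

lemma space_law_coord: "\<omega> \<in> space law \<Longrightarrow> \<omega> n \<in> space M"
  by (auto simp: space_law space_PiM)

lemma measurable_law_coord [measurable]: "(\<lambda>\<omega>. \<omega> n) \<in> law \<rightarrow>\<^sub>M M"
  by measurable

lemma measurable_restrict_law [measurable]: "(\<lambda>\<omega>. restrict \<omega> J) \<in> law \<rightarrow>\<^sub>M PiM J (\<lambda>_. M)"
  by (rule measurable_restrict) measurable

text \<open>\<open>CI\<close> on an index set J projects \<open>C\<close> at time
  \<open>up_to J\<close>, the end of the shortest initial segment that contains J. For J = {0..<n}
  that end is n, so the projection is the identity.\<close>

lemma distr_law_restrict:
  "distr law (PiM {0..<n} (\<lambda>_. M)) (\<lambda>\<omega>. restrict \<omega> {0..<n}) = IT.C 0 n (\<lambda>_. undefined)"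
proof -
  have "IT.up_to {0..<n} \<le> n" "{0..<n} \<subseteq> {0..<IT.up_to {0..<n}}"
    using IT.up_to[of "{0..<n}"] by (simp_all add: IT.up_to_iff_Ico)
  then have n: "IT.up_to {0..<n} = n"
    by (cases "n = 0") auto
  have "distr law (PiM {0..<n} (\<lambda>_. M)) (\<lambda>\<omega>. restrict \<omega> {0..<n}) = IT.CI {0..<n}"
    unfolding chain_law_def by (rule IT.distr_lim) simp
  also have "\<dots> = IT.C 0 n (\<lambda>_. undefined)"
    unfolding IT.CI_def n using IT.distr_C[of n n "\<lambda>_. undefined" 0] by simp
  finally show ?thesis .
qed

text \<open>A marginal has the same total mass, so it suffices to look at the one on the empty index
  set.\<close>

sublocale prob_space law
proof (rule prob_space_distrD)
  show "(\<lambda>\<omega>. restrict \<omega> {0..<0}) \<in> law \<rightarrow>\<^sub>M PiM {0..<0} (\<lambda>_. M)" by measurable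
  show "prob_space (distr law (PiM {0..<0} (\<lambda>_. M)) (\<lambda>\<omega>. restrict \<omega> {0..<0}))"
    unfolding distr_law_restrict by (rule IT.prob_space_C) simp
qed

lemma prob_space_R: "x \<in> space M \<Longrightarrow> prob_space (R x)"
  and sets_R: "x \<in> space M \<Longrightarrow> sets (R x) = sets M"
  and space_R: "x \<in> space M \<Longrightarrow> space (R x) = space M"
  using measurable_space[OF R] by (auto simp: space_prob_algebra dest: sets_eq_imp_space_eq)

lemma measurable_R [measurable]: "R \<in> M \<rightarrow>\<^sub>M subprob_algebra M"
  using R by (rule measurable_prob_algebraD)

text \<open>The Markov property: the law of the first k + 2 coordinates arises from that of the
  first k + 1 by one draw from \<open>R\<close> at the last of them. All conditioning on the past
  goes through this identity, without a filtration.\<close>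

lemma nn_integral_law_step:
  assumes [measurable]: "\<Phi> \<in> borel_measurable (PiM {0..<Suc k} (\<lambda>_. M) \<Otimes>\<^sub>M M)"
  shows "(\<integral>\<^sup>+\<omega>. \<Phi> (restrict \<omega> {0..<Suc k}, \<omega> (Suc k)) \<partial>law) =
    (\<integral>\<^sup>+\<omega>. (\<integral>\<^sup>+y. \<Phi> (restrict \<omega> {0..<Suc k}, y) \<partial>R (\<omega> k)) \<partial>law)"
proof -
  let ?C = "\<lambda>n. IT.C 0 n (\<lambda>_. undefined)" and ?P = "\<lambda>n. PiM {0..<n} (\<lambda>_. M)"
  have u: "(\<lambda>_. undefined) \<in> space (PiM {0..<0::nat} (\<lambda>_. M))" by simp
  have sets_C[measurable_cong]: "sets (?C n) = sets (?P n)" for n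
    using IT.sets_C[OF u] by simp
  have k[measurable]: "(\<lambda>x. x k) \<in> ?P (Suc k) \<rightarrow>\<^sub>M M" "(\<lambda>x. x (Suc k)) \<in> ?P (Suc (Suc k)) \<rightarrow>\<^sub>M M"
    by (auto intro!: measurable_component_singleton)
  have restr: "(\<lambda>x. restrict x {0..<Suc k}) \<in> ?P (Suc (Suc k)) \<rightarrow>\<^sub>M ?P (Suc k)"
    by (rule measurable_restrict_subset) auto
  have \<Phi>': "(\<lambda>x. \<Phi> (restrict x {0..<Suc k}, x (Suc k))) \<in> borel_measurable (?P (Suc (Suc k)))"
    by (intro measurable_compose[OF measurable_Pair assms] restr k)
  have eP: "IT.eP (Suc k) \<in> ?C (Suc k) \<rightarrow>\<^sub>M subprob_algebra (?P (Suc (Suc k)))"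
    unfolding measurable_cong_sets[OF sets_C refl] by (rule IT.measurable_eP)
  have [measurable]: "(\<lambda>x. \<integral>\<^sup>+y. \<Phi> (x, y) \<partial>R (x k)) \<in> borel_measurable (?P (Suc k))"
    by (rule nn_integral_measurable_subprob_algebra2[where N=M]) measurable
  have "(\<integral>\<^sup>+\<omega>. \<Phi> (restrict \<omega> {0..<Suc k}, \<omega> (Suc k)) \<partial>law) =
      (\<integral>\<^sup>+x. \<Phi> (restrict x {0..<Suc k}, x (Suc k)) \<partial>distr law (?P (Suc (Suc k))) (\<lambda>\<omega>. restrict \<omega> {0..<Suc (Suc k)}))"
    by (subst nn_integral_distr) (auto intro!: \<Phi>' nn_integral_cong arg_cong[where f=\<Phi>] simp: fun_eq_iff)
  also have "\<dots> = (\<integral>\<^sup>+x. \<integral>\<^sup>+y. \<Phi> (restrict y {0..<Suc k}, y (Suc k)) \<partial>IT.eP (Suc k) x \<partial>?C (Suc k))"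
    unfolding distr_law_restrict IT.C.simps(2)[of 0 "Suc k"] add_0
    by (rule nn_integral_bind[OF \<Phi>' eP])
  also have "\<dots> = (\<integral>\<^sup>+x. \<integral>\<^sup>+y. \<Phi> (x, y) \<partial>R (x k) \<partial>?C (Suc k))"
  proof (rule nn_integral_cong)
    fix x assume "x \<in> space (?C (Suc k))"
    then have x: "x \<in> space (?P (Suc k))"
      using sets_eq_imp_space_eq[OF sets_C, of "Suc k"] by (simp del: IT.C.simps)
    then have "restrict (x(Suc k := y)) {0..<Suc k} = x" for y
      by (auto simp: space_PiM PiE_iff extensional_def fun_eq_iff)
    then show "(\<integral>\<^sup>+y. \<Phi> (restrict y {0..<Suc k}, y (Suc k)) \<partial>IT.eP (Suc k) x) = (\<integral>\<^sup>+y. \<Phi> (x, y) \<partial>R (x k))"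
      by (subst IT.nn_integral_eP[OF x]) (simp_all add: chain_step_def)
  qed
  also have "\<dots> = (\<integral>\<^sup>+\<omega>. (\<integral>\<^sup>+y. \<Phi> (restrict \<omega> {0..<Suc k}, y) \<partial>R (\<omega> k)) \<partial>law)"
    unfolding distr_law_restrict[symmetric]
    by (subst nn_integral_distr) auto
  finally show ?thesis .
qed

text \<open>Adding the bound c makes \<Phi> nonnegative, so the identity for nonnegative functions
  applies, and c cancels on both sides.\<close>

lemma integral_law_step:
  fixes \<Phi> :: "(nat \<Rightarrow> 'z) \<times> 'z \<Rightarrow> real"
  assumes [measurable]: "\<Phi> \<in> borel_measurable (PiM {0..<Suc k} (\<lambda>_. M) \<Otimes>\<^sub>M M)"
    and bound: "\<And>p. p \<in> space (PiM {0..<Suc k} (\<lambda>_. M) \<Otimes>\<^sub>M M) \<Longrightarrow> \<bar>\<Phi> p\<bar> \<le> c"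
  shows "(\<integral>\<omega>. \<Phi> (restrict \<omega> {0..<Suc k}, \<omega> (Suc k)) \<partial>law) =
    (\<integral>\<omega>. (\<integral>y. \<Phi> (restrict \<omega> {0..<Suc k}, y) \<partial>R (\<omega> k)) \<partial>law)" (is "?l = ?r")
proof -
  let ?I = "\<lambda>\<omega>. \<integral>y. \<Phi> (restrict \<omega> {0..<Suc k}, y) \<partial>R (\<omega> k)"
  have sp: "(restrict \<omega> {0..<Suc k}, y) \<in> space (PiM {0..<Suc k} (\<lambda>_. M) \<Otimes>\<^sub>M M)"
    if "\<omega> \<in> space law" "y \<in> space M" for \<omega> y
    using that by (auto simp: space_pair_measure space_PiM space_law)
  have nonneg: "0 \<le> \<Phi> (restrict \<omega> {0..<Suc k}, y) + c" if "\<omega> \<in> space law" "y \<in> space M" for \<omega> y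
    using bound[OF sp[OF that]] by linarith
  have [measurable]: "?I \<in> borel_measurable law"
    by (rule integral_measurable_subprob_algebra2[where N=M]) measurable
  have inner: "(\<integral>\<^sup>+y. ennreal (\<Phi> (restrict \<omega> {0..<Suc k}, y) + c) \<partial>R (\<omega> k)) = ennreal (?I \<omega> + c)"
    and I_bound: "\<bar>?I \<omega>\<bar> \<le> c" if \<omega>: "\<omega> \<in> space law" for \<omega>
  proof -
    have \<omega>k: "\<omega> k \<in> space M" using \<omega> by (rule space_law_coord)
    interpret Rk: prob_space "R (\<omega> k)" by (rule prob_space_R[OF \<omega>k])
    note sets_R[OF \<omega>k, measurable_cong] space_R[OF \<omega>k, simp]
    have "restrict \<omega> {0..<Suc k} \<in> space (PiM {0..<Suc k} (\<lambda>_. M))"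
      using \<omega> by (auto simp: space_PiM space_law)
    then have "(\<lambda>y. \<Phi> (restrict \<omega> {0..<Suc k}, y)) \<in> borel_measurable M"
      by (intro measurable_compose[OF measurable_Pair1' assms(1)])
    then have [measurable]: "(\<lambda>y. \<Phi> (restrict \<omega> {0..<Suc k}, y)) \<in> borel_measurable (R (\<omega> k))"
      unfolding measurable_cong_sets[OF sets_R[OF \<omega>k] refl] .
    have int: "integrable (R (\<omega> k)) (\<lambda>y. \<Phi> (restrict \<omega> {0..<Suc k}, y))"
      using bound[OF sp[OF \<omega>]] by (intro Rk.integrable_const_bound[where B=c] AE_I2) auto
    show "(\<integral>\<^sup>+y. ennreal (\<Phi> (restrict \<omega> {0..<Suc k}, y) + c) \<partial>R (\<omega> k)) = ennreal (?I \<omega> + c)"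
      using int nonneg[OF \<omega>]
      by (subst nn_integral_eq_integral) (auto simp: Rk.prob_space[unfolded space_R[OF \<omega>k]])
    show "\<bar>?I \<omega>\<bar> \<le> c"
      using bound[OF sp[OF \<omega>]] by (intro Rk.abs_expectation_le_const) auto
  qed
  have I_nonneg: "0 \<le> ?I \<omega> + c" if "\<omega> \<in> space law" for \<omega>
    using I_bound[OF that] by linarith
  have int: "integrable law (\<lambda>\<omega>. \<Phi> (restrict \<omega> {0..<Suc k}, \<omega> (Suc k)))"
    using bound[OF sp] by (intro integrable_const_bound[where B=c] AE_I2) (auto simp: space_law_coord)
  have intI: "integrable law ?I"
    using I_bound by (intro integrable_const_bound[where B=c] AE_I2) auto
  have "ennreal (?l + c) = (\<integral>\<^sup>+\<omega>. ennreal (\<Phi> (restrict \<omega> {0..<Suc k}, \<omega> (Suc k)) + c) \<partial>law)"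
    using int nonneg by (subst nn_integral_eq_integral) (auto simp: prob_space space_law_coord)
  also have "\<dots> = (\<integral>\<^sup>+\<omega>. (\<integral>\<^sup>+y. ennreal (\<Phi> (restrict \<omega> {0..<Suc k}, y) + c) \<partial>R (\<omega> k)) \<partial>law)"
    by (rule nn_integral_law_step[of "\<lambda>p. ennreal (\<Phi> p + c)"]) measurable
  also have "\<dots> = (\<integral>\<^sup>+\<omega>. ennreal (?I \<omega> + c) \<partial>law)"
    by (intro nn_integral_cong inner)
  also have "\<dots> = ennreal (?r + c)"
    using intI I_nonneg by (subst nn_integral_eq_integral) (auto simp: prob_space)
  finally have eq: "ennreal (?l + c) = ennreal (?r + c)" .
  have "\<bar>?l\<bar> \<le> c" "\<bar>?r\<bar> \<le> c"
    using bound[OF sp] I_bound by (auto intro!: abs_expectation_le_const simp: space_law_coord)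
  then have "0 \<le> ?l + c" "0 \<le> ?r + c" by auto
  then show ?thesis using eq by simp
qed

text \<open>From each state the violations of \<open>T\<close> have mass zero, and the Markov
  property integrates this to zero under the law. It carries properties of a single transition over
  to almost every path.\<close>

lemma AE_law_step:
  assumes [measurable]: "Measurable.pred (M \<Otimes>\<^sub>M M) (\<lambda>p. T (fst p) (snd p))"
    and T: "\<And>x. x \<in> space M \<Longrightarrow> AE y in R x. T x y"
  shows "AE \<omega> in law. \<forall>n. T (\<omega> n) (\<omega> (Suc n))"
  unfolding AE_all_countable
proof
  fix n :: nat
  have "(\<lambda>p. (fst p n, snd p)) \<in> PiM {0..<Suc n} (\<lambda>_. M) \<Otimes>\<^sub>M M \<rightarrow>\<^sub>M M \<Otimes>\<^sub>M M"
    by (intro measurable_Pair measurable_snd measurable_compose[OF measurable_fst measurable_component_singleton]) simp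
  from measurable_compose[OF this assms(1)]
  have [measurable]: "Measurable.pred (PiM {0..<Suc n} (\<lambda>_. M) \<Otimes>\<^sub>M M) (\<lambda>p. T (fst p n) (snd p))"
    by simp
  let ?\<Phi> = "\<lambda>p. indicator {p. \<not> T (fst p n) (snd p)} p :: ennreal"
  have "(\<integral>\<^sup>+\<omega>. ?\<Phi> (restrict \<omega> {0..<Suc n}, \<omega> (Suc n)) \<partial>law) =
      (\<integral>\<^sup>+\<omega>. (\<integral>\<^sup>+y. ?\<Phi> (restrict \<omega> {0..<Suc n}, y) \<partial>R (\<omega> n)) \<partial>law)"
    by (rule nn_integral_law_step) measurable
  also have "\<dots> = (\<integral>\<^sup>+\<omega>. 0 \<partial>law)"
  proof (rule nn_integral_cong)
    fix \<omega> assume "\<omega> \<in> space law"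
    then have "AE y in R (\<omega> n). T (\<omega> n) y" by (intro T space_law_coord)
    then have "(\<integral>\<^sup>+y. ?\<Phi> (restrict \<omega> {0..<Suc n}, y) \<partial>R (\<omega> n)) = (\<integral>\<^sup>+y. 0 \<partial>R (\<omega> n))"
      by (intro nn_integral_cong_AE) (auto simp: indicator_def)
    then show "(\<integral>\<^sup>+y. ?\<Phi> (restrict \<omega> {0..<Suc n}, y) \<partial>R (\<omega> n)) = 0" by simp
  qed
  finally have "(\<integral>\<^sup>+\<omega>. ?\<Phi> (restrict \<omega> {0..<Suc n}, \<omega> (Suc n)) \<partial>law) = 0" by simp
  then have "AE \<omega> in law. ?\<Phi> (restrict \<omega> {0..<Suc n}, \<omega> (Suc n)) = 0"
    by (subst (asm) nn_integral_0_iff_AE) measurable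
  then show "AE \<omega> in law. T (\<omega> n) (\<omega> (Suc n))"
    by eventually_elim (auto simp: indicator_def split: if_splits)
qed

end

lemma powr_le_affine:
  fixes r u :: real
  assumes "0 \<le> r" "r \<le> 1" "0 < u"
  shows "u powr r \<le> r * u + (1 - r)"
proof -
  have "exp ((1 - r) * 0 + r * ln u) \<le> (1 - r) * exp 0 + r * exp (ln u)"
    using convex_onD[OF exp_convex, of r 0 "ln u"] assms by simp
  then show ?thesis using assms by (simp add: powr_def)
qed

text \<open>The power y^r is concave and the right-hand side is its tangent at t. Used with t the
  current value, it plays the part of Jensen's inequality: a bound affine in y can be integrated
  directly.\<close>

lemma powr_le_tangent:
  fixes r t y :: real
  assumes "0 \<le> r" "r \<le> 1" "0 < t" "0 < y"
  shows "y powr r \<le> (1 - r) * t powr r + r * t powr (r - 1) * y"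
proof -
  have "(y / t) powr r \<le> r * (y / t) + (1 - r)"
    using assms by (intro powr_le_affine) auto
  then have "(y / t) powr r * t powr r \<le> (r * (y / t) + (1 - r)) * t powr r"
    by (rule mult_right_mono) simp
  then show ?thesis
    using assms by (simp add: powr_divide powr_diff field_simps)
qed

section \<open>Martingale increments along the chain\<close>

context markov_chain
begin

text \<open>Given the history up to time k, the factor \<Psi> is fixed and the increment d has mean
  0 under the next draw. This gives the orthogonality of martingale increments.\<close>

lemma expectation_law_step_eq_0:
  fixes \<Psi> :: "(nat \<Rightarrow> 'z) \<Rightarrow> real" and d :: "'z \<times> 'z \<Rightarrow> real"
  assumes [measurable]: "\<Psi> \<in> borel_measurable (PiM {0..<Suc k} (\<lambda>_. M))" "d \<in> borel_measurable (M \<Otimes>\<^sub>M M)"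
    and \<Psi>: "\<And>x. x \<in> space (PiM {0..<Suc k} (\<lambda>_. M)) \<Longrightarrow> \<bar>\<Psi> x\<bar> \<le> c"
    and d: "\<And>p. p \<in> space (M \<Otimes>\<^sub>M M) \<Longrightarrow> \<bar>d p\<bar> \<le> c'"
    and centred: "\<And>x. x \<in> space M \<Longrightarrow> (\<integral>y. d (x, y) \<partial>R x) = 0"
  shows "expectation (\<lambda>\<omega>. \<Psi> (restrict \<omega> {0..<Suc k}) * d (\<omega> k, \<omega> (Suc k))) = 0"
proof -
  let ?\<Phi> = "\<lambda>p. \<Psi> (fst p) * d (fst p k, snd p)"
  have "(\<lambda>p. (fst p k, snd p)) \<in> PiM {0..<Suc k} (\<lambda>_. M) \<Otimes>\<^sub>M M \<rightarrow>\<^sub>M M \<Otimes>\<^sub>M M"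
    by (intro measurable_Pair measurable_snd measurable_compose[OF measurable_fst measurable_component_singleton]) simp
  from measurable_compose[OF this assms(2)]
  have [measurable]: "(\<lambda>p. d (fst p k, snd p)) \<in> borel_measurable (PiM {0..<Suc k} (\<lambda>_. M) \<Otimes>\<^sub>M M)"
    by simp
  have "expectation (\<lambda>\<omega>. ?\<Phi> (restrict \<omega> {0..<Suc k}, \<omega> (Suc k))) =
      expectation (\<lambda>\<omega>. \<integral>y. ?\<Phi> (restrict \<omega> {0..<Suc k}, y) \<partial>R (\<omega> k))"
  proof (rule integral_law_step[where c="c * c'"])
    fix p assume "p \<in> space (PiM {0..<Suc k} (\<lambda>_. M) \<Otimes>\<^sub>M M)"
    then have *: "fst p \<in> space (PiM {0..<Suc k} (\<lambda>_. M))" "(fst p k, snd p) \<in> space (M \<Otimes>\<^sub>M M)"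
      by (auto simp: space_pair_measure space_PiM)
    show "\<bar>?\<Phi> p\<bar> \<le> c * c'"
      unfolding abs_mult using \<Psi>[OF *(1)] d[OF *(2)] by (intro mult_mono) auto
  qed measurable
  also have "\<dots> = expectation (\<lambda>\<omega>. 0)"
    by (intro Bochner_Integration.integral_cong refl) (simp add: centred space_law_coord)
  finally show ?thesis by simp
qed

text \<open>Subtracting the one-step conditional mean leaves bounded, mutually orthogonal
  increments. All starting times m are covered by one null set, because the start of the final
  excursion depends on the path.\<close>

lemma slln_law_step:
  fixes u :: "'z \<times> 'z \<Rightarrow> real"
  assumes [measurable]: "u \<in> borel_measurable (M \<Otimes>\<^sub>M M)"
    and bound: "\<And>p. p \<in> space (M \<Otimes>\<^sub>M M) \<Longrightarrow> \<bar>u p\<bar> \<le> c"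
  shows "AE \<omega> in law. \<forall>m. (\<lambda>n. (\<Sum>k<n. u (\<omega> (m + k), \<omega> (Suc (m + k))) -
    (\<integral>y. u (\<omega> (m + k), y) \<partial>R (\<omega> (m + k)))) / real n) \<longlonglongrightarrow> 0"
  unfolding AE_all_countable
proof
  fix m :: nat
  define d where "d p = u p - (\<integral>y. u (fst p, y) \<partial>R (fst p))" for p
  have [measurable]: "(\<lambda>x. \<integral>y. u (x, y) \<partial>R x) \<in> borel_measurable M"
    by (rule integral_measurable_subprob_algebra2[where N=M]) measurable
  have d_meas[measurable]: "d \<in> borel_measurable (M \<Otimes>\<^sub>M M)"
    unfolding d_def by measurable
  have I: "integrable (R x) (\<lambda>y. u (x, y))" "\<bar>\<integral>y. u (x, y) \<partial>R x\<bar> \<le> c" "(\<integral>y. d (x, y) \<partial>R x) = 0"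
    if x: "x \<in> space M" for x
  proof -
    interpret Rx: prob_space "R x" by (rule prob_space_R[OF x])
    note sets_R[OF x, measurable_cong] space_R[OF x, simp]
    have "(\<lambda>y. u (x, y)) \<in> borel_measurable M"
      using x by measurable
    then have [measurable]: "(\<lambda>y. u (x, y)) \<in> borel_measurable (R x)"
      unfolding measurable_cong_sets[OF sets_R[OF x] refl] .
    show int: "integrable (R x) (\<lambda>y. u (x, y))"
      using bound x by (intro Rx.integrable_const_bound[where B=c] AE_I2) (auto simp: space_pair_measure)
    show "\<bar>\<integral>y. u (x, y) \<partial>R x\<bar> \<le> c"
      using bound x by (intro Rx.abs_expectation_le_const) (auto simp: space_pair_measure)
    show "(\<integral>y. d (x, y) \<partial>R x) = 0"
      using int by (simp add: d_def Rx.prob_space[unfolded space_R[OF x]])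
  qed
  have d_bound: "\<bar>d p\<bar> \<le> 2 * c" if "p \<in> space (M \<Otimes>\<^sub>M M)" for p
    using bound[OF that] I(2)[of "fst p"] that by (auto simp: d_def space_pair_measure abs_le_iff)
  have "AE \<omega> in law. (\<lambda>n. (\<Sum>k<n. d (\<omega> (m + k), \<omega> (Suc (m + k)))) / real n) \<longlonglongrightarrow> 0"
  proof (rule bounded_orthogonal_slln)
    fix k show "(\<lambda>\<omega>. d (\<omega> (m + k), \<omega> (Suc (m + k)))) \<in> borel_measurable law"
      by measurable
  next
    fix k \<omega> assume "\<omega> \<in> space law"
    then show "\<bar>d (\<omega> (m + k), \<omega> (Suc (m + k)))\<bar> \<le> 2 * c"
      by (intro d_bound) (auto simp: space_pair_measure space_law_coord)
  next
    fix j k :: nat assume jk: "j < k"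
    \<comment> \<open>Since j < k, the earlier increment reads coordinates up to m + j + 1 \<le> m +
      k only, so it belongs to the past of the later one.\<close>
    let ?\<Psi> = "\<lambda>x. d (x (m + j), x (Suc (m + j)))"
    have "expectation (\<lambda>\<omega>. ?\<Psi> (restrict \<omega> {0..<Suc (m + k)}) * d (\<omega> (m + k), \<omega> (Suc (m + k)))) = 0"
    proof (rule expectation_law_step_eq_0)
      have "(\<lambda>x. (x (m + j), x (Suc (m + j)))) \<in> PiM {0..<Suc (m + k)} (\<lambda>_. M) \<rightarrow>\<^sub>M M \<Otimes>\<^sub>M M"
        using jk by (intro measurable_Pair measurable_component_singleton) auto
      from measurable_compose[OF this d_meas]
      show "?\<Psi> \<in> borel_measurable (PiM {0..<Suc (m + k)} (\<lambda>_. M))" .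
      show "\<bar>?\<Psi> x\<bar> \<le> 2 * c" if "x \<in> space (PiM {0..<Suc (m + k)} (\<lambda>_. M))" for x
        using that jk by (intro d_bound) (auto simp: space_pair_measure space_PiM PiE_iff)
    qed (use d_bound I in auto)
    then show "expectation (\<lambda>\<omega>. d (\<omega> (m + j), \<omega> (Suc (m + j))) * d (\<omega> (m + k), \<omega> (Suc (m + k)))) = 0"
      using jk by simp
  qed
  then show "AE \<omega> in law. (\<lambda>n. (\<Sum>k<n. u (\<omega> (m + k), \<omega> (Suc (m + k))) -
    (\<integral>y. u (\<omega> (m + k), y) \<partial>R (\<omega> (m + k)))) / real n) \<longlonglongrightarrow> 0"
    by (simp add: d_def)
qed

end

section \<open>Averages along a chain with geometric drift\<close>

context markov_chain
begin

lemma expectation_power2_step_le: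
  fixes w :: "'z \<Rightarrow> real"
  assumes x: "x \<in> space M" and w[measurable]: "w \<in> borel_measurable M"
    and bound: "\<And>y. y \<in> space M \<Longrightarrow> \<bar>w y\<bar> \<le> c"
  shows "(\<integral>\<^sup>+y. ennreal ((w y - (\<integral>y. w y \<partial>R x))\<^sup>2) \<partial>R x) \<le> (\<integral>\<^sup>+y. ennreal ((w y)\<^sup>2) \<partial>R x)"
proof -
  interpret Rx: prob_space "R x" by (rule prob_space_R[OF x])
  note sets_R[OF x, measurable_cong] space_R[OF x, simp]
  have [measurable]: "w \<in> borel_measurable (R x)"
    unfolding measurable_cong_sets[OF sets_R[OF x] refl] by (rule w)
  have int: "integrable (R x) w"
    using bound by (intro Rx.integrable_const_bound[where B=c] AE_I2) auto
  have int2: "integrable (R x) (\<lambda>y. (w y)\<^sup>2)"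
    using power_mono[OF bound, of _ 2] by (intro Rx.integrable_const_bound[where B="c\<^sup>2"] AE_I2) auto
  let ?c = "\<integral>y. w y \<partial>R x"
  have "integrable (R x) (\<lambda>y. (w y - ?c)\<^sup>2)"
    unfolding power2_diff using int int2 by auto
  moreover have "(\<integral>y. (w y - ?c)\<^sup>2 \<partial>R x) = (\<integral>y. (w y)\<^sup>2 \<partial>R x) - ?c\<^sup>2"
    by (rule Rx.variance_eq[OF int int2])
  ultimately show ?thesis
    using int2 by (subst (1 2) nn_integral_eq_integral) (auto intro!: ennreal_leI)
qed

text \<open>The cutoff \<open>U (\<omega> m) \<le> L\<close> makes the later moments of \<open>U\<close> finite although
  \<open>E[U (\<omega> m)]\<close> may be infinite; almost every path satisfies it for some \<open>L\<close>.\<close>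

definition stay :: "'z set \<Rightarrow> ('z \<Rightarrow> real) \<Rightarrow> real \<Rightarrow> nat \<Rightarrow> nat \<Rightarrow> (nat \<Rightarrow> 'z) \<Rightarrow> real" where
  "stay G U L m k \<omega> = (if U (\<omega> m) \<le> L \<and> (\<forall>i\<le>k. \<omega> (m + i) \<in> G) then 1 else 0)"

lemma stay_bounds: "0 \<le> stay G U L m k \<omega>" "stay G U L m k \<omega> \<le> 1" "\<bar>stay G U L m k \<omega>\<bar> \<le> 1"
  by (auto simp: stay_def)

lemma stay_Suc_le: "stay G U L m (Suc k) \<omega> \<le> stay G U L m k \<omega>"
  by (auto simp: stay_def)

text \<open>The indicator is known at time m + k, before the next state is drawn. This
  predictability keeps the increments orthogonal after multiplication by it.\<close>

lemma stay_restrict: "stay G U L m k (restrict \<omega> {0..<Suc (m + k)}) = stay G U L m k \<omega>"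
  by (auto simp: stay_def)

lemma measurable_stay_PiM:
  assumes [measurable]: "G \<in> sets M" "U \<in> borel_measurable M" and "m + k < n"
  shows "stay G U L m k \<in> borel_measurable (PiM {0..<n} (\<lambda>_. M))"
proof -
  have [measurable]: "(\<lambda>x. x (m + i)) \<in> PiM {0..<n} (\<lambda>_. M) \<rightarrow>\<^sub>M M" if "i \<le> k" for i
    using that assms by (intro measurable_component_singleton) auto
  have *: "(\<lambda>x. x m) \<in> PiM {0..<n} (\<lambda>_. M) \<rightarrow>\<^sub>M M"
    using assms by (intro measurable_component_singleton) auto
  have [measurable]: "Measurable.pred (PiM {0..<n} (\<lambda>_. M)) (\<lambda>x. U (x m) \<le> L)"
    by (rule measurable_compose[OF *]) measurable
  have [measurable]: "Measurable.pred (PiM {0..<n} (\<lambda>_. M)) (\<lambda>x. \<forall>i\<in>{..k}. x (m + i) \<in> G)"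
    by (intro pred_intros_finite) (auto intro!: pred_sets2[OF assms(1)])
  have "(\<lambda>x. if U (x m) \<le> L \<and> (\<forall>i\<in>{..k}. x (m + i) \<in> G) then 1 else 0 :: real) \<in> borel_measurable (PiM {0..<n} (\<lambda>_. M))"
    by measurable
  then show ?thesis by (simp add: stay_def[abs_def] Ball_def)
qed

lemma measurable_stay [measurable]:
  assumes "G \<in> sets M" "U \<in> borel_measurable M"
  shows "stay G U L m k \<in> borel_measurable law"
proof -
  have "(\<lambda>\<omega>. stay G U L m k (restrict \<omega> {0..<Suc (m + k)})) \<in> borel_measurable law"
    by (rule measurable_compose[OF measurable_restrict_law measurable_stay_PiM]) (use assms in auto)
  then show ?thesis by (simp only: stay_restrict)
qed

lemma nn_integral_stay_step:
  assumes [measurable]: "G \<in> sets M" "U \<in> borel_measurable M" "h \<in> borel_measurable (M \<Otimes>\<^sub>M M)"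
  shows "(\<integral>\<^sup>+\<omega>. ennreal (stay G U L m k \<omega>) * h (\<omega> (m + k), \<omega> (Suc (m + k))) \<partial>law) =
    (\<integral>\<^sup>+\<omega>. ennreal (stay G U L m k \<omega>) * (\<integral>\<^sup>+y. h (\<omega> (m + k), y) \<partial>R (\<omega> (m + k))) \<partial>law)"
proof -
  let ?n = "Suc (m + k)"
  have [measurable]: "stay G U L m k \<in> borel_measurable (PiM {0..<?n} (\<lambda>_. M))"
    by (rule measurable_stay_PiM) (use assms in auto)
  have "(\<lambda>p. (fst p (m + k), snd p)) \<in> PiM {0..<?n} (\<lambda>_. M) \<Otimes>\<^sub>M M \<rightarrow>\<^sub>M M \<Otimes>\<^sub>M M"
    by (intro measurable_Pair measurable_snd measurable_compose[OF measurable_fst measurable_component_singleton]) simp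
  from measurable_compose[OF this assms(3)]
  have [measurable]: "(\<lambda>p. h (fst p (m + k), snd p)) \<in> borel_measurable (PiM {0..<?n} (\<lambda>_. M) \<Otimes>\<^sub>M M)"
    by simp
  let ?\<Phi> = "\<lambda>p. ennreal (stay G U L m k (fst p)) * h (fst p (m + k), snd p)"
  have "(\<integral>\<^sup>+\<omega>. ?\<Phi> (restrict \<omega> {0..<?n}, \<omega> ?n) \<partial>law) =
      (\<integral>\<^sup>+\<omega>. (\<integral>\<^sup>+y. ?\<Phi> (restrict \<omega> {0..<?n}, y) \<partial>R (\<omega> (m + k))) \<partial>law)"
    by (rule nn_integral_law_step) measurable
  also have "\<dots> = (\<integral>\<^sup>+\<omega>. ennreal (stay G U L m k \<omega>) * (\<integral>\<^sup>+y. h (\<omega> (m + k), y) \<partial>R (\<omega> (m + k))) \<partial>law)"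
  proof (rule nn_integral_cong)
    fix \<omega> assume "\<omega> \<in> space law"
    then have \<omega>: "\<omega> (m + k) \<in> space M" by (rule space_law_coord)
    have "(\<lambda>y. h (\<omega> (m + k), y)) \<in> borel_measurable (R (\<omega> (m + k)))"
      unfolding measurable_cong_sets[OF sets_R[OF \<omega>] refl]
      by (rule measurable_compose[OF measurable_Pair1'[OF \<omega>] assms(3)])
    then show "(\<integral>\<^sup>+y. ?\<Phi> (restrict \<omega> {0..<?n}, y) \<partial>R (\<omega> (m + k))) =
        ennreal (stay G U L m k \<omega>) * (\<integral>\<^sup>+y. h (\<omega> (m + k), y) \<partial>R (\<omega> (m + k)))"
      by (simp add: stay_restrict nn_integral_cmult)
  qed
  finally show ?thesis by (simp add: stay_restrict)
qed

end

text \<open>The drift inequality is available on \<open>G\<close> only, so the moment estimates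
  carry the factor \<open>stay\<close>, which vanishes once the path has left
  \<open>G\<close>.\<close>

locale drift_chain = markov_chain +
  fixes G :: "'a set" and U :: "'a \<Rightarrow> real" and l b :: real
  assumes G[measurable]: "G \<in> sets M" and U[measurable]: "U \<in> borel_measurable M"
    and U_ge_1: "\<And>x. x \<in> space M \<Longrightarrow> 1 \<le> U x"
    and l: "0 \<le> l" "l < 1" and b: "0 \<le> b"
    and drift: "\<And>x. x \<in> G \<Longrightarrow> (\<integral>\<^sup>+y. ennreal (U y) \<partial>R x) \<le> ennreal (l * U x + b)"
begin

text \<open>The number b / (1 - l) is the fixed point of B \<mapsto> l * B + b. Adding L makes it
  dominate the starting value, which the cutoff limits to L, and keeps l * B + b \<le> B. The second
  bound concerns the state after the step, whether or not that state lies in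
  \<open>G\<close>.\<close>

lemma nn_integral_stay_le:
  assumes "0 \<le> L"
  shows "(\<integral>\<^sup>+\<omega>. ennreal (stay G U L m k \<omega> * U (\<omega> (m + k))) \<partial>law) \<le> ennreal (L + b / (1 - l))"
    and "(\<integral>\<^sup>+\<omega>. ennreal (stay G U L m k \<omega>) * (\<integral>\<^sup>+y. ennreal (U y) \<partial>R (\<omega> (m + k))) \<partial>law) \<le> ennreal (L + b / (1 - l))"
proof -
  let ?B = "L + b / (1 - l)" and ?J = "\<lambda>k. stay G U L m k"
  have B0: "0 \<le> ?B" using l b assms by auto
  have Bb: "l * ?B + b \<le> ?B"
  proof -
    have "(1 - l) * ?B = (1 - l) * L + b" using l by (simp add: distrib_left)
    moreover have "0 \<le> (1 - l) * L" using l assms by simp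
    ultimately have "b \<le> ?B - l * ?B" by (simp only: left_diff_distrib mult_1_left)
    then show ?thesis by linarith
  qed
  have step: "(\<integral>\<^sup>+\<omega>. ennreal (?J k \<omega>) * (\<integral>\<^sup>+y. ennreal (U y) \<partial>R (\<omega> (m + k))) \<partial>law) \<le> ennreal ?B"
    if IH: "(\<integral>\<^sup>+\<omega>. ennreal (?J k \<omega> * U (\<omega> (m + k))) \<partial>law) \<le> ennreal ?B" for k
  proof -
    have "(\<integral>\<^sup>+\<omega>. ennreal (?J k \<omega>) * (\<integral>\<^sup>+y. ennreal (U y) \<partial>R (\<omega> (m + k))) \<partial>law)
        \<le> (\<integral>\<^sup>+\<omega>. ennreal l * ennreal (?J k \<omega> * U (\<omega> (m + k))) + ennreal b \<partial>law)"
    proof (rule nn_integral_mono)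
      fix \<omega> assume "\<omega> \<in> space law"
      then have U0: "0 \<le> U (\<omega> (m + k))" using U_ge_1[OF space_law_coord, of \<omega> "m + k"] by simp
      show "ennreal (?J k \<omega>) * (\<integral>\<^sup>+y. ennreal (U y) \<partial>R (\<omega> (m + k))) \<le>
          ennreal l * ennreal (?J k \<omega> * U (\<omega> (m + k))) + ennreal b"
        using drift[of "\<omega> (m + k)"] U0 l b
        by (auto simp: stay_def ennreal_mult[symmetric] ennreal_plus[symmetric] simp del: ennreal_plus)
    qed
    also have "\<dots> = ennreal l * (\<integral>\<^sup>+\<omega>. ennreal (?J k \<omega> * U (\<omega> (m + k))) \<partial>law) + ennreal b"
      by (subst nn_integral_add) (auto simp: nn_integral_cmult emeasure_space_1)
    also have "\<dots> \<le> ennreal l * ennreal ?B + ennreal b"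
      using IH by (intro add_mono mult_left_mono) auto
    also have "\<dots> = ennreal (l * ?B + b)"
      using l b B0 by (simp add: ennreal_mult[symmetric] ennreal_plus[symmetric] del: ennreal_plus)
    also have "\<dots> \<le> ennreal ?B" by (rule ennreal_leI[OF Bb])
    finally show ?thesis .
  qed
  show 1: "(\<integral>\<^sup>+\<omega>. ennreal (?J k \<omega> * U (\<omega> (m + k))) \<partial>law) \<le> ennreal ?B" for k
  proof (induction k)
    case 0
    have "(\<integral>\<^sup>+\<omega>. ennreal (?J 0 \<omega> * U (\<omega> (m + 0))) \<partial>law) \<le> (\<integral>\<^sup>+\<omega>. ennreal L \<partial>law)"
      using assms by (intro nn_integral_mono ennreal_leI) (auto simp: stay_def)
    also have "\<dots> \<le> ennreal ?B"
      using l b by (auto simp: emeasure_space_1 intro!: ennreal_leI)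
    finally show ?case .
  next
    case (Suc k)
    have "(\<integral>\<^sup>+\<omega>. ennreal (?J (Suc k) \<omega> * U (\<omega> (m + Suc k))) \<partial>law) \<le>
        (\<integral>\<^sup>+\<omega>. ennreal (?J k \<omega>) * ennreal (U (\<omega> (Suc (m + k)))) \<partial>law)"
    proof (rule nn_integral_mono)
      fix \<omega> assume "\<omega> \<in> space law"
      then have "0 \<le> U (\<omega> (Suc (m + k)))" using U_ge_1[OF space_law_coord, of \<omega> "Suc (m + k)"] by simp
      then show "ennreal (?J (Suc k) \<omega> * U (\<omega> (m + Suc k))) \<le> ennreal (?J k \<omega>) * ennreal (U (\<omega> (Suc (m + k))))"
        using stay_Suc_le[of G U L m k \<omega>]
        by (simp add: ennreal_mult[symmetric] stay_bounds ennreal_leI mult_right_mono)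
    qed
    also have "\<dots> = (\<integral>\<^sup>+\<omega>. ennreal (?J k \<omega>) * (\<integral>\<^sup>+y. ennreal (U y) \<partial>R (\<omega> (m + k))) \<partial>law)"
      using nn_integral_stay_step[OF G U, of "\<lambda>p. ennreal (U (snd p))" L m k] by simp
    also have "\<dots> \<le> ennreal ?B" by (rule step[OF Suc.IH])
    finally show ?case .
  qed
  from step[OF 1] show "(\<integral>\<^sup>+\<omega>. ennreal (?J k \<omega>) * (\<integral>\<^sup>+y. ennreal (U y) \<partial>R (\<omega> (m + k))) \<partial>law) \<le> ennreal ?B" .
qed

end

lemma summable_powr_minus:
  assumes "0 < s"
  shows "summable (\<lambda>j. B * (2 powr - s) ^ j :: real)"
  using assms by (intro summable_mult summable_geometric) (simp add: powr_less_one)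

lemma two_power_powr: "((2::real) ^ j) powr a = (2 powr a) ^ j"
  by (simp add: powr_power powr_realpow[symmetric] powr_powr mult.commute)

section \<open>Powers of the drift function, truncated at dyadic levels\<close>

context drift_chain
begin

text \<open>The tangent of y^r at \<open>U x\<close> bounds \<open>U y powr r\<close> by an affine
  function of \<open>U y\<close>, to which the drift applies. The coefficient of b is r times
  \<open>U x powr (r - 1)\<close>, at most r because \<open>U x\<close> \<ge> 1.\<close>

lemma nn_integral_powr_drift:
  assumes x: "x \<in> G" and r: "0 \<le> r" "r \<le> 1"
  shows "(\<integral>\<^sup>+y. ennreal (U y powr r) \<partial>R x) \<le> ennreal ((1 - r * (1 - l)) * U x powr r + r * b)"
proof -
  have xM: "x \<in> space M" using x sets.sets_into_space[OF G] by auto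
  interpret Rx: prob_space "R x" by (rule prob_space_R[OF xM])
  have Ux: "1 \<le> U x" by (rule U_ge_1[OF xM])
  have [measurable]: "U \<in> borel_measurable (R x)"
    unfolding measurable_cong_sets[OF sets_R[OF xM] refl] by (rule U)
  let ?t = "U x powr (r - 1)"
  have "(\<integral>\<^sup>+y. ennreal (U y powr r) \<partial>R x) \<le> (\<integral>\<^sup>+y. ennreal ((1 - r) * U x powr r) + ennreal (r * ?t) * ennreal (U y) \<partial>R x)"
  proof (rule nn_integral_mono)
    fix y assume "y \<in> space (R x)"
    then have y: "1 \<le> U y" using U_ge_1 by (simp add: space_R[OF xM])
    have "U y powr r \<le> (1 - r) * U x powr r + r * ?t * U y"
      using powr_le_tangent[of r "U x" "U y"] r Ux y by simp
    then have "ennreal (U y powr r) \<le> ennreal ((1 - r) * U x powr r + r * ?t * U y)" by (rule ennreal_leI)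
    also have "\<dots> = ennreal ((1 - r) * U x powr r) + ennreal (r * ?t) * ennreal (U y)"
      using r y by (subst ennreal_plus) (auto simp: ennreal_mult)
    finally show "ennreal (U y powr r) \<le> ennreal ((1 - r) * U x powr r) + ennreal (r * ?t) * ennreal (U y)" .
  qed
  also have "\<dots> = ennreal ((1 - r) * U x powr r) + ennreal (r * ?t) * (\<integral>\<^sup>+y. ennreal (U y) \<partial>R x)"
    by (subst nn_integral_add) (auto simp: nn_integral_cmult Rx.emeasure_space_1)
  also have "\<dots> \<le> ennreal ((1 - r) * U x powr r) + ennreal (r * ?t) * ennreal (l * U x + b)"
    by (intro add_mono mult_left_mono drift[OF x]) auto
  also have "\<dots> = ennreal ((1 - r) * U x powr r + r * ?t * (l * U x + b))"
    using r l b Ux by (subst ennreal_plus) (auto simp: ennreal_mult)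
  also have "\<dots> \<le> ennreal ((1 - r * (1 - l)) * U x powr r + r * b)"
  proof (rule ennreal_leI)
    have "?t * U x = U x powr r" using Ux by (simp add: powr_diff)
    moreover have "?t \<le> 1" using r Ux powr_mono[of "r - 1" 0 "U x"] by simp
    then have "r * (?t * b) \<le> r * (1 * b)" using r b by (intro mult_left_mono mult_right_mono) auto
    moreover have "(1 - r) * U x powr r + r * ?t * (l * U x + b) = (1 - r) * U x powr r + r * l * (?t * U x) + r * (?t * b)"
      by (simp add: algebra_simps)
    ultimately show "(1 - r) * U x powr r + r * ?t * (l * U x + b) \<le> (1 - r * (1 - l)) * U x powr r + r * b"
      by (simp add: algebra_simps)
  qed
  finally show ?thesis .
qed

definition trunc_pow :: "real \<Rightarrow> nat \<Rightarrow> 'a \<Rightarrow> real" where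
  "trunc_pow r j x = min (U x powr r) (2 ^ j)"

lemma measurable_trunc_pow [measurable]: "trunc_pow r j \<in> borel_measurable M"
  unfolding trunc_pow_def[abs_def] by measurable

lemma trunc_pow_bounds: "0 \<le> trunc_pow r j x" "trunc_pow r j x \<le> 2 ^ j" "\<bar>trunc_pow r j x\<bar> \<le> 2 ^ j"
  by (auto simp: trunc_pow_def)

definition trunc_diff :: "real \<Rightarrow> nat \<Rightarrow> 'a \<times> 'a \<Rightarrow> real" where
  "trunc_diff r j p = trunc_pow r j (snd p) - (\<integral>y. trunc_pow r j y \<partial>R (fst p))"

lemma measurable_trunc_diff [measurable]: "trunc_diff r j \<in> borel_measurable (M \<Otimes>\<^sub>M M)"
proof -
  have [measurable]: "(\<lambda>x. \<integral>y. trunc_pow r j y \<partial>R x) \<in> borel_measurable M"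
    by (rule integral_measurable_subprob_algebra2[where N=M]) measurable
  show ?thesis unfolding trunc_diff_def[abs_def] by measurable
qed

lemma trunc_pow_integrable:
  assumes x: "x \<in> space M"
  shows "integrable (R x) (trunc_pow r j)"
proof -
  interpret Rx: prob_space "R x" by (rule prob_space_R[OF x])
  have "trunc_pow r j \<in> borel_measurable (R x)"
    unfolding measurable_cong_sets[OF sets_R[OF x] refl] by measurable
  then show ?thesis
    by (intro Rx.integrable_const_bound[where B="2 ^ j"] AE_I2) (auto simp: trunc_pow_bounds)
qed

lemma trunc_diff_bound:
  assumes "p \<in> space (M \<Otimes>\<^sub>M M)"
  shows "\<bar>trunc_diff r j p\<bar> \<le> 2 * 2 ^ j"
proof -
  have "fst p \<in> space M" using assms by (auto simp: space_pair_measure)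
  then interpret Rx: prob_space "R (fst p)" by (rule prob_space_R)
  have "\<bar>\<integral>y. trunc_pow r j y \<partial>R (fst p)\<bar> \<le> 2 ^ j"
    by (rule Rx.abs_expectation_le_const) (rule trunc_pow_bounds)
  then show ?thesis using trunc_pow_bounds[of r j "snd p"] unfolding trunc_diff_def by linarith
qed

lemma trunc_diff_centred:
  assumes x: "x \<in> space M"
  shows "(\<integral>y. trunc_diff r j (x, y) \<partial>R x) = 0"
proof -
  interpret Rx: prob_space "R x" by (rule prob_space_R[OF x])
  show ?thesis
    using trunc_pow_integrable[OF x] by (simp add: trunc_diff_def Rx.prob_space)
qed

text \<open>The square is split as w^(2 - 1/r) * w^(1/r): the first factor is bounded by the
  truncation level, its exponent being nonnegative for r \<ge> 1/2, and the second by
  \<open>U x\<close>. So a first moment of \<open>U\<close> controls the second moment at a cost of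
  order less than 2^j.\<close>

lemma trunc_pow_power2_le:
  assumes x: "x \<in> space M" and r: "1 / 2 \<le> r" "r < 1"
  shows "(trunc_pow r j x)\<^sup>2 \<le> (2 powr (2 - 1 / r)) ^ j * U x"
proof -
  let ?w = "trunc_pow r j x"
  have Ux: "1 \<le> U x" by (rule U_ge_1[OF x])
  have w: "0 < ?w" using Ux by (auto simp: trunc_pow_def)
  have "?w\<^sup>2 = ?w powr (2 - 1 / r) * ?w powr (1 / r)"
    using w by (simp add: powr_add[symmetric] powr_numeral)
  also have "\<dots> \<le> (2 ^ j) powr (2 - 1 / r) * (U x powr r) powr (1 / r)"
    using w r by (intro mult_mono powr_mono2) (auto simp: trunc_pow_def field_simps)
  also have "(U x powr r) powr (1 / r) = U x"
    using r Ux by (simp add: powr_powr)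
  finally show ?thesis by (simp add: two_power_powr)
qed

text \<open>Markov's inequality in pointwise form, at level 2^(j/r) for \<open>U\<close>.\<close>

lemma indicator_exceeds_le:
  assumes x: "x \<in> space M" and r: "1 / 2 \<le> r" "r < 1"
  shows "(if 2 ^ j < U x powr r then 1 else 0) \<le> (2 powr - (1 / r)) ^ j * U x"
proof -
  have Ux: "1 \<le> U x" by (rule U_ge_1[OF x])
  have "(2 powr - (1 / r)) ^ j * U x \<ge> 1" if "2 ^ j < U x powr r"
  proof -
    have "(2 ^ j) powr (1 / r) \<le> (U x powr r) powr (1 / r)"
      using that r by (intro powr_mono2) auto
    also have "\<dots> = U x" using r Ux by (simp add: powr_powr)
    finally have "(2 ^ j) powr - (1 / r) * (2 ^ j) powr (1 / r) \<le> (2 ^ j) powr - (1 / r) * U x"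
      by (rule mult_left_mono) simp
    then show ?thesis
      by (simp add: two_power_powr[symmetric] powr_add[symmetric])
  qed
  then show ?thesis using Ux by auto
qed

text \<open>There are 2^j indices, each exceeding the level with probability of order 2^(-j/r); the
  product is a geometric sequence of ratio 2^(-(1/r - 1)), less than 1 for r < 1. Hence for large j
  the truncation changes none of the first 2^j values.\<close>

lemma AE_summable_exceedances:
  assumes r: "1 / 2 \<le> r" "r < 1" and L: "0 \<le> L"
  shows "AE \<omega> in law. summable (\<lambda>j. \<Sum>k<2 ^ j. stay G U L m k \<omega> * (if 2 ^ j < U (\<omega> (m + k)) powr r then 1 else 0))"
proof (rule AE_summable_of_summable_expectation)
  let ?B = "L + b / (1 - l)"
  have B0: "0 \<le> ?B" using L l b by simp
  fix j
  let ?c = "(2 powr - (1 / r)) ^ j :: real"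
  have "(\<integral>\<^sup>+\<omega>. ennreal (\<Sum>k<2 ^ j. stay G U L m k \<omega> * (if 2 ^ j < U (\<omega> (m + k)) powr r then 1 else 0)) \<partial>law)
      = (\<Sum>k<2 ^ j. \<integral>\<^sup>+\<omega>. ennreal (stay G U L m k \<omega> * (if 2 ^ j < U (\<omega> (m + k)) powr r then 1 else 0)) \<partial>law)"
    by (subst nn_integral_sum[symmetric]) (auto simp: stay_bounds)
  also have "\<dots> \<le> (\<Sum>k<(2::nat) ^ j. ennreal (?c * ?B))"
  proof (rule sum_mono)
    fix k
    have "(\<integral>\<^sup>+\<omega>. ennreal (stay G U L m k \<omega> * (if 2 ^ j < U (\<omega> (m + k)) powr r then 1 else 0)) \<partial>law)
        \<le> (\<integral>\<^sup>+\<omega>. ennreal ?c * ennreal (stay G U L m k \<omega> * U (\<omega> (m + k))) \<partial>law)"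
    proof (rule nn_integral_mono)
      fix \<omega> assume \<omega>: "\<omega> \<in> space law"
      have "stay G U L m k \<omega> * (if 2 ^ j < U (\<omega> (m + k)) powr r then 1 else 0) \<le> stay G U L m k \<omega> * (?c * U (\<omega> (m + k)))"
        using indicator_exceeds_le[OF space_law_coord[OF \<omega>] r] by (intro mult_left_mono) (auto simp: stay_bounds)
      then show "ennreal (stay G U L m k \<omega> * (if 2 ^ j < U (\<omega> (m + k)) powr r then 1 else 0))
          \<le> ennreal ?c * ennreal (stay G U L m k \<omega> * U (\<omega> (m + k)))"
        by (subst ennreal_mult''[symmetric]) (use U_ge_1[OF space_law_coord[OF \<omega>], of "m + k"] in
            \<open>auto intro!: ennreal_leI mult_nonneg_nonneg simp: stay_bounds ac_simps\<close>)
    qed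
    also have "\<dots> = ennreal ?c * (\<integral>\<^sup>+\<omega>. ennreal (stay G U L m k \<omega> * U (\<omega> (m + k))) \<partial>law)"
      by (rule nn_integral_cmult) measurable
    also have "\<dots> \<le> ennreal ?c * ennreal ?B"
      by (intro mult_left_mono nn_integral_stay_le(1)[OF L]) simp
    also have "\<dots> = ennreal (?c * ?B)" by (rule ennreal_mult[symmetric]) (use B0 in auto)
    finally show "(\<integral>\<^sup>+\<omega>. ennreal (stay G U L m k \<omega> * (if 2 ^ j < U (\<omega> (m + k)) powr r then 1 else 0)) \<partial>law)
        \<le> ennreal (?c * ?B)" .
  qed
  also have "\<dots> = ennreal (2 ^ j * (?c * ?B))"
    using B0 by (simp add: ennreal_mult ennreal_power[symmetric])
  also have "2 ^ j * (?c * ?B) = ?B * (2 powr - (1 / r - 1)) ^ j"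
    by (simp add: two_power_powr[symmetric] powr_add[symmetric] powr_diff powr_minus field_simps)
  finally show "(\<integral>\<^sup>+\<omega>. ennreal (\<Sum>k<2 ^ j. stay G U L m k \<omega> * (if 2 ^ j < U (\<omega> (m + k)) powr r then 1 else 0)) \<partial>law)
      \<le> ennreal (?B * (2 powr - (1 / r - 1)) ^ j)" .
  show "0 \<le> ?B * (2 powr - (1 / r - 1)) ^ j" using B0 by simp
  show "summable (\<lambda>j. ?B * (2 powr - (1 / r - 1)) ^ j)"
    using r by (intro summable_powr_minus) (simp add: field_simps)
qed (auto intro!: sum_nonneg simp: stay_bounds)

text \<open>By orthogonality the second moment of the sum is at most 2^j times one of order 2^(j(2 -
  1/r)); division by 4^j gives the same geometric ratio as for the exceedances. The square is
  summable, so the normalised sums tend to 0 along the dyadic times.\<close>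

lemma AE_summable_martingale:
  assumes r: "1 / 2 \<le> r" "r < 1" and L: "0 \<le> L"
  shows "AE \<omega> in law. summable (\<lambda>j. ((\<Sum>k<2 ^ j. stay G U L m k \<omega> *
    trunc_diff r j (\<omega> (m + k), \<omega> (Suc (m + k)))) / 2 ^ j)\<^sup>2)"
proof (rule AE_summable_of_summable_expectation)
  let ?B = "L + b / (1 - l)"
  have B0: "0 \<le> ?B" using L l b by simp
  fix j
  let ?c = "(2 powr (2 - 1 / r)) ^ j :: real" and ?J = "stay G U L m"
  define X where "X k \<omega> = ?J k \<omega> * trunc_diff r j (\<omega> (m + k), \<omega> (Suc (m + k)))" for k \<omega>
  have [measurable]: "X k \<in> borel_measurable law" for k
    unfolding X_def by measurable
  have mult_bound: "\<bar>?J k x * a\<bar> \<le> c" if "\<bar>a\<bar> \<le> c" for k x a c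
    using that by (auto simp: stay_def)
  have X_bound: "\<bar>X k \<omega>\<bar> \<le> 2 * 2 ^ j" if "\<omega> \<in> space law" for k \<omega>
    unfolding X_def using that
    by (intro mult_bound trunc_diff_bound) (auto simp: space_pair_measure space_law_coord)
  have orth: "expectation (\<lambda>\<omega>. X i \<omega> * X k \<omega>) = 0" if ik: "i < k" for i k
  proof -
    \<comment> \<open>The weight \<open>?J k\<close> of the later increment is itself predictable,
      so it is moved into the past factor and a centred increment remains.\<close>
    let ?\<Psi> = "\<lambda>x. ?J i x * trunc_diff r j (x (m + i), x (Suc (m + i))) * ?J k x"
    have "expectation (\<lambda>\<omega>. ?\<Psi> (restrict \<omega> {0..<Suc (m + k)}) * trunc_diff r j (\<omega> (m + k), \<omega> (Suc (m + k)))) = 0"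
    proof (rule expectation_law_step_eq_0)
      have "(\<lambda>x. (x (m + i), x (Suc (m + i)))) \<in> PiM {0..<Suc (m + k)} (\<lambda>_. M) \<rightarrow>\<^sub>M M \<Otimes>\<^sub>M M"
        using ik by (intro measurable_Pair measurable_component_singleton) auto
      from measurable_compose[OF this measurable_trunc_diff]
      have [measurable]: "(\<lambda>x. trunc_diff r j (x (m + i), x (Suc (m + i)))) \<in> borel_measurable (PiM {0..<Suc (m + k)} (\<lambda>_. M))" .
      have [measurable]: "?J i \<in> borel_measurable (PiM {0..<Suc (m + k)} (\<lambda>_. M))"
        "?J k \<in> borel_measurable (PiM {0..<Suc (m + k)} (\<lambda>_. M))"
        using ik by (auto intro!: measurable_stay_PiM)
      show "?\<Psi> \<in> borel_measurable (PiM {0..<Suc (m + k)} (\<lambda>_. M))" by measurable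
      show "\<bar>?\<Psi> x\<bar> \<le> 2 * 2 ^ j" if "x \<in> space (PiM {0..<Suc (m + k)} (\<lambda>_. M))" for x
        unfolding mult.commute[of _ "?J k x"] using that ik
        by (intro mult_bound trunc_diff_bound) (auto simp: space_pair_measure space_PiM PiE_iff)
    qed (use trunc_diff_bound trunc_diff_centred in auto)
    moreover have "?J i (restrict \<omega> {0..<Suc (m + k)}) = ?J i \<omega>" for \<omega>
      using ik by (auto simp: stay_def)
    ultimately show ?thesis
      using ik by (simp add: X_def stay_restrict mult_ac)
  qed
  have intX: "integrable law (\<lambda>\<omega>. (X k \<omega>)\<^sup>2)" for k
    using power_mono[OF X_bound, of _ k 2]
    by (intro integrable_const_bound[where B="(2 * 2 ^ j)\<^sup>2"] AE_I2) auto
  have EX: "expectation (\<lambda>\<omega>. (X k \<omega>)\<^sup>2) \<le> ?c * ?B" for k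
  proof -
    have "ennreal (expectation (\<lambda>\<omega>. (X k \<omega>)\<^sup>2)) = (\<integral>\<^sup>+\<omega>. ennreal ((X k \<omega>)\<^sup>2) \<partial>law)"
      using intX by (intro nn_integral_eq_integral[symmetric]) auto
    \<comment> \<open>The weight takes only the values 0 and 1, so squaring leaves it
      unchanged.\<close>
    also have "\<dots> = (\<integral>\<^sup>+\<omega>. ennreal (?J k \<omega>) * ennreal ((trunc_diff r j (\<omega> (m + k), \<omega> (Suc (m + k))))\<^sup>2) \<partial>law)"
      by (intro nn_integral_cong) (auto simp: X_def stay_def)
    also have "\<dots> = (\<integral>\<^sup>+\<omega>. ennreal (?J k \<omega>) * (\<integral>\<^sup>+y. ennreal ((trunc_diff r j (\<omega> (m + k), y))\<^sup>2) \<partial>R (\<omega> (m + k))) \<partial>law)"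
      by (rule nn_integral_stay_step[where h="\<lambda>p. ennreal ((trunc_diff r j p)\<^sup>2)"]) measurable
    also have "\<dots> \<le> (\<integral>\<^sup>+\<omega>. ennreal ?c * (ennreal (?J k \<omega>) * (\<integral>\<^sup>+y. ennreal (U y) \<partial>R (\<omega> (m + k)))) \<partial>law)"
    proof (rule nn_integral_mono)
      fix \<omega> assume "\<omega> \<in> space law"
      then have x: "\<omega> (m + k) \<in> space M" by (rule space_law_coord)
      have [measurable]: "U \<in> borel_measurable (R (\<omega> (m + k)))"
        unfolding measurable_cong_sets[OF sets_R[OF x] refl] by (rule U)
      have "(\<integral>\<^sup>+y. ennreal ((trunc_diff r j (\<omega> (m + k), y))\<^sup>2) \<partial>R (\<omega> (m + k))) \<le>
          (\<integral>\<^sup>+y. ennreal ((trunc_pow r j y)\<^sup>2) \<partial>R (\<omega> (m + k)))"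
        unfolding trunc_diff_def fst_conv snd_conv
        by (rule expectation_power2_step_le[OF x]) (measurable, rule trunc_pow_bounds)
      also have "\<dots> \<le> (\<integral>\<^sup>+y. ennreal ?c * ennreal (U y) \<partial>R (\<omega> (m + k)))"
        using trunc_pow_power2_le[OF _ r]
        by (intro nn_integral_mono) (auto simp: space_R[OF x] ennreal_mult'[symmetric] intro!: ennreal_leI)
      also have "\<dots> = ennreal ?c * (\<integral>\<^sup>+y. ennreal (U y) \<partial>R (\<omega> (m + k)))"
        by (rule nn_integral_cmult) measurable
      finally show "ennreal (?J k \<omega>) * (\<integral>\<^sup>+y. ennreal ((trunc_diff r j (\<omega> (m + k), y))\<^sup>2) \<partial>R (\<omega> (m + k)))
          \<le> ennreal ?c * (ennreal (?J k \<omega>) * (\<integral>\<^sup>+y. ennreal (U y) \<partial>R (\<omega> (m + k))))"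
        by (subst mult.left_commute) (rule mult_left_mono, auto)
    qed
    also have "\<dots> = ennreal ?c * (\<integral>\<^sup>+\<omega>. ennreal (?J k \<omega>) * (\<integral>\<^sup>+y. ennreal (U y) \<partial>R (\<omega> (m + k))) \<partial>law)"
      by (rule nn_integral_cmult) measurable
    also have "\<dots> \<le> ennreal ?c * ennreal ?B"
      by (intro mult_left_mono nn_integral_stay_le(2)[OF L]) simp
    also have "\<dots> = ennreal (?c * ?B)" by (rule ennreal_mult[symmetric]) (use B0 in auto)
    finally show ?thesis using B0 by (subst (asm) ennreal_le_iff) auto
  qed
  let ?S = "\<lambda>\<omega>. \<Sum>k<2 ^ j. X k \<omega>"
  have "expectation (\<lambda>\<omega>. (?S \<omega>)\<^sup>2) = (\<Sum>k<2 ^ j. expectation (\<lambda>\<omega>. (X k \<omega>)\<^sup>2))"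
    by (rule expectation_power2_sum_orthogonal[OF _ X_bound orth]) auto
  also have "\<dots> \<le> (\<Sum>k<(2::nat) ^ j. ?c * ?B)"
    by (rule sum_mono) (rule EX)
  finally have ES: "expectation (\<lambda>\<omega>. (?S \<omega>)\<^sup>2) \<le> 2 ^ j * (?c * ?B)" by simp
  have S_bound: "\<bar>?S \<omega>\<bar> \<le> 2 ^ j * (2 * 2 ^ j)" if "\<omega> \<in> space law" for \<omega>
    using sum_bounded_above[of "{..<2 ^ j}" "\<lambda>k. \<bar>X k \<omega>\<bar>" "2 * 2 ^ j", OF X_bound[OF that]]
    by (intro order_trans[OF sum_abs]) simp
  have "integrable law (\<lambda>\<omega>. (?S \<omega>)\<^sup>2)"
    using power_mono[OF S_bound, of _ 2]
    by (intro integrable_const_bound[where B="(2 ^ j * (2 * 2 ^ j))\<^sup>2"] AE_I2) auto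
  then have "(\<integral>\<^sup>+\<omega>. ennreal ((?S \<omega> / 2 ^ j)\<^sup>2) \<partial>law) = ennreal (expectation (\<lambda>\<omega>. (?S \<omega>)\<^sup>2) / (2 ^ j)\<^sup>2)"
    by (subst nn_integral_eq_integral) (auto simp: power_divide)
  also have "\<dots> \<le> ennreal (2 ^ j * (?c * ?B) / (2 ^ j)\<^sup>2)"
    using ES by (intro ennreal_leI divide_right_mono) auto
  also have "2 ^ j * (?c * ?B) / (2 ^ j)\<^sup>2 = ?B * (2 powr - (1 / r - 1)) ^ j"
  proof -
    have "2 ^ j * ?c / (2 ^ j)\<^sup>2 = (2 * 2 powr (2 - 1 / r) / 4) ^ j"
      by (simp only: power2_eq_square power_mult_distrib[symmetric] power_divide[symmetric]) simp
    also have "2 * 2 powr (2 - 1 / r) / 4 = 2 powr - (1 / r - 1)"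
      by (simp add: powr_diff powr_minus field_simps)
    finally show ?thesis by (simp add: field_simps)
  qed
  finally show "(\<integral>\<^sup>+\<omega>. ennreal (((\<Sum>k<2 ^ j. ?J k \<omega> * trunc_diff r j (\<omega> (m + k), \<omega> (Suc (m + k)))) / 2 ^ j)\<^sup>2) \<partial>law)
      \<le> ennreal (?B * (2 powr - (1 / r - 1)) ^ j)"
    by (simp add: X_def)
  show "0 \<le> ?B * (2 powr - (1 / r - 1)) ^ j" using B0 by simp
  show "summable (\<lambda>j. ?B * (2 powr - (1 / r - 1)) ^ j)"
    using r by (intro summable_powr_minus) (simp add: field_simps)
qed auto

text \<open>Summing the drift of U^r over the first 2^j steps bounds the sum S by (1 - q) * S plus
  terms of order 2^j, where q = r * (1 - l). Solving for S needs the truncated and the original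
  values to agree, which holds for large j; finally n is rounded up to a power of 2.\<close>

lemma AE_bounded_averages_powr:
  assumes r: "1 / 2 \<le> r" "r < 1"
  shows "AE \<omega> in law. \<forall>m. (\<forall>n\<ge>m. \<omega> n \<in> G) \<longrightarrow>
    (\<exists>B. \<forall>n. (\<Sum>k<n. U (\<omega> (m + k)) powr r) \<le> B * (real n + 1))"
proof -
  let ?T = "\<lambda>m L \<omega> j. \<Sum>k<2 ^ j. stay G U (real L) m k \<omega> * (if 2 ^ j < U (\<omega> (m + k)) powr r then 1 else 0)"
  let ?S = "\<lambda>m L \<omega> j. (\<Sum>k<2 ^ j. stay G U (real L) m k \<omega> * trunc_diff r j (\<omega> (m + k), \<omega> (Suc (m + k)))) / 2 ^ j"
  have "AE \<omega> in law. \<forall>m (L::nat). summable (?T m L \<omega>) \<and> summable (\<lambda>j. (?S m L \<omega> j)\<^sup>2)"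
    unfolding AE_all_countable
    using AE_summable_exceedances[OF r] AE_summable_martingale[OF r] by (auto intro!: AE_conjI)
  then show ?thesis
    using AE_space
  proof eventually_elim
    fix \<omega>
    assume sm: "\<forall>m (L::nat). summable (?T m L \<omega>) \<and> summable (\<lambda>j. (?S m L \<omega> j)\<^sup>2)" and \<omega>: "\<omega> \<in> space law"
    show "\<forall>m. (\<forall>n\<ge>m. \<omega> n \<in> G) \<longrightarrow> (\<exists>B. \<forall>n. (\<Sum>k<n. U (\<omega> (m + k)) powr r) \<le> B * (real n + 1))"
    proof (intro allI impI)
      fix m assume inG: "\<forall>n\<ge>m. \<omega> n \<in> G"
      \<comment> \<open>The cutoff depends on the path; natural values of L suffice, so the
        exceptional set remains null.\<close>
      obtain L :: nat where L: "U (\<omega> m) \<le> real L" using real_arch_simple by blast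
      have stay1: "stay G U (real L) m k \<omega> = 1" for k
        using L inG by (auto simp: stay_def)
      define a where "a k = U (\<omega> (m + k)) powr r" for k
      have a0: "0 \<le> a k" for k by (simp add: a_def)
      have sums: "summable (?T m L \<omega>)" "summable (\<lambda>j. (?S m L \<omega> j)\<^sup>2)"
        using sm by auto
      have "\<forall>\<^sub>F j in sequentially. ?T m L \<omega> j < 1" "\<forall>\<^sub>F j in sequentially. (?S m L \<omega> j)\<^sup>2 < 1"
        by (rule order_tendstoD(2)[OF sums(1)[THEN summable_LIMSEQ_zero]], simp)
          (rule order_tendstoD(2)[OF sums(2)[THEN summable_LIMSEQ_zero]], simp)
      then have "\<forall>\<^sub>F j in sequentially. ?T m L \<omega> j < 1 \<and> (?S m L \<omega> j)\<^sup>2 < 1"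
        by (rule eventually_conj)
      then obtain j0 where j0: "\<And>j. j0 \<le> j \<Longrightarrow> ?T m L \<omega> j < 1 \<and> (?S m L \<omega> j)\<^sup>2 < 1"
        unfolding eventually_sequentially by blast
      let ?q = "r * (1 - l)"
      have q: "0 < ?q" using r l by simp
      have dyadic: "(\<Sum>k<2 ^ j. a k) \<le> (2 + r * b) / ?q * 2 ^ j" if j: "j0 \<le> j" for j
      proof -
        let ?N = "2 ^ j :: nat"
        have T: "(\<Sum>k<?N. if 2 ^ j < a k then 1 else 0 :: real) < 1"
          using j0[OF j] by (simp add: stay1 a_def)
        \<comment> \<open>A sum of zeros and ones below 1 has no term equal to 1.\<close>
        have small: "a k \<le> 2 ^ j" if "k < ?N" for k
        proof (rule ccontr)
          assume *: "\<not> a k \<le> 2 ^ j"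
          have "(if 2 ^ j < a k then 1 else 0 :: real) \<le> (\<Sum>k<?N. if 2 ^ j < a k then 1 else 0)"
            using that by (intro member_le_sum) auto
          with T * show False by auto
        qed
        have trunc: "trunc_pow r j (\<omega> (m + k)) = a k" if "k < ?N" for k
          using small[OF that] by (simp add: trunc_pow_def a_def)
        have step: "trunc_pow r j (\<omega> (Suc (m + k))) \<le> trunc_diff r j (\<omega> (m + k), \<omega> (Suc (m + k))) + ((1 - ?q) * a k + r * b)" for k
        proof -
          have xG: "\<omega> (m + k) \<in> G" and x: "\<omega> (m + k) \<in> space M"
            using inG \<omega> by (auto simp: space_law_coord)
          have "ennreal (\<integral>y. trunc_pow r j y \<partial>R (\<omega> (m + k))) = (\<integral>\<^sup>+y. ennreal (trunc_pow r j y) \<partial>R (\<omega> (m + k)))"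
            using trunc_pow_integrable[OF x] by (intro nn_integral_eq_integral[symmetric]) (auto simp: trunc_pow_bounds)
          also have "\<dots> \<le> (\<integral>\<^sup>+y. ennreal (U y powr r) \<partial>R (\<omega> (m + k)))"
            by (intro nn_integral_mono ennreal_leI) (simp add: trunc_pow_def)
          also have "\<dots> \<le> ennreal ((1 - ?q) * a k + r * b)"
            unfolding a_def using r by (intro nn_integral_powr_drift[OF xG]) auto
          finally have "(\<integral>y. trunc_pow r j y \<partial>R (\<omega> (m + k))) \<le> (1 - ?q) * a k + r * b"
          proof (subst (asm) ennreal_le_iff)
            have "?q \<le> 1" using r l by (intro mult_le_one) auto
            then show "0 \<le> (1 - ?q) * a k + r * b" using a0 r b by simp
          qed
          then show ?thesis by (simp add: trunc_diff_def)
        qed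
        have "(\<Sum>k<?N. a k) - a 0 \<le> (\<Sum>k<?N. trunc_pow r j (\<omega> (Suc (m + k))))"
        proof -
          obtain p where p: "?N = Suc p" by (metis not0_implies_Suc power_not_zero zero_neq_numeral)
          have "(\<Sum>k<?N. a k) - a 0 = (\<Sum>k<p. a (Suc k))"
            unfolding p by (simp add: sum.lessThan_Suc_shift del: sum.lessThan_Suc)
          also have "\<dots> = (\<Sum>k<p. trunc_pow r j (\<omega> (Suc (m + k))))"
            using trunc[of "Suc k" for k] p by (intro sum.cong) auto
          also have "\<dots> \<le> (\<Sum>k<?N. trunc_pow r j (\<omega> (Suc (m + k))))"
            unfolding p by (simp add: trunc_pow_bounds)
          finally show ?thesis .
        qed
        also have "\<dots> \<le> (\<Sum>k<?N. trunc_diff r j (\<omega> (m + k), \<omega> (Suc (m + k))) + ((1 - ?q) * a k + r * b))"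
          by (rule sum_mono) (rule step)
        also have "\<dots> = 2 ^ j * ?S m L \<omega> j + (1 - ?q) * (\<Sum>k<?N. a k) + 2 ^ j * (r * b)"
          by (simp add: stay1 sum.distrib sum_distrib_left[symmetric])
        also have "2 ^ j * ?S m L \<omega> j \<le> 2 ^ j * 1"
        proof (rule mult_left_mono)
          have "(?S m L \<omega> j)\<^sup>2 \<le> 1\<^sup>2" using j0[OF j] by simp
          then show "?S m L \<omega> j \<le> 1" by (rule power2_le_imp_le) simp
        qed simp
        finally have "?q * (\<Sum>k<?N. a k) \<le> a 0 + 2 ^ j + 2 ^ j * (r * b)"
          by (simp add: algebra_simps)
        also have "\<dots> \<le> (2 + r * b) * 2 ^ j"
          using small[of 0] by (simp add: algebra_simps)
        finally show ?thesis using q by (simp add: field_simps)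
      qed
      show "\<exists>B. \<forall>n. (\<Sum>k<n. U (\<omega> (m + k)) powr r) \<le> B * (real n + 1)"
      proof (intro exI allI)
        fix n :: nat
        obtain i where i: "2 ^ i \<le> n + 1" "n + 1 < 2 ^ (i + 1)"
          using ex_power_ivl1[of 2 "n + 1"] by auto
        \<comment> \<open>Adding \<open>j0\<close> brings small n into the range of the dyadic
          bound; it costs the constant factor 2^(j0 + 1).\<close>
        let ?j = "j0 + i + 1"
        have "n \<le> 2 ^ ?j"
        proof -
          have "(2::nat) ^ (i + 1) \<le> 2 ^ ?j" by (rule power_increasing) auto
          with i show ?thesis by linarith
        qed
        then have "(\<Sum>k<n. a k) \<le> (\<Sum>k<2 ^ ?j. a k)"
          by (intro sum_mono2) (auto simp: a0)
        also have "\<dots> \<le> (2 + r * b) / ?q * 2 ^ ?j" by (rule dyadic) simp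
        also have "\<dots> \<le> (2 + r * b) / ?q * (2 ^ (j0 + 1) * (real n + 1))"
        proof (rule mult_left_mono)
          have "(2::real) ^ i \<le> real n + 1" using of_nat_mono[OF i(1), where 'a=real] by simp
          then show "(2::real) ^ ?j \<le> 2 ^ (j0 + 1) * (real n + 1)"
            by (simp add: power_add)
          show "0 \<le> (2 + r * b) / ?q" using r b q by auto
        qed
        finally show "(\<Sum>k<n. U (\<omega> (m + k)) powr r) \<le> ((2 + r * b) / ?q * 2 ^ (j0 + 1)) * (real n + 1)"
          by (simp add: a_def mult.assoc)
      qed
    qed
  qed
qed

end

section \<open>Uniform geometric ergodicity\<close>

locale markov_kernel =
  fixes M :: "'a measure" and P :: "'a \<Rightarrow> 'a measure"
  assumes P: "P \<in> M \<rightarrow>\<^sub>M prob_algebra M"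
begin

lemma prob_space_P: "x \<in> space M \<Longrightarrow> prob_space (P x)"
  and sets_P: "x \<in> space M \<Longrightarrow> sets (P x) = sets M"
  and space_P: "x \<in> space M \<Longrightarrow> space (P x) = space M"
  using measurable_space[OF P] by (auto simp: space_prob_algebra dest: sets_eq_imp_space_eq)

lemma measurable_P [measurable]: "P \<in> M \<rightarrow>\<^sub>M subprob_algebra M"
  using P by (rule measurable_prob_algebraD)

lemma borel_measurable_P: "x \<in> space M \<Longrightarrow> h \<in> borel_measurable (P x) \<longleftrightarrow> h \<in> borel_measurable M"
  by (rule arg_cong[of _ _ "\<lambda>A. h \<in> A"], rule measurable_cong_sets) (simp_all add: sets_P)

lemma kernel_kernel_pow: "markov_kernel M (kernel_pow M P n)"
proof
  show "kernel_pow M P n \<in> M \<rightarrow>\<^sub>M prob_algebra M"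
  proof (induction n)
    case 0
    then show ?case by (simp add: measurable_return_prob_space)
  next
    case (Suc n)
    then show ?case
      using measurable_bind_prob_space[OF P Suc] by (simp add: kernel_pow.simps(2)[abs_def])
  qed
qed

lemma nn_integral_kernel_pow_Suc:
  assumes x: "x \<in> space M" and h: "h \<in> borel_measurable M"
  shows "(\<integral>\<^sup>+y. h y \<partial>kernel_pow M P (Suc n) x) = (\<integral>\<^sup>+y. \<integral>\<^sup>+z. h z \<partial>kernel_pow M P n y \<partial>P x)"
proof -
  interpret n: markov_kernel M "kernel_pow M P n" by (rule kernel_kernel_pow)
  show ?thesis
    unfolding kernel_pow.simps
    by (rule nn_integral_bind[OF h]) (simp add: measurable_cong_sets[OF sets_P[OF x] refl])
qed

lemma nn_integral_kernel_pow_0: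
  assumes x: "x \<in> space M" and h: "h \<in> borel_measurable M"
  shows "(\<integral>\<^sup>+y. h y \<partial>kernel_pow M P 0 x) = h x"
  using assms by (simp add: nn_integral_return)

lemma kernel_app_bounded:
  fixes f :: "'a \<Rightarrow> real"
  assumes "\<And>x. x \<in> space M \<Longrightarrow> \<bar>f x\<bar> \<le> F" and x: "x \<in> space M"
  shows "\<bar>kernel_app P f x\<bar> \<le> F"
proof -
  interpret Px: prob_space "P x" by (rule prob_space_P[OF x])
  show ?thesis
    unfolding kernel_app_def using assms by (intro Px.abs_expectation_le_const) (simp add: space_P)
qed

lemma measurable_kernel_app [measurable]:
  fixes f :: "'a \<Rightarrow> real"
  assumes "f \<in> borel_measurable M"
  shows "kernel_app P f \<in> borel_measurable M"
  unfolding kernel_app_def[abs_def]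
  using measurable_compose[OF measurable_P integral_measurable_subprob_algebra[OF assms]] .

lemma funpow_kernel_app:
  fixes f :: "'a \<Rightarrow> real"
  assumes f: "f \<in> borel_measurable M" and F: "\<And>x. x \<in> space M \<Longrightarrow> \<bar>f x\<bar> \<le> F"
  shows "(kernel_app P ^^ n) f \<in> borel_measurable M"
    and "x \<in> space M \<Longrightarrow> \<bar>(kernel_app P ^^ n) f x\<bar> \<le> F"
proof (induction n arbitrary: x)
  case (Suc n)
  { case 1 then show ?case using Suc.IH(1) by simp
  next case 2 then show ?case using kernel_app_bounded[OF Suc.IH(2)] by simp }
qed (use f F in auto)

lemma integrable_bounded_P:
  fixes f :: "'a \<Rightarrow> real"
  assumes f: "f \<in> borel_measurable M" and F: "\<And>x. x \<in> space M \<Longrightarrow> \<bar>f x\<bar> \<le> F" and x: "x \<in> space M"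
  shows "integrable (P x) f"
proof -
  interpret Px: prob_space "P x" by (rule prob_space_P[OF x])
  show ?thesis
    using f F x by (intro Px.integrable_const_bound[where B=F] AE_I2) (auto simp: space_P borel_measurable_P)
qed

lemma kernel_app_kernel_pow_Suc:
  fixes f :: "'a \<Rightarrow> real"
  assumes f: "f \<in> borel_measurable M" and F: "\<And>x. x \<in> space M \<Longrightarrow> \<bar>f x\<bar> \<le> F" and x: "x \<in> space M"
  shows "kernel_app (kernel_pow M P (Suc n)) f x = kernel_app P (kernel_app (kernel_pow M P n) f) x"
proof -
  interpret n: markov_kernel M "kernel_pow M P n" by (rule kernel_kernel_pow)
  interpret Px: prob_space "P x" by (rule prob_space_P[OF x])
  show ?thesis
    unfolding kernel_app_def kernel_pow.simps
  proof (rule integral_bind[OF f F, where B'=1])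
    show "kernel_pow M P n \<in> P x \<rightarrow>\<^sub>M subprob_algebra M"
      by (simp add: measurable_cong_sets[OF sets_P[OF x] refl])
    show "AE y in P x. emeasure (kernel_pow M P n y) (space (kernel_pow M P n y)) \<le> ennreal 1"
      using x by (intro AE_I2) (simp add: space_P n.prob_space_P[THEN prob_space.emeasure_space_1])
  qed (auto intro: Px.finite_measure_axioms)
qed

text \<open>Drift and minorization speak of the measures \<open>kernel_pow\<close>, the Poisson
  equation of the iterated operator; this identifies the two forms of P^n f.\<close>

lemma kernel_app_kernel_pow:
  fixes f :: "'a \<Rightarrow> real"
  assumes f: "f \<in> borel_measurable M" and F: "\<And>x. x \<in> space M \<Longrightarrow> \<bar>f x\<bar> \<le> F" and x: "x \<in> space M"
  shows "kernel_app (kernel_pow M P n) f x = (kernel_app P ^^ n) f x"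
  using x
proof (induction n arbitrary: x)
  case 0
  then show ?case using f by (simp add: kernel_app_def integral_return)
next
  case (Suc n)
  have "kernel_app P (kernel_app (kernel_pow M P n) f) x = kernel_app P ((kernel_app P ^^ n) f) x"
    unfolding kernel_app_def[of P "kernel_app (kernel_pow M P n) f"] kernel_app_def[of P "(kernel_app P ^^ n) f"]
    using Suc by (intro Bochner_Integration.integral_cong) (auto simp: space_P)
  then show ?case using kernel_app_kernel_pow_Suc[OF f F Suc.prems, of n] by (simp del: kernel_pow.simps)
qed

lemma integral_kernel_app_invariant:
  fixes f :: "'a \<Rightarrow> real"
  assumes "prob_space M" and inv: "M \<bind> P = M"
    and f: "f \<in> borel_measurable M" and F: "\<And>x. x \<in> space M \<Longrightarrow> \<bar>f x\<bar> \<le> F"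
  shows "(\<integral>x. (kernel_app P ^^ n) f x \<partial>M) = (\<integral>x. f x \<partial>M)"
proof (induction n)
  case (Suc n)
  interpret prob_space M by fact
  have "(\<integral>x. (kernel_app P ^^ n) f x \<partial>(M \<bind> P)) = (\<integral>x. kernel_app P ((kernel_app P ^^ n) f) x \<partial>M)"
    unfolding kernel_app_def[of P "(kernel_app P ^^ n) f"]
    by (rule integral_bind[where B'=1 and B=F and K=M])
       (use funpow_kernel_app[OF f F] in \<open>auto intro!: finite_measure_axioms AE_I2 simp: prob_space_P[THEN prob_space.emeasure_space_1]\<close>)
  then show ?case using Suc by (simp add: inv)
qed simp

lemma nn_integral_kernel_pow_drift:
  assumes V[measurable]: "V \<in> borel_measurable M" and V0: "\<And>x. x \<in> space M \<Longrightarrow> 0 \<le> V x"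
    and l: "0 \<le> l" "l < 1" and b: "0 \<le> b"
    and drift: "\<And>x. x \<in> space M \<Longrightarrow> (\<integral>\<^sup>+y. ennreal (V y) \<partial>P x) \<le> ennreal (l * V x + b)"
    and x: "x \<in> space M"
  shows "(\<integral>\<^sup>+y. ennreal (V y) \<partial>kernel_pow M P n x) \<le> ennreal (l ^ n * V x + b * (1 - l ^ n) / (1 - l))"
  using x
proof (induction n arbitrary: x)
  case 0
  then show ?case using l b V0 by (subst nn_integral_kernel_pow_0) (auto intro!: ennreal_leI)
next
  case (Suc n)
  interpret Px: prob_space "P x" by (rule prob_space_P[OF Suc.prems])
  let ?K = "b * (1 - l ^ n) / (1 - l)"
  have K0: "0 \<le> ?K" using l b by (auto intro!: divide_nonneg_nonneg mult_nonneg_nonneg simp: power_le_one)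
  have [measurable]: "V \<in> borel_measurable (P x)" by (simp add: borel_measurable_P Suc.prems)
  have "(\<integral>\<^sup>+y. ennreal (V y) \<partial>kernel_pow M P (Suc n) x) = (\<integral>\<^sup>+y. \<integral>\<^sup>+z. ennreal (V z) \<partial>kernel_pow M P n y \<partial>P x)"
    by (rule nn_integral_kernel_pow_Suc[OF Suc.prems]) measurable
  also have "\<dots> \<le> (\<integral>\<^sup>+y. ennreal (l ^ n) * ennreal (V y) + ennreal ?K \<partial>P x)"
  proof (rule nn_integral_mono)
    fix y assume "y \<in> space (P x)"
    then have y: "y \<in> space M" using Suc.prems by (simp add: space_P)
    show "(\<integral>\<^sup>+z. ennreal (V z) \<partial>kernel_pow M P n y) \<le> ennreal (l ^ n) * ennreal (V y) + ennreal ?K"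
      using Suc.IH[OF y] l V0[OF y] K0 by (simp add: ennreal_mult ennreal_plus)
  qed
  also have "\<dots> = ennreal (l ^ n) * (\<integral>\<^sup>+y. ennreal (V y) \<partial>P x) + ennreal ?K"
    by (subst nn_integral_add) (auto simp: nn_integral_cmult Px.emeasure_space_1)
  also have "\<dots> \<le> ennreal (l ^ n) * ennreal (l * V x + b) + ennreal ?K"
    using drift[OF Suc.prems] by (intro add_mono mult_left_mono) auto
  also have "\<dots> = ennreal (l ^ n * (l * V x + b) + ?K)"
    using l b V0[OF Suc.prems] K0 by (subst ennreal_plus) (auto simp: ennreal_mult)
  also have "l ^ n * (l * V x + b) + ?K = l ^ Suc n * V x + b * (1 - l ^ Suc n) / (1 - l)"
    using l by (simp add: field_simps)
  finally show ?case .
qed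

end

section \<open>Hitting the small set and minorizing kernel powers\<close>

context markov_kernel
begin

text \<open>\<open>hit C j x\<close> is the probability that the chain started at \<open>x\<close> visits \<open>C\<close> at one of
  the times \<open>0, \<dots>, j\<close>.\<close>

primrec hit :: "'a set \<Rightarrow> nat \<Rightarrow> 'a \<Rightarrow> ennreal" where
  "hit C 0 x = indicator C x"
| "hit C (Suc j) x = (if x \<in> C then 1 else \<integral>\<^sup>+y. hit C j y \<partial>P x)"

lemma measurable_hit [measurable]:
  assumes [measurable]: "C \<in> sets M"
  shows "hit C j \<in> borel_measurable M"
proof (induction j)
  case (Suc j)
  have "(\<lambda>x. \<integral>\<^sup>+y. hit C j y \<partial>P x) \<in> borel_measurable M"
    by (rule measurable_compose[OF measurable_P nn_integral_measurable_subprob_algebra[OF Suc]])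
  then show ?case by (simp add: hit.simps(2)[abs_def])
qed (simp add: hit.simps(1)[abs_def])

lemma hit_in: "x \<in> C \<Longrightarrow> hit C j x = 1"
  by (cases j) auto

text \<open>Outside C the mean of V shrinks by the factor l at each step while V stays at least 1,
  so C is avoided up to time j with probability at most l^j * V x. The form as a sum avoids
  subtraction in \<open>ennreal\<close>.\<close>

lemma one_le_hit:
  assumes C[measurable]: "C \<in> sets M" and V[measurable]: "V \<in> borel_measurable M"
    and V1: "\<And>x. x \<in> space M \<Longrightarrow> 1 \<le> V x" and l: "0 \<le> l"
    and drift: "\<And>x. x \<in> space M - C \<Longrightarrow> (\<integral>\<^sup>+y. ennreal (V y) \<partial>P x) \<le> ennreal (l * V x)"
    and x: "x \<in> space M"
  shows "1 \<le> hit C j x + ennreal (l ^ j * V x)"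
  using x
proof (induction j arbitrary: x)
  case 0
  then show ?case using V1[OF 0] by (auto simp: indicator_def ennreal_leI[of 1, simplified])
next
  case (Suc j)
  show ?case
  proof (cases "x \<in> C")
    case False
    interpret Px: prob_space "P x" by (rule prob_space_P[OF Suc.prems])
    have [measurable]: "V \<in> borel_measurable (P x)" "hit C j \<in> borel_measurable (P x)"
      by (simp_all add: borel_measurable_P Suc.prems)
    have "1 = (\<integral>\<^sup>+y. 1 \<partial>P x)" by (simp add: Px.emeasure_space_1)
    also have "\<dots> \<le> (\<integral>\<^sup>+y. hit C j y + ennreal (l ^ j) * ennreal (V y) \<partial>P x)"
    proof (rule nn_integral_mono)
      fix y assume "y \<in> space (P x)"
      then have y: "y \<in> space M" using Suc.prems by (simp add: space_P)
      show "1 \<le> hit C j y + ennreal (l ^ j) * ennreal (V y)"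
        using Suc.IH[OF y] l by (simp add: ennreal_mult')
    qed
    also have "\<dots> = (\<integral>\<^sup>+y. hit C j y \<partial>P x) + ennreal (l ^ j) * (\<integral>\<^sup>+y. ennreal (V y) \<partial>P x)"
      by (subst nn_integral_add) (auto simp: nn_integral_cmult)
    also have "\<dots> \<le> (\<integral>\<^sup>+y. hit C j y \<partial>P x) + ennreal (l ^ j) * ennreal (l * V x)"
      using drift[of x] False Suc.prems by (intro add_left_mono mult_left_mono) auto
    also have "\<dots> = hit C (Suc j) x + ennreal (l ^ Suc j * V x)"
      using l False by (simp add: ennreal_mult'[symmetric] mult_ac)
    finally show ?thesis .
  qed simp
qed

lemma nn_integral_minorization:
  assumes sets_\<phi>: "sets \<phi> = sets M" and e: "0 \<le> e" and \<phi>: "finite_measure \<phi>"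
    and minor: "\<And>A. A \<in> sets M \<Longrightarrow> e * measure \<phi> A \<le> measure (P x) A"
    and x: "x \<in> space M" and h: "h \<in> borel_measurable M"
  shows "ennreal e * (\<integral>\<^sup>+y. h y \<partial>\<phi>) \<le> (\<integral>\<^sup>+y. h y \<partial>P x)"
proof -
  interpret Px: prob_space "P x" by (rule prob_space_P[OF x])
  interpret \<phi>: finite_measure \<phi> by (rule \<phi>)
  have "scale_measure (ennreal e) \<phi> \<le> P x"
    using minor e by (subst le_measure)
      (auto simp: sets_P[OF x] sets_\<phi> Px.emeasure_eq_measure \<phi>.emeasure_eq_measure ennreal_mult[symmetric] intro!: ennreal_leI)
  then have "(\<integral>\<^sup>+y. h y \<partial>scale_measure (ennreal e) \<phi>) \<le> (\<integral>\<^sup>+y. h y \<partial>P x)"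
    by (intro nn_integral_mono_measure) (simp_all add: sets_P[OF x] sets_\<phi>)
  then show ?thesis
    using h by (simp add: nn_integral_scale_measure measurable_cong_sets[OF sets_\<phi> refl])
qed

text \<open>The time of the visit to C is random, but a minorization at the fixed time j + 1 is
  wanted. Once in C, each step is replaced by a draw from \<phi> that falls back into C, at a cost
  of e * \<phi>(C), until the last step draws from \<phi> freely. Steps before the visit cost
  nothing, so the constant with j returns covers every visiting time.\<close>

lemma kernel_pow_minorization:
  assumes C[measurable]: "C \<in> sets M" and sets_\<phi>: "sets \<phi> = sets M" and \<phi>: "prob_space \<phi>"
    and e: "0 < e" "e \<le> 1"
    and minor: "\<And>x A. x \<in> C \<Longrightarrow> A \<in> sets M \<Longrightarrow> e * measure \<phi> A \<le> measure (P x) A"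
    and x: "x \<in> space M" and h[measurable]: "h \<in> borel_measurable M"
  shows "ennreal (e * (e * measure \<phi> C) ^ j) * hit C j x * (\<integral>\<^sup>+y. h y \<partial>\<phi>) \<le> (\<integral>\<^sup>+y. h y \<partial>kernel_pow M P (Suc j) x)"
  using x
proof (induction j arbitrary: x)
  case 0
  have "(\<integral>\<^sup>+y. h y \<partial>kernel_pow M P (Suc 0) x) = (\<integral>\<^sup>+y. h y \<partial>P x)"
    using 0 by (subst nn_integral_kernel_pow_Suc) (auto intro!: nn_integral_cong simp: nn_integral_kernel_pow_0 space_P simp del: kernel_pow.simps)
  moreover have "ennreal e * (\<integral>\<^sup>+y. h y \<partial>\<phi>) \<le> (\<integral>\<^sup>+y. h y \<partial>P x)" if "x \<in> C"
    using e minor[OF that] 0 prob_space.finite_measure[OF \<phi>] by (intro nn_integral_minorization sets_\<phi>) auto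
  ultimately show ?case by (auto simp: indicator_def)
next
  case (Suc j)
  interpret \<phi>: prob_space \<phi> by (rule \<phi>)
  interpret Px: prob_space "P x" by (rule prob_space_P[OF Suc.prems])
  interpret N: markov_kernel M "kernel_pow M P (Suc j)" by (rule kernel_kernel_pow)
  let ?d = "measure \<phi> C" and ?I = "\<integral>\<^sup>+y. h y \<partial>\<phi>"
  let ?c = "\<lambda>j. e * (e * ?d) ^ j"
  have ed: "0 \<le> e * ?d" "e * ?d \<le> 1" using e by (auto intro!: mult_le_one)
  have c0: "0 \<le> ?c j" using e by simp
  let ?g = "\<lambda>y. \<integral>\<^sup>+z. h z \<partial>kernel_pow M P (Suc j) y"
  have g: "?g \<in> borel_measurable M"
    by (rule measurable_compose[OF N.measurable_P nn_integral_measurable_subprob_algebra[OF h]])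
  have [measurable]: "hit C j \<in> borel_measurable (P x)" by (simp add: borel_measurable_P Suc.prems)
  have eq: "(\<integral>\<^sup>+y. h y \<partial>kernel_pow M P (Suc (Suc j)) x) = (\<integral>\<^sup>+y. ?g y \<partial>P x)"
    by (rule nn_integral_kernel_pow_Suc[OF Suc.prems h])
  show ?case
  proof (cases "x \<in> C")
    case True
    have "ennreal (?c (Suc j)) * hit C (Suc j) x * ?I = ennreal e * (\<integral>\<^sup>+y. ennreal (?c j) * ?I * indicator C y \<partial>\<phi>)"
    proof -
      have "(\<integral>\<^sup>+y. ennreal (?c j) * ?I * indicator C y \<partial>\<phi>) = ennreal (?c j) * ?I * ennreal ?d"
        by (subst nn_integral_cmult_indicator) (auto simp: sets_\<phi> \<phi>.emeasure_eq_measure)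
      moreover have "ennreal (?c (Suc j)) = ennreal e * ennreal ?d * ennreal (?c j)"
        using e by (simp add: ennreal_mult[symmetric] mult_ac)
      ultimately show ?thesis using True by (simp add: mult_ac)
    qed
    also have "\<dots> \<le> ennreal e * (\<integral>\<^sup>+y. ?g y \<partial>\<phi>)"
    proof (intro mult_left_mono nn_integral_mono)
      fix y assume "y \<in> space \<phi>"
      then have y: "y \<in> space M" using sets_eq_imp_space_eq[OF sets_\<phi>] by simp
      show "ennreal (?c j) * ?I * indicator C y \<le> ?g y"
        using Suc.IH[OF y] hit_in[of y C j] by (auto simp: indicator_def simp del: kernel_pow.simps)
    qed simp
    also have "\<dots> \<le> (\<integral>\<^sup>+y. ?g y \<partial>P x)"
      using e minor[OF True] Suc.prems \<phi>.finite_measure_axioms by (intro nn_integral_minorization sets_\<phi> g) auto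
    finally show ?thesis unfolding eq .
  next
    case False
    have "ennreal (?c (Suc j)) * hit C (Suc j) x * ?I \<le> ennreal (?c j) * hit C (Suc j) x * ?I"
      using ed e by (intro mult_right_mono ennreal_leI mult_left_mono power_decreasing) auto
    also have "\<dots> = (\<integral>\<^sup>+y. (ennreal (?c j) * ?I) * hit C j y \<partial>P x)"
      using False by (subst nn_integral_cmult) (auto simp: mult_ac)
    also have "\<dots> \<le> (\<integral>\<^sup>+y. ?g y \<partial>P x)"
      using Suc.IH Suc.prems by (intro nn_integral_mono) (simp add: space_P mult_ac del: kernel_pow.simps)
    finally show ?thesis unfolding eq .
  qed
qed

end

section \<open>Contraction in a weighted norm, modulo constants\<close>

lemma ex_centre:
  fixes f w :: "'a \<Rightarrow> real"
  assumes "\<And>x y. x \<in> S \<Longrightarrow> y \<in> S \<Longrightarrow> \<bar>f x - f y\<bar> \<le> w x + w y"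
  shows "\<exists>s. \<forall>x\<in>S. \<bar>f x - s\<bar> \<le> w x"
proof (cases "S = {}")
  case False
  \<comment> \<open>The intervals [f x - w x, f x + w x] meet pairwise, so on the line they share a
    point; the infimum of the right ends is one. Thus a bound on differences becomes a bound on the
    distance to a constant.\<close>
  define s where "s = (INF y\<in>S. f y + w y)"
  have low: "f x - w x \<le> f y + w y" if "x \<in> S" "y \<in> S" for x y
    using assms[OF that] by linarith
  have bdd: "bdd_below ((\<lambda>y. f y + w y) ` S)"
  proof -
    obtain x where "x \<in> S" using False by auto
    then show ?thesis using low by (intro bdd_belowI2[where m="f x - w x"])
  qed
  have "f x - w x \<le> s" if "x \<in> S" for x
    unfolding s_def using low[OF that] False by (intro cINF_greatest)
  moreover have "s \<le> f x + w x" if "x \<in> S" for x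
    unfolding s_def by (rule cINF_lower[OF bdd that])
  ultimately show ?thesis by (intro exI[of _ s]) (simp add: abs_le_iff algebra_simps)
qed auto

text \<open>Chosen so that \<open>hm_beta a K * (2 * K) = a\<close>: for two starting points the
  minorization gains 2 * a, and the additive drift constants take back only half of it.\<close>

definition hm_beta :: "real \<Rightarrow> real \<Rightarrow> real" where
  "hm_beta a K = a / (2 * K)"

text \<open>Let S = V x + V y. For S below R = 4 * K / (1 - g) the minorization gives the factor 1 -
  a / 2. From R on, g * S + 2 * K \<le> (1 + g) / 2 * S, so the drift alone contracts; the second
  entry is the resulting ratio at S = R, where it is largest.\<close>

definition hm_rate :: "real \<Rightarrow> real \<Rightarrow> real \<Rightarrow> real" where
  "hm_rate a K g = (let \<beta> = hm_beta a K; R = 4 * K / (1 - g) in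
     max (1 - a / 2) ((2 + \<beta> * ((1 + g) / 2 * R)) / (2 + \<beta> * R)))"

lemma hm_rate:
  assumes "0 < a" "0 < K" "0 \<le> g" "g < 1"
  defines "\<beta> \<equiv> hm_beta a K" and "\<rho> \<equiv> hm_rate a K g" and "R \<equiv> 4 * K / (1 - g)"
  shows "0 < \<beta>" "0 < \<rho>" "\<rho> < 1"
    and "\<And>S. R \<le> S \<Longrightarrow> 2 + \<beta> * (g * S + 2 * K) \<le> \<rho> * (2 + \<beta> * S)"
    and "\<And>S. 0 \<le> S \<Longrightarrow> 2 * (1 - a) + \<beta> * (g * S + 2 * K) \<le> \<rho> * (2 + \<beta> * S)"
proof -
  let ?g = "(1 + g) / 2"
  show \<beta>: "0 < \<beta>" using assms(1,2) by (simp add: \<beta>_def hm_beta_def)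
  have R: "0 < R" using assms(1-4) by (simp add: R_def)
  have den: "0 < 2 + \<beta> * R" using \<beta> R by (simp add: add_pos_pos)
  have \<rho>: "\<rho> = max (1 - a / 2) ((2 + \<beta> * (?g * R)) / (2 + \<beta> * R))"
    unfolding \<rho>_def hm_rate_def Let_def \<beta>_def R_def by (rule refl)
  have gR: "?g * R < 1 * R" using R assms(4) by (intro mult_strict_right_mono) auto
  then have "\<beta> * (?g * R) < \<beta> * R" using \<beta> by simp
  then have "(2 + \<beta> * (?g * R)) / (2 + \<beta> * R) < 1" using den by (simp add: divide_less_eq)
  then show "\<rho> < 1" using assms(1) by (simp add: \<rho>)
  have \<rho>1: "1 - a / 2 \<le> \<rho>" and "(2 + \<beta> * (?g * R)) / (2 + \<beta> * R) \<le> \<rho>" by (simp_all add: \<rho>)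
  then have \<rho>2: "2 + \<beta> * (?g * R) \<le> \<rho> * (2 + \<beta> * R)" using den by (simp add: pos_divide_le_eq)
  \<comment> \<open>The second entry of the maximum is a weighted mean of 1 and \<open>?g\<close>,
    hence at least \<open>?g\<close>. This extends the bound at R to all larger S and also gives g
    \<le> \<rho> for the other case.\<close>
  have "?g * (2 + \<beta> * R) = ?g * 2 + \<beta> * (?g * R)"
    by (simp only: distrib_left) (simp only: mult_ac)
  then have "?g * (2 + \<beta> * R) \<le> 2 + \<beta> * (?g * R)" using assms(4) by simp
  with \<rho>2 have "?g * (2 + \<beta> * R) \<le> \<rho> * (2 + \<beta> * R)" by linarith
  then have \<rho>3: "?g \<le> \<rho>" using den by (simp only: mult_le_cancel_right_pos)
  then show "0 < \<rho>" using assms(3) by simp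
  have \<beta>K: "\<beta> * (2 * K) = a" using assms(2) by (simp add: \<beta>_def hm_beta_def)
  show "2 + \<beta> * (g * S + 2 * K) \<le> \<rho> * (2 + \<beta> * S)" if S: "R \<le> S" for S
  proof -
    have "4 * K = (1 - g) * R" using assms(4) by (simp add: R_def)
    also have "\<dots> \<le> (1 - g) * S" using S assms(4) by (intro mult_left_mono) auto
    finally have "g * S + 2 * K \<le> ?g * S" by (simp add: field_simps)
    then have "\<beta> * (g * S + 2 * K) \<le> \<beta> * (?g * S)" using \<beta> by simp
    moreover have "\<beta> * (?g * (S - R)) \<le> \<rho> * (\<beta> * (S - R))"
    proof -
      have "?g * (\<beta> * (S - R)) \<le> \<rho> * (\<beta> * (S - R))" using \<rho>3 \<beta> S by (intro mult_right_mono) auto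
      then show ?thesis by (simp add: mult_ac)
    qed
    moreover have "\<beta> * (?g * S) = \<beta> * (?g * R) + \<beta> * (?g * (S - R))"
      by (simp add: right_diff_distrib)
    moreover have "\<rho> * (2 + \<beta> * S) = \<rho> * (2 + \<beta> * R) + \<rho> * (\<beta> * (S - R))"
      by (simp add: algebra_simps)
    ultimately show ?thesis using \<rho>2 by linarith
  qed
  show "2 * (1 - a) + \<beta> * (g * S + 2 * K) \<le> \<rho> * (2 + \<beta> * S)" if S: "0 \<le> S" for S
  proof -
    have "g \<le> \<rho>" using \<rho>3 assms(4) by (simp add: field_simps)
    then have "g * (\<beta> * S) \<le> \<rho> * (\<beta> * S)" using \<beta> S by (intro mult_right_mono) auto
    then have "\<beta> * (g * S) \<le> \<rho> * (\<beta> * S)" by (simp add: mult_ac)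
    then show ?thesis using \<rho>1 \<beta>K by (simp add: algebra_simps)
  qed
qed

text \<open>Hairer and Mattingly's contraction in the weighted norm \<open>1 + \<beta> V\<close>, modulo constants.\<close>

lemma (in markov_kernel) hm_contraction:
  assumes V[measurable]: "V \<in> borel_measurable M" and V0: "\<And>x. x \<in> space M \<Longrightarrow> 0 \<le> V x"
    and K: "0 < K" and g: "0 \<le> g" "g < 1"
    and drift: "\<And>x. x \<in> space M \<Longrightarrow> (\<integral>\<^sup>+y. ennreal (V y) \<partial>P x) \<le> ennreal (g * V x + K)"
    and sets_\<phi>: "sets \<phi> = sets M" and \<phi>: "prob_space \<phi>" and a: "0 < a"
    and minor: "\<And>x h. x \<in> space M \<Longrightarrow> V x \<le> 4 * K / (1 - g) \<Longrightarrow> h \<in> borel_measurable M \<Longrightarrow>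
      ennreal a * (\<integral>\<^sup>+y. h y \<partial>\<phi>) \<le> (\<integral>\<^sup>+y. h y \<partial>P x)"
    and f[measurable]: "f \<in> borel_measurable M" and F: "\<And>x. x \<in> space M \<Longrightarrow> \<bar>f x\<bar> \<le> F" and A: "0 \<le> A"
    and fs: "\<And>x. x \<in> space M \<Longrightarrow> \<bar>f x - s\<bar> \<le> A * (1 + hm_beta a K * V x)"
  shows "\<exists>s'. \<forall>x\<in>space M. \<bar>kernel_app P f x - s'\<bar> \<le> hm_rate a K g * A * (1 + hm_beta a K * V x)"
proof -
  let ?\<beta> = "hm_beta a K" and ?\<rho> = "hm_rate a K g" and ?R = "4 * K / (1 - g)"
  note hm = hm_rate[OF a K g]
  interpret \<phi>: prob_space \<phi> by (rule \<phi>)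
  let ?W = "\<lambda>x. A * (1 + ?\<beta> * V x)"
  have PV: "integrable (P x) V" "(\<integral>y. V y \<partial>P x) \<le> g * V x + K" "0 \<le> (\<integral>y. V y \<partial>P x)" if x: "x \<in> space M" for x
  proof -
    have m: "V \<in> borel_measurable (P x)" by (simp add: borel_measurable_P x)
    have ae: "AE y in P x. 0 \<le> V y" using V0 x by (intro AE_I2) (simp add: space_P)
    have fin: "(\<integral>\<^sup>+y. ennreal (V y) \<partial>P x) < \<infinity>" using drift[OF x] by (simp add: le_less_trans)
    show int: "integrable (P x) V"
      using fin ae m by (intro integrableI_nonneg) auto
    show "0 \<le> (\<integral>y. V y \<partial>P x)" using ae by (rule integral_nonneg_AE)
    have "ennreal (\<integral>y. V y \<partial>P x) \<le> ennreal (g * V x + K)"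
      using drift[OF x] nn_integral_eq_integral[OF int ae] by simp
    then show "(\<integral>y. V y \<partial>P x) \<le> g * V x + K"
      using g K V0[OF x] by (subst (asm) ennreal_le_iff) (auto intro!: add_nonneg_nonneg)
  qed
  have W: "integrable (P x) ?W" "(\<integral>y. ?W y \<partial>P x) = A * (1 + ?\<beta> * (\<integral>y. V y \<partial>P x))"
    and int_f: "integrable (P x) (\<lambda>y. f y - s)" and app: "(\<integral>y. f y - s \<partial>P x) = kernel_app P f x - s"
    if x: "x \<in> space M" for x
  proof -
    interpret Px: prob_space "P x" by (rule prob_space_P[OF x])
    show "integrable (P x) ?W" "(\<integral>y. ?W y \<partial>P x) = A * (1 + ?\<beta> * (\<integral>y. V y \<partial>P x))"
      using PV(1)[OF x] by (simp_all add: Px.prob_space)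
    have "integrable (P x) f" by (rule integrable_bounded_P[OF f F x])
    then show "integrable (P x) (\<lambda>y. f y - s)" "(\<integral>y. f y - s \<partial>P x) = kernel_app P f x - s"
      by (simp_all add: kernel_app_def Px.prob_space)
  qed
  have far: "\<bar>kernel_app P f x - s\<bar> \<le> A * (1 + ?\<beta> * (\<integral>y. V y \<partial>P x))" if x: "x \<in> space M" for x
  proof -
    have "\<bar>kernel_app P f x - s\<bar> \<le> (\<integral>y. \<bar>f y - s\<bar> \<partial>P x)"
      unfolding app[OF x, symmetric] by (rule integral_abs_bound)
    also have "\<dots> \<le> (\<integral>y. ?W y \<partial>P x)"
      using int_f[OF x] W[OF x] fs x by (intro integral_mono) (auto simp: space_P)
    finally show ?thesis unfolding W(2)[OF x] .
  qed
  \<comment> \<open>On the level set the part a * \<phi> is common to all kernels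
    \<open>P x\<close>; its contribution cancels between two starting points. Removing it saves a *
    A, because the weight is at least A.\<close>
  have near: "\<bar>kernel_app P f x - s - a * (\<integral>y. f y - s \<partial>\<phi>)\<bar> \<le> A * (1 + ?\<beta> * (\<integral>y. V y \<partial>P x)) - a * A"
    if x: "x \<in> space M" and Vx: "V x \<le> ?R" for x
  proof -
    interpret Px: prob_space "P x" by (rule prob_space_P[OF x])
    have sp: "space \<phi> = space M" by (rule sets_eq_imp_space_eq[OF sets_\<phi>])
    have m\<phi>: "h \<in> borel_measurable \<phi> \<longleftrightarrow> h \<in> borel_measurable M" for h :: "'a \<Rightarrow> real"
      by (simp add: measurable_cong_sets[OF sets_\<phi> refl])
    have real_minor: "integrable \<phi> h" "a * (\<integral>y. h y \<partial>\<phi>) \<le> (\<integral>y. h y \<partial>P x)"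
      if h[measurable]: "h \<in> borel_measurable M" and h0: "\<And>y. y \<in> space M \<Longrightarrow> 0 \<le> h y" and int: "integrable (P x) h" for h
    proof -
      have ae: "AE y in P x. 0 \<le> h y" using h0 x by (intro AE_I2) (simp add: space_P)
      have ae\<phi>: "AE y in \<phi>. 0 \<le> h y" using h0 by (intro AE_I2) (simp add: sp)
      have le: "ennreal a * (\<integral>\<^sup>+y. ennreal (h y) \<partial>\<phi>) \<le> ennreal (\<integral>y. h y \<partial>P x)"
        using minor[OF x Vx, of "\<lambda>y. ennreal (h y)"] nn_integral_eq_integral[OF int ae] by simp
      then have "(\<integral>\<^sup>+y. ennreal (h y) \<partial>\<phi>) < \<infinity>"
        using a by (auto simp: less_top[symmetric] ennreal_mult_eq_top_iff top_unique)
      then show int\<phi>: "integrable \<phi> h"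
        using ae\<phi> by (intro integrableI_nonneg) (auto simp: m\<phi>)
      have "ennreal (a * (\<integral>y. h y \<partial>\<phi>)) \<le> ennreal (\<integral>y. h y \<partial>P x)"
        using le nn_integral_eq_integral[OF int\<phi> ae\<phi>] a integral_nonneg_AE[OF ae\<phi>] by (simp add: ennreal_mult)
      then show "a * (\<integral>y. h y \<partial>\<phi>) \<le> (\<integral>y. h y \<partial>P x)"
        using integral_nonneg_AE[OF ae] by (subst (asm) ennreal_le_iff) auto
    qed
    have V\<phi>: "integrable \<phi> V" using real_minor(1)[OF V V0 PV(1)[OF x]] by auto
    have V\<phi>0: "0 \<le> (\<integral>y. V y \<partial>\<phi>)" using V0 by (intro integral_nonneg_AE AE_I2) (simp add: sp)
    have f\<phi>: "integrable \<phi> f"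
      using F by (intro \<phi>.integrable_const_bound[where B=F] AE_I2) (auto simp: sp m\<phi>)
    have W\<phi>: "integrable \<phi> ?W" "(\<integral>y. ?W y \<partial>\<phi>) = A * (1 + ?\<beta> * (\<integral>y. V y \<partial>\<phi>))"
      using V\<phi> by (simp_all add: \<phi>.prob_space)
    let ?w = "\<integral>y. ?W y \<partial>P x" and ?w\<phi> = "\<integral>y. ?W y \<partial>\<phi>" and ?d = "\<integral>y. f y - s \<partial>P x" and ?d\<phi> = "\<integral>y. f y - s \<partial>\<phi>"
    have low: "a * A \<le> a * ?w\<phi>"
      unfolding W\<phi> using a A hm(1) V\<phi>0 by (intro mult_left_mono) (auto simp: algebra_simps intro!: mult_nonneg_nonneg)
    \<comment> \<open>The minorization concerns nonnegative functions, so it is applied to the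
      weight plus and minus f - s.\<close>
    have "a * (\<integral>y. ?W y + (f y - s) \<partial>\<phi>) \<le> (\<integral>y. ?W y + (f y - s) \<partial>P x)"
    proof (rule real_minor(2))
      show "0 \<le> ?W y + (f y - s)" if "y \<in> space M" for y
        using fs[OF that] by linarith
    qed (use W(1)[OF x] int_f[OF x] in auto)
    also have "(\<integral>y. ?W y + (f y - s) \<partial>\<phi>) = ?w\<phi> + ?d\<phi>"
      using W\<phi>(1) f\<phi> by (intro Bochner_Integration.integral_add) auto
    also have "(\<integral>y. ?W y + (f y - s) \<partial>P x) = ?w + ?d"
      using W(1)[OF x] int_f[OF x] by (intro Bochner_Integration.integral_add)
    finally have up: "a * (?w\<phi> + ?d\<phi>) \<le> ?w + ?d" .
    have "a * (\<integral>y. ?W y - (f y - s) \<partial>\<phi>) \<le> (\<integral>y. ?W y - (f y - s) \<partial>P x)"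
    proof (rule real_minor(2))
      show "0 \<le> ?W y - (f y - s)" if "y \<in> space M" for y
        using fs[OF that] by linarith
    qed (use W(1)[OF x] int_f[OF x] in auto)
    also have "(\<integral>y. ?W y - (f y - s) \<partial>\<phi>) = ?w\<phi> - ?d\<phi>"
      using W\<phi>(1) f\<phi> by (intro Bochner_Integration.integral_diff) auto
    also have "(\<integral>y. ?W y - (f y - s) \<partial>P x) = ?w - ?d"
      using W(1)[OF x] int_f[OF x] by (intro Bochner_Integration.integral_diff)
    finally have dn: "a * (?w\<phi> - ?d\<phi>) \<le> ?w - ?d" .
    have "\<bar>?d - a * ?d\<phi>\<bar> \<le> ?w - a * A"
      using low up dn unfolding distrib_left[of a] right_diff_distrib[of a] abs_le_iff by linarith
    then show ?thesis unfolding app[OF x] W(2)[OF x] .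
  qed
  have "\<bar>kernel_app P f x - kernel_app P f y\<bar> \<le> ?\<rho> * A * (1 + ?\<beta> * V x) + ?\<rho> * A * (1 + ?\<beta> * V y)"
    if x: "x \<in> space M" and y: "y \<in> space M" for x y
  proof -
    let ?S = "V x + V y"
    have sum: "?\<beta> * ((\<integral>u. V u \<partial>P x) + (\<integral>u. V u \<partial>P y)) \<le> ?\<beta> * (g * ?S + 2 * K)"
      using PV(2)[OF x] PV(2)[OF y] hm(1) by (intro mult_left_mono) (auto simp: algebra_simps)
    have "\<bar>kernel_app P f x - kernel_app P f y\<bar> \<le> A * (?\<rho> * (2 + ?\<beta> * ?S))"
    proof (cases "?R \<le> ?S")
      case True
      have "\<bar>kernel_app P f x - kernel_app P f y\<bar> \<le> A * (2 + ?\<beta> * ((\<integral>u. V u \<partial>P x) + (\<integral>u. V u \<partial>P y)))"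
        using far[OF x] far[OF y] by (simp add: algebra_simps)
      also have "\<dots> \<le> A * (?\<rho> * (2 + ?\<beta> * ?S))"
        using sum hm(4)[OF True] A by (intro mult_left_mono) auto
      finally show ?thesis .
    next
      case False
      then have "V x \<le> ?R" "V y \<le> ?R" using V0[OF x] V0[OF y] by auto
      then have "\<bar>kernel_app P f x - kernel_app P f y\<bar> \<le> A * (2 * (1 - a) + ?\<beta> * ((\<integral>u. V u \<partial>P x) + (\<integral>u. V u \<partial>P y)))"
        using near[OF x] near[OF y] by (simp add: algebra_simps)
      also have "\<dots> \<le> A * (?\<rho> * (2 + ?\<beta> * ?S))"
        using sum hm(5)[of ?S] A V0[OF x] V0[OF y] by (intro mult_left_mono) auto
      finally show ?thesis .
    qed
    then show ?thesis by (simp add: algebra_simps)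
  qed
  then show ?thesis by (rule ex_centre)
qed

text \<open>Integrating the drift inequality for the truncation \<open>min V m\<close> avoids assuming \<open>\<pi>(V) < \<infinity>\<close>.\<close>

lemma (in markov_kernel) invariant_nn_integral_le:
  assumes "prob_space M" and inv: "M \<bind> P = M"
    and V[measurable]: "V \<in> borel_measurable M" and V0: "\<And>x. x \<in> space M \<Longrightarrow> 0 \<le> V x"
    and l: "0 \<le> l" "l < 1" and b: "0 \<le> b"
    and drift: "\<And>x. x \<in> space M \<Longrightarrow> (\<integral>\<^sup>+y. ennreal (V y) \<partial>P x) \<le> ennreal (l * V x + b)"
  shows "(\<integral>\<^sup>+x. ennreal (V x) \<partial>M) \<le> ennreal (b / (1 - l))"
proof -
  interpret prob_space M by fact
  define v0 where "v0 = b / (1 - l)"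
  have v0: "0 \<le> v0" "l * v0 + b = v0"
    using l b by (auto simp: v0_def field_simps)
  have bounded: "(\<integral>\<^sup>+x. ennreal (V x) * indicator {x. V x \<le> real m} x \<partial>M) \<le> ennreal v0" if m: "v0 \<le> real m" for m :: nat
  proof -
    let ?T = "\<lambda>x. min (V x) (real m)" and ?D = "\<lambda>x. min (l * V x + b) (real m)"
    have T_bd: "\<bar>?T x\<bar> \<le> real m" and D_bd: "\<bar>?D x\<bar> \<le> real m" if "x \<in> space M" for x
      using V0[OF that] l b by (subst abs_of_nonneg; simp)+
    have T_int: "integrable M ?T" and D_int: "integrable M ?D"
      using T_bd D_bd by (intro integrable_const_bound[where B="real m"] AE_I2; simp)+
    have P_int: "(\<integral>x. kernel_app P ?T x \<partial>M) = (\<integral>x. ?T x \<partial>M)"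
      using integral_kernel_app_invariant[OF assms(1) inv, of ?T "real m" 1] T_bd by simp
    have "(\<integral>x. kernel_app P ?T x \<partial>M) \<le> (\<integral>x. ?D x \<partial>M)"
    proof (rule integral_mono)
      show "integrable M (kernel_app P ?T)"
        using kernel_app_bounded[where f="?T" and F="real m", OF T_bd] by (intro integrable_const_bound[where B="real m"] AE_I2) auto
      show "integrable M ?D" by fact
      fix x assume x: "x \<in> space M"
      interpret Px: prob_space "P x" by (rule prob_space_P[OF x])
      have ti: "integrable (P x) ?T" using T_bd by (intro integrable_bounded_P x) auto
      have "ennreal (kernel_app P ?T x) = (\<integral>\<^sup>+y. ennreal (?T y) \<partial>P x)"
        unfolding kernel_app_def using V0 x
        by (intro nn_integral_eq_integral[OF ti, symmetric] AE_I2) (simp add: space_P)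
      also have "\<dots> \<le> (\<integral>\<^sup>+y. ennreal (V y) \<partial>P x)"
        by (intro nn_integral_mono ennreal_leI) simp
      also have "\<dots> \<le> ennreal (l * V x + b)" by (rule drift[OF x])
      finally have "kernel_app P ?T x \<le> l * V x + b"
        using l b V0[OF x] by (subst (asm) ennreal_le_iff) auto
      moreover have "kernel_app P ?T x \<le> real m" using kernel_app_bounded[where f="?T" and F="real m", OF T_bd x] by simp
      ultimately show "kernel_app P ?T x \<le> ?D x" by simp
    qed
    then have le: "(\<integral>x. ?T x - ?D x \<partial>M) \<le> 0"
      using T_int D_int P_int by simp
    \<comment> \<open>Where V \<le> m, \<open>?T - ?D\<close> is at least (1 - l) * V - b; elsewhere
      it is nonnegative, hence at least - b. Since invariance makes the integral of
      \<open>?T - ?D\<close> at most 0, this bounds the integral of V over {V \<le> m} independently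
      of m.\<close>
    let ?I = "\<lambda>x. (if V x \<le> real m then V x else 0)"
    have I_int: "integrable M ?I"
      using V0 by (intro integrable_const_bound[where B="real m"] AE_I2) auto
    have "(1 - l) * (\<integral>x. ?I x \<partial>M) - b = (\<integral>x. (1 - l) * ?I x - b \<partial>M)"
      using I_int by (simp add: prob_space)
    also have "\<dots> \<le> (\<integral>x. ?T x - ?D x \<partial>M)"
    proof (rule integral_mono)
      show "integrable M (\<lambda>x. (1 - l) * ?I x - b)" "integrable M (\<lambda>x. ?T x - ?D x)"
        using I_int T_int D_int by auto
      fix x assume x: "x \<in> space M"
      show "(1 - l) * ?I x - b \<le> ?T x - ?D x"
      proof (cases "V x \<le> real m")
        case True
        then have "?D x \<le> l * V x + b" by simp
        with True show ?thesis by (simp add: algebra_simps)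
      qed (use b in auto)
    qed
    also note le
    finally have "(\<integral>x. ?I x \<partial>M) \<le> v0"
      using l by (simp add: v0_def field_simps)
    moreover have "(\<integral>\<^sup>+x. ennreal (V x) * indicator {x. V x \<le> real m} x \<partial>M) = (\<integral>\<^sup>+x. ennreal (?I x) \<partial>M)"
      by (intro nn_integral_cong) (auto simp: indicator_def)
    moreover have "(\<integral>\<^sup>+x. ennreal (?I x) \<partial>M) = ennreal (\<integral>x. ?I x \<partial>M)"
      using V0 by (intro nn_integral_eq_integral I_int AE_I2) auto
    ultimately show ?thesis by (simp add: ennreal_leI)
  qed
  have "(\<integral>\<^sup>+x. ennreal (V x) \<partial>M) = (\<integral>\<^sup>+x. (SUP m. ennreal (V x) * indicator {x. V x \<le> real m} x) \<partial>M)"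
  proof (rule nn_integral_cong)
    fix x
    obtain m :: nat where m: "V x \<le> real m" using real_arch_simple by blast
    show "ennreal (V x) = (SUP m. ennreal (V x) * indicator {x. V x \<le> real m} x)"
    proof (rule antisym)
      show "ennreal (V x) \<le> (SUP m. ennreal (V x) * indicator {x. V x \<le> real m} x)"
        using m by (intro SUP_upper2[of m]) auto
    qed (auto intro!: SUP_least simp: indicator_def)
  qed
  also have "\<dots> = (SUP m. \<integral>\<^sup>+x. ennreal (V x) * indicator {x. V x \<le> real m} x \<partial>M)"
    by (intro nn_integral_monotone_convergence_SUP)
       (auto simp: incseq_def le_fun_def indicator_def)
  also have "\<dots> \<le> ennreal v0"
  proof (rule SUP_least)
    fix m :: nat
    obtain m' :: nat where m': "v0 \<le> real m'" using real_arch_simple by blast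
    have "(\<integral>\<^sup>+x. ennreal (V x) * indicator {x. V x \<le> real m} x \<partial>M) \<le>
        (\<integral>\<^sup>+x. ennreal (V x) * indicator {x. V x \<le> real (max m m')} x \<partial>M)"
      by (intro nn_integral_mono mult_left_mono) (auto simp: indicator_def)
    also have "\<dots> \<le> ennreal v0" using m' by (intro bounded) simp
    finally show "(\<integral>\<^sup>+x. ennreal (V x) * indicator {x. V x \<le> real m} x \<partial>M) \<le> ennreal v0" .
  qed
  finally show ?thesis by (simp add: v0_def)
qed

text \<open>Write z as z^(1 - r) * z^r and bound each factor separately. It trades a geometric bound
  of order V and a trivial constant bound for a geometric bound of order V^r.\<close>

lemma le_powr_interpolate:
  fixes z a c r :: real
  assumes "0 \<le> z" "z \<le> a" "z \<le> c" "0 \<le> r" "r \<le> 1"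
  shows "z \<le> a powr (1 - r) * c powr r"
proof (cases "z = 0")
  case False
  then have "z = z powr (1 - r) * z powr r" using assms by (simp add: powr_add[symmetric])
  also have "\<dots> \<le> a powr (1 - r) * c powr r"
    using assms by (intro mult_mono powr_mono2) auto
  finally show ?thesis .
qed simp

text \<open>The number of steps of the skeleton depends on the minorization and drift constants only, so
  it is the same for the whole family of kernels.\<close>

lemma uniform_ergodicity:
  fixes P :: "'t \<Rightarrow> 'a \<Rightarrow> 'a measure" and f :: "'a \<Rightarrow> real"
  assumes \<pi>: "prob_space \<pi>"
    and P: "\<And>\<theta>. \<theta> \<in> K \<Longrightarrow> P \<theta> \<in> \<pi> \<rightarrow>\<^sub>M prob_algebra \<pi>"
    and inv: "\<And>\<theta>. \<theta> \<in> K \<Longrightarrow> \<pi> \<bind> P \<theta> = \<pi>"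
    and V[measurable]: "V \<in> borel_measurable \<pi>" and V1: "\<And>x. x \<in> space \<pi> \<Longrightarrow> 1 \<le> V x"
    and C: "C \<in> sets \<pi>" and e: "0 < e" and \<phi>: "prob_space \<phi>" and sets_\<phi>: "sets \<phi> = sets \<pi>" and \<phi>C: "0 < measure \<phi> C"
    and minor: "\<And>\<theta> x A. \<theta> \<in> K \<Longrightarrow> x \<in> C \<Longrightarrow> A \<in> sets \<pi> \<Longrightarrow> e * measure \<phi> A \<le> measure (P \<theta> x) A"
    and l: "0 \<le> l" "l < 1" and b: "0 < b"
    and drift_out: "\<And>\<theta> x. \<theta> \<in> K \<Longrightarrow> x \<in> space \<pi> - C \<Longrightarrow> (\<integral>\<^sup>+y. ennreal (V y) \<partial>P \<theta> x) \<le> ennreal (l * V x)"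
    and drift_in: "\<And>\<theta> x. \<theta> \<in> K \<Longrightarrow> x \<in> C \<Longrightarrow> (\<integral>\<^sup>+y. ennreal (V y) \<partial>P \<theta> x) \<le> ennreal b"
    and f: "f \<in> borel_measurable \<pi>" and F: "\<And>x. x \<in> space \<pi> \<Longrightarrow> \<bar>f x\<bar> \<le> F"
    and r: "0 < r" "r \<le> 1" and \<epsilon>: "0 < \<epsilon>"
  shows "\<exists>n. \<forall>\<theta>\<in>K. \<forall>x\<in>space \<pi>. \<bar>(kernel_app (P \<theta>) ^^ n) f x - (\<integral>x. f x \<partial>\<pi>)\<bar> \<le> \<epsilon> * V x powr r"
proof (cases "K = {}")
  case False
  interpret prob_space \<pi> by fact
  interpret \<phi>: prob_space \<phi> by fact
  have kern: "markov_kernel \<pi> (P \<theta>)" if "\<theta> \<in> K" for \<theta> using P[OF that] by unfold_locales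
  have CM: "x \<in> space \<pi>" if "x \<in> C" for x using C that sets.sets_into_space by blast
  \<comment> \<open>The minorization is tested on the whole space at a point of C, which exists
    because \<phi>(C) > 0.\<close>
  have e1: "e \<le> 1"
  proof -
    obtain \<theta> where \<theta>: "\<theta> \<in> K" using False by auto
    obtain x where x: "x \<in> C" using \<phi>C by (cases "C = {}") auto
    interpret markov_kernel \<pi> "P \<theta>" by (rule kern[OF \<theta>])
    interpret Px: prob_space "P \<theta> x" by (rule prob_space_P[OF CM[OF x]])
    have "e * measure \<phi> (space \<pi>) \<le> measure (P \<theta> x) (space \<pi>)" by (rule minor[OF \<theta> x]) simp
    moreover have "measure \<phi> (space \<pi>) = 1" "measure (P \<theta> x) (space \<pi>) = 1"
      using \<phi>.prob_space Px.prob_space sets_eq_imp_space_eq[OF sets_\<phi>] space_P[OF CM[OF x]] by simp_all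
    ultimately show ?thesis by simp
  qed
  have V0: "0 \<le> V x" if "x \<in> space \<pi>" for x using V1[OF that] by simp
  have drift: "(\<integral>\<^sup>+y. ennreal (V y) \<partial>P \<theta> x) \<le> ennreal (l * V x + b)" if "\<theta> \<in> K" "x \<in> space \<pi>" for \<theta> x
  proof (cases "x \<in> C")
    case True
    have "ennreal b \<le> ennreal (l * V x + b)" using l V0[OF that(2)] by (intro ennreal_leI) auto
    with drift_in[OF that(1) True] show ?thesis by (rule order_trans)
  next
    case False
    have "ennreal (l * V x) \<le> ennreal (l * V x + b)" using b by (intro ennreal_leI) auto
    with drift_out[OF that(1), of x] False that(2) show ?thesis by (auto intro: order_trans)
  qed
  \<comment> \<open>L bounds the additive drift constant of every power of the kernels, whatever the
    number of steps.\<close>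
  define L where "L = b / (1 - l)"
  have L: "0 < L" using l b by (simp add: L_def)
  define R where "R = 4 * L / (1 - l)"
  \<comment> \<open>m is taken so large that from the level set {V \<le> R} the chain visits C
    within m steps with probability at least 1/2; this probability is the 1/2 in
    \<open>a\<close>.\<close>
  have "(\<lambda>m. l ^ m * R) \<longlonglongrightarrow> 0" using l by (auto intro!: tendsto_mult_left_zero LIMSEQ_realpow_zero)
  then have "\<forall>\<^sub>F m in sequentially. l ^ m * R < 1 / 2" by (rule order_tendstoD) simp
  then obtain m where m: "l ^ m * R < 1 / 2" by (auto simp: eventually_sequentially)
  define a where "a = e * (e * measure \<phi> C) ^ m / 2"
  have a: "0 < a" using e \<phi>C by (simp add: a_def)
  let ?\<beta> = "hm_beta a L" and ?\<rho> = "hm_rate a L l"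
  note hm = hm_rate(1-3)[OF a L l]
  let ?g = "\<lambda>\<theta> n. (kernel_app (P \<theta>) ^^ (Suc m * n)) f"
  have F0: "0 \<le> F"
  proof -
    obtain x where "x \<in> space \<pi>" using not_empty by auto
    then show ?thesis using F[of x] by linarith
  qed
  \<comment> \<open>The contraction holds for m + 1 steps at a time, so \<open>?g\<close> counts in
    blocks of that length.\<close>
  have contract: "\<exists>s. \<forall>x\<in>space \<pi>. \<bar>?g \<theta> n x - s\<bar> \<le> ?\<rho> ^ n * F * (1 + ?\<beta> * V x)" if \<theta>: "\<theta> \<in> K" for \<theta> n
  proof (induction n)
    case 0
    have "\<bar>?g \<theta> 0 x - 0\<bar> \<le> ?\<rho> ^ 0 * F * (1 + ?\<beta> * V x)" if "x \<in> space \<pi>" for x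
    proof -
      have "F * 1 \<le> F * (1 + ?\<beta> * V x)" using F0 hm V0[OF that] by (intro mult_left_mono) auto
      then show ?thesis using F[OF that] by simp
    qed
    then show ?case by blast
  next
    case (Suc n)
    then obtain s where s: "\<And>x. x \<in> space \<pi> \<Longrightarrow> \<bar>?g \<theta> n x - s\<bar> \<le> ?\<rho> ^ n * F * (1 + ?\<beta> * V x)" by auto
    interpret k: markov_kernel \<pi> "P \<theta>" by (rule kern[OF \<theta>])
    interpret N: markov_kernel \<pi> "kernel_pow \<pi> (P \<theta>) (Suc m)" by (rule k.kernel_kernel_pow)
    note g_meas = k.funpow_kernel_app[OF f F, where n="Suc m * n"]
    have "\<exists>s'. \<forall>x\<in>space \<pi>. \<bar>kernel_app (kernel_pow \<pi> (P \<theta>) (Suc m)) (?g \<theta> n) x - s'\<bar> \<le> ?\<rho> * (?\<rho> ^ n * F) * (1 + ?\<beta> * V x)"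
    proof (rule N.hm_contraction[where F=F])
      fix x assume x: "x \<in> space \<pi>"
      have "(\<integral>\<^sup>+y. ennreal (V y) \<partial>kernel_pow \<pi> (P \<theta>) (Suc m) x) \<le>
          ennreal (l ^ Suc m * V x + b * (1 - l ^ Suc m) / (1 - l))"
        by (rule k.nn_integral_kernel_pow_drift) (use V V0 l b drift[OF \<theta>] x in auto)
      also have "\<dots> \<le> ennreal (l * V x + L)"
      proof (intro ennreal_leI add_mono)
        have "l ^ Suc m \<le> l ^ 1" using l by (intro power_decreasing) auto
        then show "l ^ Suc m * V x \<le> l * V x" using V0[OF x] by (intro mult_right_mono) auto
        have "b * (1 - l ^ Suc m) \<le> b * 1" using l b by (intro mult_left_mono) auto
        then show "b * (1 - l ^ Suc m) / (1 - l) \<le> L" using l by (simp add: L_def divide_right_mono del: power_Suc)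
      qed
      finally show "(\<integral>\<^sup>+y. ennreal (V y) \<partial>kernel_pow \<pi> (P \<theta>) (Suc m) x) \<le> ennreal (l * V x + L)" .
    next
      fix x and h :: "'a \<Rightarrow> ennreal"
      assume x: "x \<in> space \<pi>" and Vx: "V x \<le> 4 * L / (1 - l)" and h: "h \<in> borel_measurable \<pi>"
      have "1 \<le> k.hit C m x + ennreal (l ^ m * V x)"
        by (rule k.one_le_hit[OF C V V1]) (use l drift_out[OF \<theta>] x in auto)
      also have "\<dots> \<le> k.hit C m x + ennreal (1 / 2)"
      proof (intro add_left_mono ennreal_leI)
        have "l ^ m * V x \<le> l ^ m * R" using Vx l by (intro mult_left_mono) (auto simp: R_def)
        then show "l ^ m * V x \<le> 1 / 2" using m by linarith
      qed
      finally have le: "1 \<le> k.hit C m x + ennreal (1 / 2)" .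
      have half: "ennreal (1 / 2) \<le> k.hit C m x"
      proof (cases "k.hit C m x" rule: ennreal_cases)
        case (real t)
        with le real(1) have "ennreal 1 \<le> ennreal (t + 1 / 2)" by (simp add: ennreal_plus)
        then have "1 / 2 \<le> t" using real(1) by (subst (asm) ennreal_le_iff) auto
        then show ?thesis unfolding real(2) by (rule ennreal_leI)
      qed simp
      have "ennreal a * (\<integral>\<^sup>+y. h y \<partial>\<phi>) = ennreal (e * (e * measure \<phi> C) ^ m) * ennreal (1 / 2) * (\<integral>\<^sup>+y. h y \<partial>\<phi>)"
        using e by (subst ennreal_mult[symmetric]) (auto simp: a_def)
      also have "\<dots> \<le> ennreal (e * (e * measure \<phi> C) ^ m) * k.hit C m x * (\<integral>\<^sup>+y. h y \<partial>\<phi>)"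
        by (intro mult_right_mono mult_left_mono half) auto
      also have "\<dots> \<le> (\<integral>\<^sup>+y. h y \<partial>kernel_pow \<pi> (P \<theta>) (Suc m) x)"
        by (rule k.kernel_pow_minorization[OF C sets_\<phi> \<phi> e e1 minor[OF \<theta>] x h])
      finally show "ennreal a * (\<integral>\<^sup>+y. h y \<partial>\<phi>) \<le> (\<integral>\<^sup>+y. h y \<partial>kernel_pow \<pi> (P \<theta>) (Suc m) x)" .
    qed (use V V0 L l sets_\<phi> \<phi> a g_meas s hm F0 in auto)
    moreover have "kernel_app (kernel_pow \<pi> (P \<theta>) (Suc m)) (?g \<theta> n) x = ?g \<theta> (Suc n) x" if "x \<in> space \<pi>" for x
    proof -
      have "kernel_app (kernel_pow \<pi> (P \<theta>) (Suc m)) (?g \<theta> n) x = (kernel_app (P \<theta>) ^^ Suc m) (?g \<theta> n) x"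
        using g_meas that by (rule k.kernel_app_kernel_pow)
      then show ?thesis by (simp add: funpow_add[symmetric] fun_cong[OF funpow_add, unfolded o_apply, symmetric] del: funpow.simps)
    qed
    ultimately show ?case by (simp add: mult.assoc)
  qed
  define \<pi>V where "\<pi>V = (\<integral>x. V x \<partial>\<pi>)"
  have V_int: "integrable \<pi> V" and \<pi>V0: "0 \<le> \<pi>V"
  proof -
    obtain \<theta> where \<theta>: "\<theta> \<in> K" using False by auto
    interpret markov_kernel \<pi> "P \<theta>" by (rule kern[OF \<theta>])
    have "(\<integral>\<^sup>+x. ennreal (V x) \<partial>\<pi>) \<le> ennreal (b / (1 - l))"
      using b by (intro invariant_nn_integral_le[OF \<pi> inv[OF \<theta>] V V0 l _ drift[OF \<theta>]]) auto
    then have "(\<integral>\<^sup>+x. ennreal (V x) \<partial>\<pi>) < \<infinity>" by (simp add: le_less_trans)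
    then show "integrable \<pi> V" using V0 by (intro integrableI_nonneg AE_I2) auto
    show "0 \<le> \<pi>V" unfolding \<pi>V_def using V0 by (intro integral_nonneg_AE AE_I2)
  qed
  \<comment> \<open>D collects the error from s and the error from replacing s by \<pi>(f), both
    written as multiples of V using V \<ge> 1. The added 1 keeps D positive when F = 0.\<close>
  define D where "D = F * (2 + 2 * ?\<beta> + ?\<beta> * \<pi>V) + 1"
  have D: "0 < D" using F0 hm \<pi>V0 by (simp add: D_def add_nonneg_pos)
  have geometric: "\<bar>?g \<theta> n x - (\<integral>x. f x \<partial>\<pi>)\<bar> \<le> ?\<rho> ^ n * D * V x" if \<theta>: "\<theta> \<in> K" and x: "x \<in> space \<pi>" for \<theta> n x
  proof -
    interpret k: markov_kernel \<pi> "P \<theta>" by (rule kern[OF \<theta>])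
    from contract[OF \<theta>] obtain s where s: "\<And>x. x \<in> space \<pi> \<Longrightarrow> \<bar>?g \<theta> n x - s\<bar> \<le> ?\<rho> ^ n * F * (1 + ?\<beta> * V x)" by blast
    note g = k.funpow_kernel_app[OF f F, where n="Suc m * n"]
    have g_int: "integrable \<pi> (?g \<theta> n)"
      using g by (intro integrable_const_bound[where B=F] AE_I2) auto
    \<comment> \<open>By invariance \<open>?g\<close> has the same \<pi>-mean as f, so the unknown
      centre s is within the \<pi>-mean of the weighted bound of \<pi>(f).\<close>
    have "\<bar>(\<integral>x. f x \<partial>\<pi>) - s\<bar> = \<bar>\<integral>x. ?g \<theta> n x - s \<partial>\<pi>\<bar>"
      using g_int k.integral_kernel_app_invariant[OF \<pi> inv[OF \<theta>] f F, of "Suc m * n"] by (simp add: prob_space)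
    also have "\<dots> \<le> (\<integral>x. \<bar>?g \<theta> n x - s\<bar> \<partial>\<pi>)" by (rule integral_abs_bound)
    also have "\<dots> \<le> (\<integral>x. ?\<rho> ^ n * F * (1 + ?\<beta> * V x) \<partial>\<pi>)"
      using g_int V_int s by (intro integral_mono) auto
    also have "\<dots> = ?\<rho> ^ n * F * (1 + ?\<beta> * \<pi>V)"
      using V_int by (simp add: prob_space \<pi>V_def)
    finally have "\<bar>?g \<theta> n x - (\<integral>x. f x \<partial>\<pi>)\<bar> \<le> ?\<rho> ^ n * F * (1 + ?\<beta> * V x) + ?\<rho> ^ n * F * (1 + ?\<beta> * \<pi>V)"
      using s[OF x] by linarith
    also have "\<dots> = ?\<rho> ^ n * (F * (2 + ?\<beta> * V x + ?\<beta> * \<pi>V))"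
      by (simp add: algebra_simps)
    also have "\<dots> \<le> ?\<rho> ^ n * (D * V x)"
    proof (intro mult_left_mono)
      have "F * (2 + ?\<beta> * V x + ?\<beta> * \<pi>V) \<le> F * ((2 + 2 * ?\<beta> + ?\<beta> * \<pi>V) * V x)"
      proof (intro mult_left_mono F0)
        have "2 * 1 \<le> 2 * V x" "?\<beta> * \<pi>V * 1 \<le> ?\<beta> * \<pi>V * V x" "0 \<le> ?\<beta> * V x"
          using V0[OF x] hm \<pi>V0 mult_left_mono[OF V1[OF x], of 2] mult_left_mono[OF V1[OF x], of "?\<beta> * \<pi>V"]
          by auto
        then show "2 + ?\<beta> * V x + ?\<beta> * \<pi>V \<le> (2 + 2 * ?\<beta> + ?\<beta> * \<pi>V) * V x"
          by (simp add: algebra_simps)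
      qed
      then show "F * (2 + ?\<beta> * V x + ?\<beta> * \<pi>V) \<le> D * V x"
        using V0[OF x] by (simp add: D_def algebra_simps)
    qed (use hm in simp)
    finally show ?thesis by (simp add: mult.assoc)
  qed
  define E where "E = (2 * F) powr (1 - r) * D powr r"
  have "(\<lambda>n. E * (?\<rho> powr r) ^ n) \<longlonglongrightarrow> 0"
    using hm r powr_less_mono2[of r ?\<rho> 1] by (intro tendsto_mult_right_zero LIMSEQ_realpow_zero) auto
  then have "\<forall>\<^sub>F n in sequentially. E * (?\<rho> powr r) ^ n < \<epsilon>" using \<epsilon> by (rule order_tendstoD)
  then obtain n where n: "E * (?\<rho> powr r) ^ n < \<epsilon>" by (auto simp: eventually_sequentially)
  show ?thesis
  proof (intro exI ballI)
    fix \<theta> x assume \<theta>: "\<theta> \<in> K" and x: "x \<in> space \<pi>"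
    interpret k: markov_kernel \<pi> "P \<theta>" by (rule kern[OF \<theta>])
    have "\<bar>\<integral>x. f x \<partial>\<pi>\<bar> \<le> F"
      using F by (rule abs_expectation_le_const)
    then have "\<bar>?g \<theta> n x - (\<integral>x. f x \<partial>\<pi>)\<bar> \<le> 2 * F"
      using k.funpow_kernel_app(2)[OF f F x, of "Suc m * n"] by linarith
    then have "\<bar>?g \<theta> n x - (\<integral>x. f x \<partial>\<pi>)\<bar> \<le> (2 * F) powr (1 - r) * (?\<rho> ^ n * D * V x) powr r"
      using geometric[OF \<theta> x] r by (intro le_powr_interpolate) auto
    also have "(?\<rho> ^ n * D * V x) powr r = (?\<rho> powr r) ^ n * D powr r * V x powr r"
      using hm D V0[OF x] by (simp add: powr_mult powr_realpow[symmetric] powr_powr mult.commute[of r])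
    also have "(2 * F) powr (1 - r) * ((?\<rho> powr r) ^ n * D powr r * V x powr r) = E * (?\<rho> powr r) ^ n * V x powr r"
      by (simp add: E_def)
    also have "\<dots> \<le> \<epsilon> * V x powr r"
      using n by (intro mult_right_mono) auto
    finally show "\<bar>?g \<theta> n x - (\<integral>x. f x \<partial>\<pi>)\<bar> \<le> \<epsilon> * V x powr r" .
  qed
qed auto

section \<open>Weighted norms and families of kernels\<close>

lemma wnorm_le:
  fixes f :: "'a \<Rightarrow> 'b::real_normed_vector"
  assumes "\<And>x. x \<in> space M \<Longrightarrow> 0 < W x" and "\<And>x. x \<in> space M \<Longrightarrow> norm (f x) \<le> c * W x"
  shows "wnorm M W f \<le> ennreal c"
  unfolding wnorm_def using assms by (auto intro!: SUP_least ennreal_leI simp: pos_divide_le_eq)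

lemma wnorm_leD:
  fixes f :: "'a \<Rightarrow> 'b::real_normed_vector"
  assumes "wnorm M W f \<le> ennreal c" and "0 \<le> c" and x: "x \<in> space M" and W: "0 < W x"
  shows "norm (f x) \<le> c * W x"
proof -
  have "ennreal (norm (f x) / W x) \<le> wnorm M W f"
    unfolding wnorm_def using x by (rule SUP_upper)
  also note assms(1)
  finally show ?thesis using \<open>0 \<le> c\<close> W by (simp add: pos_divide_le_eq)
qed

lemma wnorm_finiteE:
  fixes f :: "'a \<Rightarrow> 'b::real_normed_vector"
  assumes "wnorm M W f < \<infinity>" and W: "\<And>x. x \<in> space M \<Longrightarrow> 0 < W x"
  obtains c where "0 \<le> c" "\<And>x. x \<in> space M \<Longrightarrow> norm (f x) \<le> c * W x"
proof -
  obtain c where c: "0 \<le> c" "wnorm M W f = ennreal c"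
    using assms(1) by (cases "wnorm M W f" rule: ennreal_cases) auto
  then show ?thesis using wnorm_leD[of M W f c] W by (intro that[of c]) auto
qed

lemma W_Lipschitz_bound:
  assumes lip: "W_Lipschitz M \<Theta> W F" and K: "compact K" "K \<subseteq> \<Theta>" and W: "\<And>x. x \<in> space M \<Longrightarrow> 0 < W x"
  obtains c where "0 \<le> c" "\<And>\<theta> x. \<theta> \<in> K \<Longrightarrow> x \<in> space M \<Longrightarrow> norm (F \<theta> x) \<le> c * W x"
proof -
  have "(SUP \<theta>\<in>K. wnorm M W (F \<theta>)) < \<infinity>" using lip K by (auto simp: W_Lipschitz_def)
  then obtain c where c: "0 \<le> c" "(SUP \<theta>\<in>K. wnorm M W (F \<theta>)) = ennreal c"
    by (cases "SUP \<theta>\<in>K. wnorm M W (F \<theta>)" rule: ennreal_cases) auto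
  have "wnorm M W (F \<theta>) \<le> ennreal c" if "\<theta> \<in> K" for \<theta>
    using that unfolding c(2)[symmetric] by (rule SUP_upper)
  then have "norm (F \<theta> x) \<le> c * W x" if "\<theta> \<in> K" "x \<in> space M" for \<theta> x
    using that c(1) W by (intro wnorm_leD) auto
  with c(1) show ?thesis by (rule that)
qed

text \<open>A function that is continuous in \<open>\<theta>\<close> is the pointwise limit of functions
  \<open>(\<theta>, x) \<mapsto> F (d (i\<^sub>n \<theta>)) x\<close>, where \<open>i\<^sub>n \<theta>\<close> is the first index of a point of a dense sequence
  within distance \<open>1 / (n + 1)\<close> of \<open>\<theta>\<close>.\<close>

lemma borel_measurable_caratheodory:
  fixes F :: "'t::{metric_space, second_countable_topology} \<Rightarrow> 'a \<Rightarrow> real"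
  assumes \<Theta>: "open \<Theta>" and meas: "\<And>\<theta>. \<theta> \<in> \<Theta> \<Longrightarrow> F \<theta> \<in> borel_measurable M"
    and cont: "\<And>x. x \<in> space M \<Longrightarrow> continuous_on \<Theta> (\<lambda>\<theta>. F \<theta> x)"
  shows "(\<lambda>(\<theta>, x). F \<theta> x) \<in> borel_measurable (restrict_space borel \<Theta> \<Otimes>\<^sub>M M)"
proof (cases "\<Theta> = {}")
  case True
  then show ?thesis by (intro measurable_empty_iff[THEN iffD2] measurableI) (auto simp: space_pair_measure space_restrict_space)
next
  case False
  let ?B = "restrict_space borel \<Theta>"
  obtain D :: "'t set" where D: "countable D" "\<And>X. open X \<Longrightarrow> X \<noteq> {} \<Longrightarrow> \<exists>d\<in>D. d \<in> X"
    using countable_dense_setE by blast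
  have ne: "D \<inter> \<Theta> \<noteq> {}" using D(2)[OF \<Theta> False] by auto
  define d where "d = from_nat_into (D \<inter> \<Theta>)"
  have range_d: "range d = D \<inter> \<Theta>"
    unfolding d_def using ne D(1) by (intro range_from_nat_into) auto
  then have d: "d i \<in> \<Theta>" for i by auto
  define i where "i n \<theta> = (LEAST i. dist (d i) \<theta> < 1 / real (Suc n))" for n \<theta>
  have close: "dist (d (i n \<theta>)) \<theta> < 1 / real (Suc n)" if \<theta>: "\<theta> \<in> \<Theta>" for n \<theta>
  proof -
    have "open (ball \<theta> (1 / real (Suc n)) \<inter> \<Theta>)" "ball \<theta> (1 / real (Suc n)) \<inter> \<Theta> \<noteq> {}"
      using \<Theta> \<theta> by (auto intro!: open_Int exI[of _ \<theta>] simp: set_eq_iff)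
    from D(2)[OF this] obtain y where "y \<in> D \<inter> \<Theta>" "dist y \<theta> < 1 / real (Suc n)"
      by (auto simp: dist_commute)
    then obtain j where "dist (d j) \<theta> < 1 / real (Suc n)"
      unfolding range_d[symmetric] by auto
    then show ?thesis unfolding i_def by (rule LeastI)
  qed
  have id_B[measurable]: "(\<lambda>\<theta>. \<theta>) \<in> ?B \<rightarrow>\<^sub>M borel" by (rule measurable_restrict_space1) simp
  have fst_B[measurable]: "fst \<in> ?B \<Otimes>\<^sub>M M \<rightarrow>\<^sub>M borel" by (rule measurable_compose[OF measurable_fst id_B])
  have i_meas: "(\<lambda>p. i n (fst p)) \<in> ?B \<Otimes>\<^sub>M M \<rightarrow>\<^sub>M count_space UNIV" for n
    unfolding i_def by measurable
  show ?thesis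
  proof (rule borel_measurable_LIMSEQ_real)
    fix n
    show "(\<lambda>p. F (d (i n (fst p))) (snd p)) \<in> borel_measurable (?B \<Otimes>\<^sub>M M)"
      by (rule measurable_compose_countable[OF _ i_meas]) (rule measurable_compose[OF measurable_snd meas[OF d]])
  next
    fix p assume "p \<in> space (?B \<Otimes>\<^sub>M M)"
    then have \<theta>: "fst p \<in> \<Theta>" and x: "snd p \<in> space M"
      by (auto simp: space_pair_measure space_restrict_space)
    have "(\<lambda>n. d (i n (fst p))) \<longlonglongrightarrow> fst p"
    proof (rule metric_tendsto_imp_tendsto[where f="\<lambda>n. 1 / real (Suc n)" and a=0])
      show "(\<lambda>n. 1 / real (Suc n)) \<longlonglongrightarrow> 0" by real_asymp
      show "\<forall>\<^sub>F n in sequentially. dist (d (i n (fst p))) (fst p) \<le> dist (1 / real (Suc n)) 0"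
        using close[OF \<theta>] by (intro always_eventually allI) (simp add: dist_real_def less_imp_le)
    qed
    then show "(\<lambda>n. F (d (i n (fst p))) (snd p)) \<longlonglongrightarrow> (case p of (\<theta>, x) \<Rightarrow> F \<theta> x)"
      using continuous_on_tendsto_compose[OF cont[OF x], of "\<lambda>n. d (i n (fst p))" "fst p" sequentially] \<theta> d
      by (simp add: split_beta)
  qed
qed

text \<open>Ionescu-Tulcea needs measurability jointly in the parameter and the state. The masses of
  a fixed set are measurable in x and continuous in \<theta>, so they are Caratheodory functions and
  the kernel inherits joint measurability from them.\<close>

lemma measurable_kernel_family:
  fixes P :: "'t::{metric_space, second_countable_topology} \<Rightarrow> 'a \<Rightarrow> 'a measure"
  assumes \<Theta>: "open \<Theta>" and P: "\<And>\<theta>. \<theta> \<in> \<Theta> \<Longrightarrow> P \<theta> \<in> M \<rightarrow>\<^sub>M prob_algebra M"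
    and cont: "\<And>A x. A \<in> sets M \<Longrightarrow> x \<in> space M \<Longrightarrow> continuous_on \<Theta> (\<lambda>\<theta>. measure (P \<theta> x) A)"
  shows "(\<lambda>(\<theta>, x). P \<theta> x) \<in> restrict_space borel \<Theta> \<Otimes>\<^sub>M M \<rightarrow>\<^sub>M prob_algebra M"
proof -
  let ?N = "restrict_space borel \<Theta> \<Otimes>\<^sub>M M"
  have p: "prob_space (P \<theta> x)" "sets (P \<theta> x) = sets M" if "\<theta> \<in> \<Theta>" "x \<in> space M" for \<theta> x
    using measurable_space[OF P[OF that(1)] that(2)] by (auto simp: space_prob_algebra)
  have "(\<lambda>(\<theta>, x). P \<theta> x) \<in> ?N \<rightarrow>\<^sub>M subprob_algebra M"
  proof (rule measurable_subprob_algebra)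
    fix z assume "z \<in> space ?N"
    then show "subprob_space (case z of (\<theta>, x) \<Rightarrow> P \<theta> x)" "sets (case z of (\<theta>, x) \<Rightarrow> P \<theta> x) = sets M"
      using p by (auto simp: space_pair_measure space_restrict_space intro: prob_space_imp_subprob_space)
  next
    fix A assume A: "A \<in> sets M"
    have "(\<lambda>(\<theta>, x). measure (P \<theta> x) A) \<in> borel_measurable ?N"
    proof (rule borel_measurable_caratheodory[OF \<Theta> _ cont[OF A]])
      fix \<theta> assume "\<theta> \<in> \<Theta>"
      from measurable_compose[OF measurable_prob_algebraD[OF P[OF this]] measurable_measure_subprob_algebra[OF A]]
      show "(\<lambda>x. measure (P \<theta> x) A) \<in> borel_measurable M" .
    qed
    then have "(\<lambda>z. ennreal (case z of (\<theta>, x) \<Rightarrow> measure (P \<theta> x) A)) \<in> borel_measurable ?N"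
      by measurable
    then show "(\<lambda>z. emeasure (case z of (\<theta>, x) \<Rightarrow> P \<theta> x) A) \<in> borel_measurable ?N"
    proof (rule measurable_cong[THEN iffD1, rotated])
      fix z assume "z \<in> space ?N"
      then interpret prob_space "P (fst z) (snd z)"
        using p by (auto simp: space_pair_measure space_restrict_space)
      show "ennreal (case z of (\<theta>, x) \<Rightarrow> measure (P \<theta> x) A) = emeasure (case z of (\<theta>, x) \<Rightarrow> P \<theta> x) A"
        by (simp add: split_beta emeasure_eq_measure)
    qed
  qed
  then show ?thesis
    unfolding prob_algebra_def using p
    by (intro measurable_restrict_space2) (auto simp: space_pair_measure space_restrict_space)
qed

lemma compact_coverage_UN_interior:
  assumes "compact_coverage \<Theta> \<K>"
  shows "(\<Union>q. interior (\<K> q)) = \<Theta>"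
  using assms interior_subset unfolding compact_coverage_def by blast

text \<open>A Lipschitz bound on \<open>\<K> q\<close> gives continuity on its interior, and the
  interiors are open and cover \<Theta> because each \<open>\<K> q\<close> lies in the next
  interior.\<close>

lemma compact_coverage_continuous_on:
  fixes F :: "'t::real_normed_vector \<Rightarrow> real"
  assumes cov: "compact_coverage \<Theta> \<K>"
    and lip: "\<And>q. \<exists>C\<ge>0. \<forall>\<theta>\<in>\<K> q. \<forall>\<theta>'\<in>\<K> q. \<bar>F \<theta> - F \<theta>'\<bar> \<le> C * norm (\<theta> - \<theta>')"
  shows "continuous_on \<Theta> F"
proof -
  have "continuous_on (interior (\<K> q)) F" for q
  proof -
    obtain C where "0 \<le> C" "\<forall>\<theta>\<in>\<K> q. \<forall>\<theta>'\<in>\<K> q. \<bar>F \<theta> - F \<theta>'\<bar> \<le> C * norm (\<theta> - \<theta>')"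
      using lip by blast
    then have "C-lipschitz_on (\<K> q) F" by (intro lipschitz_onI) (auto simp: dist_norm)
    then show ?thesis
      by (rule continuous_on_subset[OF lipschitz_on_continuous_on interior_subset])
  qed
  then have "continuous_on (\<Union>q. interior (\<K> q)) F"
    by (intro continuous_on_open_UN) auto
  then show ?thesis by (simp add: compact_coverage_UN_interior[OF cov])
qed

section \<open>Step sizes and Cesaro averages\<close>

lemma decseq_tendsto_0_of_summable_over_Suc:
  fixes \<gamma> :: "nat \<Rightarrow> real"
  assumes pos: "\<And>k. 0 < \<gamma> k" and dec: "decseq \<gamma>" and sm: "summable (\<lambda>k. \<gamma> (Suc k) / real (Suc k))"
  shows "\<gamma> \<longlonglongrightarrow> 0"
proof -
  obtain L where L: "\<gamma> \<longlonglongrightarrow> L" "\<And>k. L \<le> \<gamma> k"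
    using decseq_convergent[OF dec, of 0] pos by (auto simp: less_imp_le)
  have "0 \<le> L" using L(1) pos by (intro LIMSEQ_le_const) (auto simp: less_imp_le)
  \<comment> \<open>A positive limit L would bound the series below by L times the harmonic
    series.\<close>
  moreover have "\<not> 0 < L"
  proof
    assume L0: "0 < L"
    have "summable (\<lambda>k. L * inverse (real (Suc k)))"
    proof (rule summable_comparison_test'[OF sm, of 0])
      fix k :: nat
      show "norm (L * inverse (real (Suc k))) \<le> \<gamma> (Suc k) / real (Suc k)"
        using L0 L(2)[of "Suc k"] by (simp add: divide_inverse mult_right_mono)
    qed
    then have "summable (\<lambda>k. inverse (real (Suc k)))" using L0 by simp
    then show False
      using not_summable_harmonic[where 'a=real] unfolding summable_Suc_iff[of "\<lambda>k. inverse (real k)"] by blast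
  qed
  ultimately show ?thesis using L(1) by simp
qed

text \<open>All but finitely many weights are below \<delta>, and bounded averages of b turn this
  into a contribution of at most about \<delta> * B; the finitely many others are divided away by
  n.\<close>

lemma weighted_average_tendsto_0:
  fixes \<gamma> b :: "nat \<Rightarrow> real"
  assumes \<gamma>: "\<gamma> \<longlonglongrightarrow> 0" "\<And>k. 0 \<le> \<gamma> k" and b: "\<And>k. 0 \<le> b k" "\<And>n. (\<Sum>k<n. b k) \<le> B * (real n + 1)"
  shows "(\<lambda>n. (\<Sum>k<n. \<gamma> k * b k) / real n) \<longlonglongrightarrow> 0"
proof (rule LIMSEQ_I)
  fix e :: real assume e: "0 < e"
  have B: "0 \<le> B" using b(2)[of 0] by simp
  define \<delta> where "\<delta> = e / (4 * (B + 1))"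
  have \<delta>: "0 < \<delta>" using e B by (simp add: \<delta>_def)
  obtain k0 where k0: "\<And>k. k0 \<le> k \<Longrightarrow> \<gamma> k < \<delta>"
    using order_tendstoD(2)[OF \<gamma>(1) \<delta>] by (auto simp: eventually_sequentially)
  define c where "c = (\<Sum>k<k0. \<gamma> k * b k)"
  have le: "(\<Sum>k<n. \<gamma> k * b k) \<le> c + \<delta> * (B * (real n + 1))" for n
  proof -
    have "(\<Sum>k<n. \<gamma> k * b k) \<le> (\<Sum>k<n. (if k < k0 then \<gamma> k * b k else 0) + \<delta> * b k)"
      using \<gamma>(2) b(1) \<delta> k0
      by (intro sum_mono) (auto simp: not_less less_imp_le intro!: mult_right_mono)
    also have "\<dots> = (\<Sum>k<n. if k < k0 then \<gamma> k * b k else 0) + \<delta> * (\<Sum>k<n. b k)"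
      by (simp add: sum.distrib sum_distrib_left)
    also have "(\<Sum>k<n. if k < k0 then \<gamma> k * b k else 0) = (\<Sum>k\<in>{..<n} \<inter> {k. k < k0}. \<gamma> k * b k)"
      by (simp add: sum.inter_restrict)
    also have "\<dots> \<le> c"
      unfolding c_def using \<gamma>(2) b(1) by (intro sum_mono2) auto
    finally show ?thesis
      using mult_left_mono[OF b(2)[of n], of \<delta>] \<delta> by linarith
  qed
  have c: "0 \<le> c" unfolding c_def using \<gamma>(2) b(1) by (intro sum_nonneg) auto
  have "(\<lambda>n. (c + \<delta> * (B * (real n + 1))) / real n) \<longlonglongrightarrow> \<delta> * B" by real_asymp
  moreover have "\<delta> * B < e" using e B by (simp add: \<delta>_def divide_less_eq)
  ultimately have "\<forall>\<^sub>F n in sequentially. (c + \<delta> * (B * (real n + 1))) / real n < e"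
    by (rule order_tendstoD)
  then obtain n0 where n0: "\<And>n. n0 \<le> n \<Longrightarrow> (c + \<delta> * (B * (real n + 1))) / real n < e"
    by (auto simp: eventually_sequentially)
  show "\<exists>n0. \<forall>n\<ge>n0. norm ((\<Sum>k<n. \<gamma> k * b k) / real n - 0) < e"
  proof (intro exI allI impI)
    fix n assume n: "n0 \<le> n"
    have "0 \<le> (\<Sum>k<n. \<gamma> k * b k)" using \<gamma>(2) b(1) by (intro sum_nonneg) auto
    then have "norm ((\<Sum>k<n. \<gamma> k * b k) / real n - 0) = (\<Sum>k<n. \<gamma> k * b k) / real n" by simp
    also have "\<dots> \<le> (c + \<delta> * (B * (real n + 1))) / real n" using le by (intro divide_right_mono) auto
    finally show "norm ((\<Sum>k<n. \<gamma> k * b k) / real n - 0) < e" using n0[OF n] by linarith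
  qed
qed

text \<open>Finitely many initial terms and the change of denominator from n to n + m vanish in the
  limit; the last lines also pass from the indices 0..n to 1..n.\<close>

lemma average_from_shift:
  fixes y :: "nat \<Rightarrow> real"
  assumes "(\<lambda>n. (\<Sum>k<n. y (m + k)) / real n) \<longlonglongrightarrow> 0"
  shows "(\<lambda>n. (\<Sum>k=1..n. y k) / real n) \<longlonglongrightarrow> 0"
proof -
  define S where "S n = (\<Sum>k<n. y k)" for n
  have shift: "S (n + m) = S m + (\<Sum>k<n. y (m + k))" for n
    unfolding S_def by (induction n) (simp_all add: add.commute)
  have "(\<lambda>n. S m / real (n + m) + (\<Sum>k<n. y (m + k)) / real n * (real n / real (n + m))) \<longlonglongrightarrow> 0 + 0 * 1"
    by (intro tendsto_add tendsto_mult assms) real_asymp+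
  then have "(\<lambda>n. S (n + m) / real (n + m)) \<longlonglongrightarrow> 0"
    by (rule filterlim_cong[THEN iffD1, rotated -1])
       (auto intro!: eventually_mono[OF eventually_gt_at_top[of 0]] simp: shift add_divide_distrib)
  then have "(\<lambda>n. S n / real n) \<longlonglongrightarrow> 0" by (rule LIMSEQ_offset)
  then have "(\<lambda>n. S (Suc n) / real (Suc n)) \<longlonglongrightarrow> 0" by (rule LIMSEQ_Suc)
  then have "(\<lambda>n. S (Suc n) / real (Suc n) * (real (Suc n) / real n) - y 0 / real n) \<longlonglongrightarrow> 0 * 1 - 0"
    by (intro tendsto_diff tendsto_mult; (assumption | real_asymp))
  moreover have "(\<Sum>k=1..n. y k) = S (Suc n) - y 0" for n
    unfolding S_def lessThan_Suc_atMost by (induction n) auto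
  ultimately show ?thesis
    by (simp add: diff_divide_distrib)
qed

section \<open>The reprojected chain\<close>

locale reprojected_chain =
  fixes \<pi> :: "'x measure" and \<Theta> :: "'t::euclidean_space set"
    and P :: "'t \<Rightarrow> 'x \<Rightarrow> 'x measure" and H :: "'t \<Rightarrow> 'x \<Rightarrow> 't" and S :: "('x \<times> 't) set"
    and \<K> :: "nat \<Rightarrow> 't set" and \<gamma> :: "nat \<Rightarrow> real"
    and proj :: "'x \<times> 't option \<Rightarrow> 'x \<times> 't"
    and V :: "'x \<Rightarrow> real" and \<beta> :: real and x\<^sub>0 :: 'x and \<theta>\<^sub>0 :: 't
  assumes prob_\<pi>: "prob_space \<pi>" and open_\<Theta>: "open \<Theta>"
    and P: "\<And>\<theta>. \<theta> \<in> \<Theta> \<Longrightarrow> P \<theta> \<in> \<pi> \<rightarrow>\<^sub>M prob_algebra \<pi>"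
    and inv: "\<And>\<theta>. \<theta> \<in> \<Theta> \<Longrightarrow> \<pi> \<bind> P \<theta> = \<pi>"
    and H: "(\<lambda>(\<theta>, x). H \<theta> x) \<in> borel_measurable (restrict_space borel \<Theta> \<Otimes>\<^sub>M \<pi>)"
    and coverage: "compact_coverage \<Theta> \<K>"
    and proj: "proj \<in> \<pi> \<Otimes>\<^sub>M param_bar \<Theta> \<rightarrow>\<^sub>M restrict_space (\<pi> \<Otimes>\<^sub>M restrict_space borel \<Theta>) S"
    and \<gamma>_pos: "\<And>k. 0 < \<gamma> k" and \<gamma>_dec: "decseq \<gamma>" and \<gamma>_lim: "\<gamma> \<longlonglongrightarrow> 0"
    and V[measurable]: "V \<in> borel_measurable \<pi>" and V1: "\<And>x. x \<in> space \<pi> \<Longrightarrow> 1 \<le> V x"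
    and geometric: "\<And>K. compact K \<Longrightarrow> K \<subseteq> \<Theta> \<Longrightarrow>
       (\<exists>C\<in>sets \<pi>.
          (\<exists>\<epsilon>>0. \<exists>\<phi>. prob_space \<phi> \<and> sets \<phi> = sets \<pi> \<and> measure \<phi> C > 0 \<and>
             (\<forall>A\<in>sets \<pi>. \<forall>\<theta>\<in>K. \<forall>x\<in>C. measure (P \<theta> x) A \<ge> \<epsilon> * measure \<phi> A)) \<and>
          (\<exists>l\<in>{0..<1}. \<exists>b>0. \<forall>\<theta>\<in>K.
             (\<forall>x\<in>space \<pi> - C. (\<integral>\<^sup>+y. ennreal (V y) \<partial>P \<theta> x) \<le> ennreal (l * V x)) \<and>
             (\<forall>x\<in>C. (\<integral>\<^sup>+y. ennreal (V y) \<partial>P \<theta> x) \<le> ennreal b)))"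
    and lipschitz_P: "\<And>K r. compact K \<Longrightarrow> K \<subseteq> \<Theta> \<Longrightarrow> r \<in> {0..1} \<Longrightarrow>
       \<exists>C\<ge>0. \<forall>\<theta>\<in>K. \<forall>\<theta>'\<in>K. \<forall>g\<in>wspace \<pi> (\<lambda>x. V x powr r).
         wnorm \<pi> (\<lambda>x. V x powr r) (\<lambda>x. kernel_app (P \<theta>) g x - kernel_app (P \<theta>') g x)
           \<le> ennreal C * wnorm \<pi> (\<lambda>x. V x powr r) g * ennreal (norm (\<theta> - \<theta>'))"
    and \<beta>: "0 \<le> \<beta>" "\<beta> \<le> 1 / 2" and lipschitz_H: "W_Lipschitz \<pi> \<Theta> (\<lambda>x. V x powr \<beta>) H"
    and x\<^sub>0: "x\<^sub>0 \<in> space \<pi>" and \<theta>\<^sub>0: "\<theta>\<^sub>0 \<in> \<Theta>"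
begin

sublocale \<pi>: prob_space \<pi> by (rule prob_\<pi>)

lemma V_pos: "x \<in> space \<pi> \<Longrightarrow> 0 < V x"
  using V1[of x] by simp

lemma \<K>: "compact (\<K> q)" "\<K> q \<subseteq> \<Theta>"
  using coverage by (auto simp: compact_coverage_def)

lemma kernel_P: "\<theta> \<in> \<Theta> \<Longrightarrow> markov_kernel \<pi> (P \<theta>)"
  by (rule markov_kernel.intro) (rule P)

lemma drift_constants:
  "\<exists>l b. 0 \<le> l \<and> l < 1 \<and> 0 < b \<and>
    (\<forall>\<theta>\<in>\<K> q. \<forall>x\<in>space \<pi>. (\<integral>\<^sup>+y. ennreal (V y) \<partial>P \<theta> x) \<le> ennreal (l * V x + b))"
proof -
  obtain C l b where l: "l \<in> {0..<1::real}" and b: "0 < b" and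
    d: "\<forall>\<theta>\<in>\<K> q. (\<forall>x\<in>space \<pi> - C. (\<integral>\<^sup>+y. ennreal (V y) \<partial>P \<theta> x) \<le> ennreal (l * V x)) \<and>
      (\<forall>x\<in>C. (\<integral>\<^sup>+y. ennreal (V y) \<partial>P \<theta> x) \<le> ennreal b)"
    using geometric[OF \<K>[of q]] by blast
  have "(\<integral>\<^sup>+y. ennreal (V y) \<partial>P \<theta> x) \<le> ennreal (l * V x + b)" if "\<theta> \<in> \<K> q" "x \<in> space \<pi>" for \<theta> x
  proof -
    have "(\<integral>\<^sup>+y. ennreal (V y) \<partial>P \<theta> x) \<le> max (ennreal (l * V x)) (ennreal b)"
      using d that by (cases "x \<in> C") (auto simp: le_max_iff_disj)
    also have "\<dots> \<le> ennreal (l * V x + b)"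
      using l b V_pos[OF that(2)] by (intro max.boundedI ennreal_leI) auto
    finally show ?thesis .
  qed
  then show ?thesis using l b by (intro exI[of _ l] exI[of _ b]) auto
qed

text \<open>\<pi> is invariant under each kernel, so the drift of a single one suffices; the one at
  \<open>\<theta>\<^sub>0\<close> serves.\<close>

lemma integrable_V: "integrable \<pi> V"
proof -
  obtain q where q: "\<theta>\<^sub>0 \<in> \<K> q" using \<theta>\<^sub>0 coverage by (auto simp: compact_coverage_def)
  obtain l b where c: "0 \<le> l" "l < 1" "0 < b"
    "\<forall>\<theta>\<in>\<K> q. \<forall>x\<in>space \<pi>. (\<integral>\<^sup>+y. ennreal (V y) \<partial>P \<theta> x) \<le> ennreal (l * V x + b)"
    using drift_constants[of q] by blast
  interpret markov_kernel \<pi> "P \<theta>\<^sub>0" by (rule kernel_P[OF \<theta>\<^sub>0])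
  have "(\<integral>\<^sup>+x. ennreal (V x) \<partial>\<pi>) \<le> ennreal (b / (1 - l))"
    using c q V_pos by (intro invariant_nn_integral_le[OF prob_\<pi> inv[OF \<theta>\<^sub>0] V]) (auto simp: less_imp_le)
  then have "(\<integral>\<^sup>+x. ennreal (V x) \<partial>\<pi>) < \<infinity>" by (simp add: le_less_trans)
  then show ?thesis using V_pos by (intro integrableI_nonneg AE_I2) (auto simp: less_imp_le)
qed

lemma ergodicity:
  assumes "f \<in> borel_measurable \<pi>" "\<And>x. x \<in> space \<pi> \<Longrightarrow> \<bar>f x\<bar> \<le> F" and "0 < r" "r \<le> 1" "0 < \<epsilon>"
  shows "\<exists>n. \<forall>\<theta>\<in>\<K> q. \<forall>x\<in>space \<pi>. \<bar>(kernel_app (P \<theta>) ^^ n) f x - (\<integral>x. f x \<partial>\<pi>)\<bar> \<le> \<epsilon> * V x powr r"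
proof -
  obtain C e \<phi> l b where C: "C \<in> sets \<pi>" and e: "0 < (e::real)" and \<phi>: "prob_space \<phi>" "sets \<phi> = sets \<pi>" "measure \<phi> C > 0"
    and minor: "\<forall>A\<in>sets \<pi>. \<forall>\<theta>\<in>\<K> q. \<forall>x\<in>C. measure (P \<theta> x) A \<ge> e * measure \<phi> A"
    and l: "l \<in> {0..<1::real}" and b: "0 < (b::real)" and
    d: "\<forall>\<theta>\<in>\<K> q. (\<forall>x\<in>space \<pi> - C. (\<integral>\<^sup>+y. ennreal (V y) \<partial>P \<theta> x) \<le> ennreal (l * V x)) \<and>
      (\<forall>x\<in>C. (\<integral>\<^sup>+y. ennreal (V y) \<partial>P \<theta> x) \<le> ennreal b)"
    using geometric[OF \<K>[of q]] by blast
  show ?thesis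
    by (rule uniform_ergodicity[OF prob_\<pi> _ _ V V1 C e \<phi>, of "\<K> q" P l b])
       (use P inv \<K>(2) minor l b d assms in auto)
qed

text \<open>The case r = 0 of the Lipschitz hypothesis: the weight is 1 on the space, and the
  weighted norm is the supremum norm.\<close>

lemma kernel_app_lipschitz:
  "\<exists>C\<ge>0. \<forall>\<theta>\<in>\<K> q. \<forall>\<theta>'\<in>\<K> q. \<forall>g\<in>borel_measurable \<pi>. \<forall>F. (\<forall>x\<in>space \<pi>. \<bar>g x\<bar> \<le> F) \<longrightarrow>
    (\<forall>x\<in>space \<pi>. \<bar>kernel_app (P \<theta>) g x - kernel_app (P \<theta>') g x\<bar> \<le> C * F * norm (\<theta> - \<theta>'))"
proof -
  let ?W = "\<lambda>x. V x powr 0"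
  have W: "0 < ?W x" "?W x = 1" if "x \<in> space \<pi>" for x using V_pos[OF that] by auto
  obtain C where C: "0 \<le> C" and lip: "\<And>\<theta> \<theta>' g. \<theta> \<in> \<K> q \<Longrightarrow> \<theta>' \<in> \<K> q \<Longrightarrow> g \<in> wspace \<pi> ?W \<Longrightarrow>
      wnorm \<pi> ?W (\<lambda>x. kernel_app (P \<theta>) g x - kernel_app (P \<theta>') g x) \<le> ennreal C * wnorm \<pi> ?W g * ennreal (norm (\<theta> - \<theta>'))"
    using lipschitz_P[OF \<K>[of q], of 0] by auto
  show ?thesis
  proof (intro exI[of _ C] conjI ballI allI impI C)
    fix \<theta> \<theta>' x F and g :: "'x \<Rightarrow> real"
    assume \<theta>: "\<theta> \<in> \<K> q" "\<theta>' \<in> \<K> q" and g: "g \<in> borel_measurable \<pi>"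
      and F: "\<forall>x\<in>space \<pi>. \<bar>g x\<bar> \<le> F" and x: "x \<in> space \<pi>"
    have F0: "0 \<le> F" using F x by fastforce
    have wn: "wnorm \<pi> ?W g \<le> ennreal F" using F W by (intro wnorm_le) auto
    then have "g \<in> wspace \<pi> ?W" using g by (auto simp: wspace_def le_less_trans)
    from lip[OF \<theta> this]
    have "wnorm \<pi> ?W (\<lambda>x. kernel_app (P \<theta>) g x - kernel_app (P \<theta>') g x) \<le> ennreal C * wnorm \<pi> ?W g * ennreal (norm (\<theta> - \<theta>'))" .
    also have "\<dots> \<le> ennreal C * ennreal F * ennreal (norm (\<theta> - \<theta>'))"
      by (intro mult_right_mono mult_left_mono wn) auto
    also have "\<dots> = ennreal (C * F * norm (\<theta> - \<theta>'))" using C F0 by (simp add: ennreal_mult)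
    finally have "norm (kernel_app (P \<theta>) g x - kernel_app (P \<theta>') g x) \<le> C * F * norm (\<theta> - \<theta>') * ?W x"
      using C F0 x W(1)[OF x] by (intro wnorm_leD) auto
    then show "\<bar>kernel_app (P \<theta>) g x - kernel_app (P \<theta>') g x\<bar> \<le> C * F * norm (\<theta> - \<theta>')"
      using W(2)[OF x] by simp
  qed
qed

text \<open>Applied to indicators, the Lipschitz bound in the supremum norm makes the masses of
  fixed sets continuous in \<theta>.\<close>

lemma measurable_P_joint: "(\<lambda>(\<theta>, x). P \<theta> x) \<in> restrict_space borel \<Theta> \<Otimes>\<^sub>M \<pi> \<rightarrow>\<^sub>M prob_algebra \<pi>"
proof (rule measurable_kernel_family[OF open_\<Theta> P])
  fix A x assume A: "A \<in> sets \<pi>" and x: "x \<in> space \<pi>"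
  show "continuous_on \<Theta> (\<lambda>\<theta>. measure (P \<theta> x) A)"
  proof (rule compact_coverage_continuous_on[OF coverage])
    fix q
    obtain C where C: "0 \<le> C" "\<And>\<theta> \<theta>' g F x. \<theta> \<in> \<K> q \<Longrightarrow> \<theta>' \<in> \<K> q \<Longrightarrow> g \<in> borel_measurable \<pi> \<Longrightarrow>
      \<forall>x\<in>space \<pi>. \<bar>g x\<bar> \<le> F \<Longrightarrow> x \<in> space \<pi> \<Longrightarrow>
      \<bar>kernel_app (P \<theta>) g x - kernel_app (P \<theta>') g x\<bar> \<le> C * F * norm (\<theta> - \<theta>')"
      using kernel_app_lipschitz[of q] by blast
    have app: "kernel_app (P \<theta>) (indicator A) x = measure (P \<theta> x) A" if "\<theta> \<in> \<K> q" for \<theta>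
    proof -
      interpret markov_kernel \<pi> "P \<theta>" using that \<K>(2) by (intro kernel_P) auto
      show ?thesis using sets.sets_into_space[OF A] by (simp add: kernel_app_def space_P[OF x] Int_absorb2)
    qed
    have "\<bar>measure (P \<theta> x) A - measure (P \<theta>' x) A\<bar> \<le> C * norm (\<theta> - \<theta>')" if "\<theta> \<in> \<K> q" "\<theta>' \<in> \<K> q" for \<theta> \<theta>'
      using C(2)[OF that, of "indicator A" 1 x] A x app that by (auto simp: indicator_def)
    with C(1) show "\<exists>C\<ge>0. \<forall>\<theta>\<in>\<K> q. \<forall>\<theta>'\<in>\<K> q. \<bar>measure (P \<theta> x) A - measure (P \<theta>' x) A\<bar> \<le> C * norm (\<theta> - \<theta>')"
      by blast
  qed
qed

abbreviation Z :: "('x, 't) reproj_state measure" where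
  "Z \<equiv> reproj_space \<pi> \<Theta>"

abbreviation R :: "('x, 't) reproj_state \<Rightarrow> ('x, 't) reproj_state measure" where
  "R \<equiv> reproj_kernel \<pi> \<Theta> P H \<gamma> \<K> proj"

sublocale markov_chain Z R "(x\<^sub>0, Some \<theta>\<^sub>0, 0, 0)"
proof
  show "R \<in> Z \<rightarrow>\<^sub>M prob_algebra Z"
    by (rule measurable_reproj_kernel[OF open_\<Theta> H measurable_P_joint coverage proj])
  show "(x\<^sub>0, Some \<theta>\<^sub>0, 0, 0) \<in> space Z"
    using x\<^sub>0 \<theta>\<^sub>0 by (simp add: reproj_space_def space_pair_measure space_param_bar)
qed

end

lemma measurable_reproj_next:
  fixes \<Theta> :: "('t::euclidean_space) set"
  assumes \<Theta>: "open \<Theta>" and cov: "compact_coverage \<Theta> \<K>"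
  shows "reproj_next \<K> \<kappa> \<nu> \<in> M \<Otimes>\<^sub>M param_bar \<Theta> \<rightarrow>\<^sub>M reproj_space M \<Theta>"
    and "{\<tau> \<in> space (param_bar \<Theta>). \<tau> \<in> Some ` \<K> \<kappa>} \<in> sets (param_bar \<Theta>)"
proof -
  have "\<K> \<kappa> \<subseteq> \<Theta>" "\<K> \<kappa> \<in> sets borel"
    using cov by (auto simp: compact_coverage_def borel_compact)
  moreover from this have "{\<tau> \<in> space (param_bar \<Theta>). \<tau> \<in> Some ` \<K> \<kappa>} = Some ` \<K> \<kappa>"
    by (auto simp: space_param_bar)
  moreover have "Some -` Some ` \<K> \<kappa> = \<K> \<kappa>" by auto
  ultimately show S: "{\<tau> \<in> space (param_bar \<Theta>). \<tau> \<in> Some ` \<K> \<kappa>} \<in> sets (param_bar \<Theta>)"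
    using \<Theta> by (auto simp: sets_param_bar sets_restrict_space_iff)
  then have "Measurable.pred (param_bar \<Theta>) (\<lambda>\<tau>. \<tau> \<in> Some ` \<K> \<kappa>)" by (simp only: pred_def)
  from measurable_compose[OF measurable_snd this]
  have [measurable]: "Measurable.pred (M \<Otimes>\<^sub>M param_bar \<Theta>) (\<lambda>p. snd p \<in> Some ` \<K> \<kappa>)" .
  show "reproj_next \<K> \<kappa> \<nu> \<in> M \<Otimes>\<^sub>M param_bar \<Theta> \<rightarrow>\<^sub>M reproj_space M \<Theta>"
    unfolding reproj_next_def reproj_space_def split_beta' by measurable
qed

section \<open>Excursions inside a compact set\<close>

context reprojected_chain
begin

text \<open>The default \<open>\<theta>\<^sub>0\<close> at the cemetery keeps the map inside
  \<Theta>, so it is measurable on the whole state space; on \<open>running\<close> states the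
  default does not occur.\<close>

definition state_theta :: "('x, 't) reproj_state \<Rightarrow> 't" where
  "state_theta z = (case fst (snd z) of Some \<theta> \<Rightarrow> \<theta> | None \<Rightarrow> \<theta>\<^sub>0)"

definition state_nu :: "('x, 't) reproj_state \<Rightarrow> nat" where
  "state_nu z = snd (snd (snd z))"

text \<open>The states reached inside the excursion that follows the \<open>q\<close>-th reinitialization.\<close>

definition running :: "nat \<Rightarrow> ('x, 't) reproj_state set" where
  "running q = {z \<in> space Z. fst (snd z) \<in> Some ` \<K> q \<and> state_kappa z = q \<and> 1 \<le> state_nu z}"

lemma state_X_eq: "state_X z = fst z" and state_kappa_eq: "state_kappa z = fst (snd (snd z))"
  by (simp_all add: state_X_def state_kappa_def split_beta)

lemma space_Z: "space Z = space \<pi> \<times> insert None (Some ` \<Theta>) \<times> UNIV"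
  by (auto simp: reproj_space_def space_pair_measure space_param_bar)

lemma measurable_state_X [measurable]: "state_X \<in> Z \<rightarrow>\<^sub>M \<pi>"
  unfolding reproj_space_def state_X_eq[abs_def] by measurable

lemma measurable_state_tau [measurable]: "(\<lambda>z. fst (snd z)) \<in> Z \<rightarrow>\<^sub>M param_bar \<Theta>"
  unfolding reproj_space_def by measurable

lemma measurable_state_kappa [measurable]: "state_kappa \<in> Z \<rightarrow>\<^sub>M count_space UNIV"
  unfolding reproj_space_def state_kappa_eq[abs_def] by measurable

lemma measurable_state_nu [measurable]: "state_nu \<in> Z \<rightarrow>\<^sub>M count_space UNIV"
  unfolding reproj_space_def state_nu_def[abs_def] by measurable

lemma measurable_state_theta [measurable]: "state_theta \<in> Z \<rightarrow>\<^sub>M restrict_space borel \<Theta>"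
  unfolding state_theta_def[abs_def]
proof (rule measurable_compose[OF measurable_state_tau measurableI])
  fix \<tau> assume "\<tau> \<in> space (param_bar \<Theta>)"
  then show "(case \<tau> of None \<Rightarrow> \<theta>\<^sub>0 | Some \<theta> \<Rightarrow> \<theta>) \<in> space (restrict_space borel \<Theta>)"
    using \<theta>\<^sub>0 by (auto simp: space_param_bar space_restrict_space)
next
  fix A assume A: "A \<in> sets (restrict_space borel \<Theta>)"
  then have sub: "A \<subseteq> \<Theta>" using sets.sets_into_space by (fastforce simp: space_restrict_space)
  let ?A = "(\<lambda>\<tau>. case \<tau> of None \<Rightarrow> \<theta>\<^sub>0 | Some \<theta> \<Rightarrow> \<theta>) -` A \<inter> space (param_bar \<Theta>)"
  have "Some -` ?A = A" using sub by (auto simp: space_param_bar)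
  then show "?A \<in> sets (param_bar \<Theta>)"
    using A by (auto simp: sets_param_bar space_param_bar)
qed

lemma pred_state_tau_in [measurable]: "Measurable.pred Z (\<lambda>z. fst (snd z) \<in> Some ` \<K> q)"
  using measurable_reproj_next(2)[OF open_\<Theta> coverage, of q]
  by (intro measurable_compose[OF measurable_state_tau]) (simp only: pred_def)

lemma sets_running [measurable]: "running q \<in> sets Z"
  unfolding running_def by measurable

lemma runningE:
  assumes "z \<in> running q"
  obtains x \<theta> \<nu> where "z = (x, Some \<theta>, q, \<nu>)" "x \<in> space \<pi>" "\<theta> \<in> \<K> q" "1 \<le> \<nu>"
    "state_X z = x" "state_theta z = \<theta>"
  using assms by (cases z) (auto simp: running_def state_kappa_def state_nu_def state_X_def state_theta_def space_Z)

lemma measurable_update: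
  assumes \<theta>: "\<theta> \<in> \<Theta>" and x: "x \<in> space \<pi>"
  shows "(\<lambda>y. (y, param_update \<Theta> H g \<theta> y)) \<in> P \<theta> x \<rightarrow>\<^sub>M \<pi> \<Otimes>\<^sub>M param_bar \<Theta>"
proof -
  interpret k: markov_kernel \<pi> "P \<theta>" by (rule kernel_P[OF \<theta>])
  have "H \<theta> \<in> borel_measurable \<pi>"
    using measurable_compose[OF measurable_Pair1' H, of \<theta>] \<theta> by (simp add: space_restrict_space)
  then have "param_update \<Theta> H g \<theta> \<in> \<pi> \<rightarrow>\<^sub>M param_bar \<Theta>"
    using open_\<Theta> by (intro measurable_param_update) auto
  then show ?thesis
    unfolding measurable_cong_sets[OF k.sets_P[OF x] refl] by measurable
qed

text \<open>The condition on \<nu> excludes the states from which the next draw starts at a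
  reprojected point. Elsewhere in the excursion the whole transition is a function of one draw from
  \<open>P \<theta> x\<close>.\<close>

lemma R_running:
  assumes \<theta>: "\<theta> \<in> \<Theta>" and x: "x \<in> space \<pi>" and \<nu>: "1 \<le> \<nu>"
  shows "R (x, Some \<theta>, q, \<nu>) = distr (P \<theta> x) Z (\<lambda>y. reproj_next \<K> q \<nu> (y, param_update \<Theta> H (\<gamma> (q + \<nu>)) \<theta> y))"
proof -
  have "R (x, Some \<theta>, q, \<nu>) = distr (distr (P \<theta> x) (\<pi> \<Otimes>\<^sub>M param_bar \<Theta>) (\<lambda>y. (y, param_update \<Theta> H (\<gamma> (q + \<nu>)) \<theta> y))) Z (reproj_next \<K> q \<nu>)"
    using \<nu> by (simp add: reproj_kernel_def reproj_draw_def elementary_kernel_def)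
  also have "\<dots> = distr (P \<theta> x) Z (reproj_next \<K> q \<nu> \<circ> (\<lambda>y. (y, param_update \<Theta> H (\<gamma> (q + \<nu>)) \<theta> y)))"
    by (rule distr_distr[OF measurable_reproj_next(1)[OF open_\<Theta> coverage] measurable_update[OF \<theta> x]])
  finally show ?thesis by (simp add: comp_def)
qed

text \<open>Forgetting the parameter and the counters leaves the draw itself, also when this step
  ends the excursion. The drift and the one-step means of the kernels thus carry over to the
  chain.\<close>

lemma distr_state_X:
  assumes "z \<in> running q"
  shows "distr (R z) \<pi> state_X = P (state_theta z) (state_X z)"
  using assms
proof (cases rule: runningE)
  case (1 x \<theta> \<nu>)
  then have \<theta>: "\<theta> \<in> \<Theta>" using \<K>(2) by auto
  interpret k: markov_kernel \<pi> "P \<theta>" by (rule kernel_P[OF \<theta>])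
  let ?g = "\<lambda>y. reproj_next \<K> q \<nu> (y, param_update \<Theta> H (\<gamma> (q + \<nu>)) \<theta> y)"
  have g: "?g \<in> P \<theta> x \<rightarrow>\<^sub>M Z"
    by (rule measurable_compose[OF measurable_update[OF \<theta> 1(2)] measurable_reproj_next(1)[OF open_\<Theta> coverage]])
  have "distr (R z) \<pi> state_X = distr (P \<theta> x) \<pi> (\<lambda>y. y)"
    unfolding 1(1) R_running[OF \<theta> 1(2,4)] distr_distr[OF measurable_state_X g]
    by (rule arg_cong[where f="distr (P \<theta> x) \<pi>"]) (auto simp: fun_eq_iff reproj_next_def state_X_def)
  also have "\<dots> = P \<theta> x" by (rule distr_id2) (simp add: k.sets_P 1(2))
  finally show ?thesis unfolding 1(5) 1(6) .
qed

lemma nn_integral_state_X: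
  assumes z: "z \<in> running q" and h: "h \<in> borel_measurable \<pi>"
  shows "(\<integral>\<^sup>+y. h (state_X y) \<partial>R z) = (\<integral>\<^sup>+y. h y \<partial>P (state_theta z) (state_X z))"
proof -
  have "z \<in> space Z" using z by (simp add: running_def)
  from measurable_cong_sets[OF sets_R[OF this] refl, of \<pi>] have "state_X \<in> R z \<rightarrow>\<^sub>M \<pi>"
    using measurable_state_X by simp
  then show ?thesis
    unfolding distr_state_X[OF z, symmetric] using h by (subst nn_integral_distr) auto
qed

lemma integral_state_X:
  fixes h :: "'x \<Rightarrow> real"
  assumes z: "z \<in> running q" and h: "h \<in> borel_measurable \<pi>"
  shows "(\<integral>y. h (state_X y) \<partial>R z) = kernel_app (P (state_theta z)) h (state_X z)"
proof -
  have "z \<in> space Z" using z by (simp add: running_def)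
  from measurable_cong_sets[OF sets_R[OF this] refl, of \<pi>] have "state_X \<in> R z \<rightarrow>\<^sub>M \<pi>"
    using measurable_state_X by simp
  then show ?thesis
    unfolding kernel_app_def distr_state_X[OF z, symmetric] using h by (subst integral_distr) auto
qed

text \<open>The quantified k is a device for measurability: membership in a set that varies with the
  state becomes a countable union over fixed sets.\<close>

definition counter_step :: "('x, 't) reproj_state \<Rightarrow> ('x, 't) reproj_state \<Rightarrow> bool" where
  "counter_step z z' \<longleftrightarrow>
     (state_kappa z' = state_kappa z \<and> state_nu z' = Suc (state_nu z) \<and>
       (\<exists>k. k = state_kappa z \<and> fst (snd z') \<in> Some ` \<K> k)) \<or>
     (state_kappa z' = Suc (state_kappa z) \<and> state_nu z' = 0)"

lemma AE_counter_step: "AE \<omega> in law. \<forall>n. counter_step (\<omega> n) (\<omega> (Suc n))"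
proof -
  have eq_meas: "Measurable.pred (Z \<Otimes>\<^sub>M Z) (\<lambda>p. a p = b p)"
    if "a \<in> Z \<Otimes>\<^sub>M Z \<rightarrow>\<^sub>M count_space UNIV" "b \<in> Z \<Otimes>\<^sub>M Z \<rightarrow>\<^sub>M count_space UNIV" for a b :: "_ \<Rightarrow> nat"
  proof -
    have [measurable]: "(\<lambda>p. real (a p)) \<in> borel_measurable (Z \<Otimes>\<^sub>M Z)" "(\<lambda>p. real (b p)) \<in> borel_measurable (Z \<Otimes>\<^sub>M Z)"
      using that by (auto intro: measurable_compose[OF _ measurable_count_space])
    have "Measurable.pred (Z \<Otimes>\<^sub>M Z) (\<lambda>p. real (a p) = real (b p))" by measurable
    then show ?thesis by simp
  qed
  have fs: "(\<lambda>p. h (fst p)) \<in> Z \<Otimes>\<^sub>M Z \<rightarrow>\<^sub>M count_space UNIV" "(\<lambda>p. h (snd p)) \<in> Z \<Otimes>\<^sub>M Z \<rightarrow>\<^sub>M count_space UNIV"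
    if "h \<in> Z \<rightarrow>\<^sub>M count_space UNIV" for h :: "_ \<Rightarrow> nat"
    using that by (auto intro: measurable_compose[OF measurable_fst] measurable_compose[OF measurable_snd])
  note fs[OF measurable_state_kappa, measurable] fs[OF measurable_state_nu, measurable]
  have Suc_meas: "(\<lambda>p. Suc (a p)) \<in> Z \<Otimes>\<^sub>M Z \<rightarrow>\<^sub>M count_space UNIV"
    if "a \<in> Z \<Otimes>\<^sub>M Z \<rightarrow>\<^sub>M count_space UNIV" for a :: "_ \<Rightarrow> nat"
    using that by measurable
  have T: "Measurable.pred (Z \<Otimes>\<^sub>M Z) (\<lambda>p. counter_step (fst p) (snd p))"
    unfolding counter_step_def
    by (intro pred_intros_logic pred_intros_countable eq_meas Suc_meas fs measurable_state_kappa measurable_state_nu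
        measurable_const measurable_compose[OF measurable_snd pred_state_tau_in]) simp_all
  show ?thesis
  proof (rule AE_law_step[OF T])
    fix z assume z: "z \<in> space Z"
    obtain x \<tau> \<kappa> \<nu> where z_eq: "z = (x, \<tau>, \<kappa>, \<nu>)" by (cases z)
    let ?draw = "reproj_draw \<pi> \<Theta> P H \<gamma> proj z"
    have sets_draw: "sets ?draw = sets (\<pi> \<Otimes>\<^sub>M param_bar \<Theta>)"
      by (auto simp: reproj_draw_def z_eq elementary_kernel_def split_beta split: option.split)
    have next_meas: "reproj_next \<K> \<kappa> \<nu> \<in> ?draw \<rightarrow>\<^sub>M Z"
      unfolding measurable_cong_sets[OF sets_draw refl]
      by (rule measurable_reproj_next(1)[OF open_\<Theta> coverage])
    have "Measurable.pred Z (counter_step z)"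
      using measurable_compose[OF measurable_Pair1'[OF z] T] by simp
    then have meas: "{z' \<in> space Z. counter_step z z'} \<in> sets Z" by (simp only: pred_def)
    have R_z: "R z = distr ?draw Z (reproj_next \<K> \<kappa> \<nu>)"
      by (simp add: reproj_kernel_def z_eq)
    have "AE p in ?draw. counter_step z (reproj_next \<K> \<kappa> \<nu> p)"
      by (intro AE_I2) (auto simp: counter_step_def z_eq reproj_next_def state_kappa_def state_nu_def split_beta)
    then show "AE z' in R z. counter_step z z'"
      unfolding R_z AE_distr_iff[OF next_meas meas] .
  qed
qed

text \<open>The update evaluates H at the old parameter and the new position, which is why V appears
  at time n + 1. Landing in \<open>running q\<close> rules out the cemetery.\<close>

lemma AE_increments:
  assumes c: "\<And>\<theta> x. \<theta> \<in> \<K> q \<Longrightarrow> x \<in> space \<pi> \<Longrightarrow> norm (H \<theta> x) \<le> c * V x powr \<beta>"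
  shows "AE \<omega> in law. \<forall>n. \<omega> n \<in> running q \<longrightarrow> \<omega> (Suc n) \<in> running q \<longrightarrow>
    norm (state_theta (\<omega> (Suc n)) - state_theta (\<omega> n)) \<le> \<gamma> (q + state_nu (\<omega> n)) * (c * V (state_X (\<omega> (Suc n))) powr \<beta>)"
proof (rule AE_law_step)
  let ?T = "\<lambda>z z'. z \<in> running q \<longrightarrow> z' \<in> running q \<longrightarrow>
    norm (state_theta z' - state_theta z) \<le> \<gamma> (q + state_nu z) * (c * V (state_X z') powr \<beta>)"
  have "(\<lambda>\<theta>. \<theta>) \<in> restrict_space borel \<Theta> \<rightarrow>\<^sub>M borel" by (rule measurable_restrict_space1) simp
  from measurable_compose[OF measurable_state_theta this] have [measurable]: "state_theta \<in> borel_measurable Z" .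
  have [measurable]: "(\<lambda>z. \<gamma> (q + state_nu z)) \<in> borel_measurable Z"
    by (rule measurable_compose[OF measurable_state_nu]) simp
  show T: "Measurable.pred (Z \<Otimes>\<^sub>M Z) (\<lambda>p. ?T (fst p) (snd p))" by measurable
  fix z assume z: "z \<in> space Z"
  show "AE z' in R z. ?T z z'"
  proof (cases "z \<in> running q")
    case True
    then show ?thesis
    proof (cases rule: runningE)
      case (1 x \<theta> \<nu>)
      then have \<theta>: "\<theta> \<in> \<Theta>" using \<K>(2) by auto
      interpret k: markov_kernel \<pi> "P \<theta>" by (rule kernel_P[OF \<theta>])
      have "Measurable.pred Z (\<lambda>z'. ?T z z')"
        using measurable_compose[OF measurable_Pair1'[OF z] T] by simp
      then have meas: "{z' \<in> space Z. ?T z z'} \<in> sets Z" by (simp only: pred_def)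
      let ?g = "\<lambda>y. reproj_next \<K> q \<nu> (y, param_update \<Theta> H (\<gamma> (q + \<nu>)) \<theta> y)"
      have g: "?g \<in> P \<theta> x \<rightarrow>\<^sub>M Z"
        by (rule measurable_compose[OF measurable_update[OF \<theta> 1(2)] measurable_reproj_next(1)[OF open_\<Theta> coverage]])
      have "?T z (?g y)" if y: "y \<in> space (P \<theta> x)" for y
      proof (intro impI)
        assume run: "?g y \<in> running q"
        have y\<pi>: "y \<in> space \<pi>" using y 1(2) by (simp add: k.space_P)
        from run have tau: "fst (snd (?g y)) \<noteq> None" by (auto simp: running_def)
        then have "param_update \<Theta> H (\<gamma> (q + \<nu>)) \<theta> y = Some (\<theta> + \<gamma> (q + \<nu>) *\<^sub>R H \<theta> y)"
          by (auto simp: reproj_next_def param_update_def split: if_splits)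
        then have "state_theta (?g y) = \<theta> + \<gamma> (q + \<nu>) *\<^sub>R H \<theta> y" "state_X (?g y) = y"
          by (auto simp: state_theta_def state_X_def reproj_next_def)
        moreover have "norm (\<gamma> (q + \<nu>) *\<^sub>R H \<theta> y) \<le> \<gamma> (q + \<nu>) * (c * V y powr \<beta>)"
          unfolding norm_scaleR abs_of_pos[OF \<gamma>_pos]
          by (rule mult_left_mono[OF c[OF 1(3) y\<pi>] less_imp_le[OF \<gamma>_pos]])
        moreover have "state_nu z = \<nu>" by (simp add: 1(1) state_nu_def)
        ultimately show "norm (state_theta (?g y) - state_theta z) \<le> \<gamma> (q + state_nu z) * (c * V (state_X (?g y)) powr \<beta>)"
          unfolding 1(6) by simp
      qed
      then have "AE y in P \<theta> x. ?T z (?g y)" by (rule AE_I2)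
      then show ?thesis
        unfolding 1(1) R_running[OF \<theta> 1(2,4)] using AE_distr_iff[OF g meas] by (simp add: 1(1))
    qed
  qed simp
qed

end

text \<open>Each e may have its own bounding sequence, whose limit need only lie below e; later the
  number of terms N or the truncation level M is chosen after e.\<close>

lemma tendsto_0_if_limit_bounds:
  fixes s :: "nat \<Rightarrow> real"
  assumes "\<And>e. 0 < e \<Longrightarrow> \<exists>t L. t \<longlonglongrightarrow> L \<and> L < e \<and> (\<forall>n>0. \<bar>s n\<bar> \<le> t n)"
  shows "s \<longlonglongrightarrow> 0"
proof (rule LIMSEQ_I)
  fix e :: real assume "0 < e"
  then obtain t L where t: "t \<longlonglongrightarrow> L" "L < e" "\<forall>n>0. \<bar>s n\<bar> \<le> t n" using assms by blast
  have "\<forall>\<^sub>F n in sequentially. t n < e \<and> 0 < n"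
    using order_tendstoD(2)[OF t(1,2)] eventually_gt_at_top[of 0] by (rule eventually_conj)
  then have "\<forall>\<^sub>F n in sequentially. norm (s n - 0) < e"
  proof eventually_elim
    fix n assume n: "t n < e \<and> 0 < n"
    then have "\<bar>s n\<bar> \<le> t n" using t(3) by blast
    with n show "norm (s n - 0) < e" by simp
  qed
  then show "\<exists>no. \<forall>n\<ge>no. norm (s n - 0) < e" by (simp add: eventually_sequentially)
qed

section \<open>Laws of large numbers on an excursion\<close>

context reprojected_chain
begin

lemma AE_powr_averages:
  assumes r: "1 / 2 \<le> r" "r < 1"
  shows "AE \<omega> in law. \<forall>q m. (\<forall>n\<ge>m. \<omega> n \<in> running q) \<longrightarrow>
    (\<exists>B. \<forall>n. (\<Sum>k<n. V (state_X (\<omega> (m + k))) powr r) \<le> B * (real n + 1))"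
proof (rule AE_all_countable[THEN iffD2, rule_format])
  fix q
  obtain l b where c: "0 \<le> l" "l < 1" "0 < b"
    "\<forall>\<theta>\<in>\<K> q. \<forall>x\<in>space \<pi>. (\<integral>\<^sup>+y. ennreal (V y) \<partial>P \<theta> x) \<le> ennreal (l * V x + b)"
    using drift_constants[of q] by blast
  interpret D: drift_chain Z R "(x\<^sub>0, Some \<theta>\<^sub>0, 0, 0)" "running q" "\<lambda>z. V (state_X z)" l b
  proof
    show "running q \<in> sets Z" "(\<lambda>z. V (state_X z)) \<in> borel_measurable Z" by measurable
    show "1 \<le> V (state_X z)" if "z \<in> space Z" for z
      using measurable_space[OF measurable_state_X that] by (rule V1)
    show "(\<integral>\<^sup>+y. ennreal (V (state_X y)) \<partial>R z) \<le> ennreal (l * V (state_X z) + b)" if z: "z \<in> running q" for z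
      using nn_integral_state_X[OF z, of "\<lambda>x. ennreal (V x)"] c(4) z by (auto elim!: runningE)
  qed (use c in auto)
  show "AE \<omega> in law. \<forall>m. (\<forall>n\<ge>m. \<omega> n \<in> running q) \<longrightarrow>
      (\<exists>B. \<forall>n. (\<Sum>k<n. V (state_X (\<omega> (m + k))) powr r) \<le> B * (real n + 1))"
    by (rule D.AE_bounded_averages_powr[OF r])
qed

lemma running_theta: "z \<in> running q \<Longrightarrow> state_theta z \<in> \<K> q"
  by (auto elim: runningE)

definition iter :: "('x \<Rightarrow> real) \<Rightarrow> nat \<Rightarrow> 't \<Rightarrow> 'x \<Rightarrow> real" where
  "iter h i \<theta> = (kernel_app (P \<theta>) ^^ i) h"

lemma iter_0: "iter h 0 \<theta> = h"
  and iter_Suc: "iter h (Suc i) \<theta> x = kernel_app (P \<theta>) (iter h i \<theta>) x"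
  by (simp_all add: iter_def)

text \<open>The truncated series for the solution of the Poisson equation. Unlike the full series, it is
  bounded and Lipschitz in \<open>\<theta>\<close> for the supremum norm; the remainder is \<open>iter h N\<close>.\<close>

definition poisson :: "('x \<Rightarrow> real) \<Rightarrow> nat \<Rightarrow> 't \<Rightarrow> 'x \<Rightarrow> real" where
  "poisson h N \<theta> x = (\<Sum>i<N. iter h i \<theta> x)"

text \<open>A martingale increment: from a state in some \<open>running q\<close>, the first term
  has the second as its mean under the transition.\<close>

definition poisson_diff ::
  "('x \<Rightarrow> real) \<Rightarrow> nat \<Rightarrow> ('x, 't) reproj_state \<Rightarrow> ('x, 't) reproj_state \<Rightarrow> real" where
  "poisson_diff h N z z' = poisson h N (state_theta z) (state_X z') -
     kernel_app (P (state_theta z)) (poisson h N (state_theta z)) (state_X z)"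

text \<open>The predicate \<open>LLN f\<close> is the conclusion of the theorem on the excursions that never end.\<close>

definition LLN :: "('x \<Rightarrow> real) \<Rightarrow> (nat \<Rightarrow> ('x, 't) reproj_state) \<Rightarrow> bool" where
  "LLN f \<omega> \<longleftrightarrow> (\<forall>q m. (\<forall>n\<ge>m. \<omega> n \<in> running q) \<longrightarrow>
     (\<lambda>n. (\<Sum>k<n. f (state_X (\<omega> (m + k))) - (\<integral>x. f x \<partial>\<pi>)) / real n) \<longlonglongrightarrow> 0)"

context
  fixes h :: "'x \<Rightarrow> real" and F :: real
  assumes h[measurable]: "h \<in> borel_measurable \<pi>" and F: "\<forall>x\<in>space \<pi>. \<bar>h x\<bar> \<le> F"
begin

lemma iter_bounded:
  assumes "\<theta> \<in> \<Theta>"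
  shows "iter h i \<theta> \<in> borel_measurable \<pi>" and "x \<in> space \<pi> \<Longrightarrow> \<bar>iter h i \<theta> x\<bar> \<le> F"
proof -
  interpret markov_kernel \<pi> "P \<theta>" by (rule kernel_P[OF assms])
  show "iter h i \<theta> \<in> borel_measurable \<pi>" "x \<in> space \<pi> \<Longrightarrow> \<bar>iter h i \<theta> x\<bar> \<le> F"
    unfolding iter_def using funpow_kernel_app[OF h F[rule_format]] by auto
qed

lemma measurable_iter_joint:
  "(\<lambda>p. iter h i (fst p) (snd p)) \<in> borel_measurable (restrict_space borel \<Theta> \<Otimes>\<^sub>M \<pi>)"
proof (induction i)
  case 0
  then show ?case by (simp add: iter_0)
next
  case (Suc i)
  let ?N = "restrict_space borel \<Theta> \<Otimes>\<^sub>M \<pi>"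
  have P: "(\<lambda>p. P (fst p) (snd p)) \<in> ?N \<rightarrow>\<^sub>M subprob_algebra \<pi>"
    using measurable_prob_algebraD[OF measurable_P_joint] by (simp add: split_beta')
  have "(\<lambda>q. (fst (fst q), snd q)) \<in> ?N \<Otimes>\<^sub>M \<pi> \<rightarrow>\<^sub>M ?N" by measurable
  from measurable_compose[OF this Suc]
  have "(\<lambda>(p, y). iter h i (fst p) y) \<in> borel_measurable (?N \<Otimes>\<^sub>M \<pi>)" by (simp add: split_beta')
  from integral_measurable_subprob_algebra2[OF this P]
  show ?case by (simp add: iter_Suc kernel_app_def)
qed

text \<open>The difference of one more iterate splits into P_\<theta> applied to the difference of
  the iterates and the difference of the kernels applied to one iterate; the latter costs D * F at
  every step. The constant grows with i, which a finite partial sum can afford.\<close>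

lemma iter_lipschitz:
  "\<exists>C\<ge>0. \<forall>\<theta>\<in>\<K> q. \<forall>\<theta>'\<in>\<K> q. \<forall>x\<in>space \<pi>. \<bar>iter h i \<theta> x - iter h i \<theta>' x\<bar> \<le> C * norm (\<theta> - \<theta>')"
proof (induction i)
  case 0
  show ?case by (intro exI[of _ 0]) (simp add: iter_0)
next
  case (Suc i)
  then obtain C where C: "0 \<le> C"
    "\<And>\<theta> \<theta>' x. \<theta> \<in> \<K> q \<Longrightarrow> \<theta>' \<in> \<K> q \<Longrightarrow> x \<in> space \<pi> \<Longrightarrow> \<bar>iter h i \<theta> x - iter h i \<theta>' x\<bar> \<le> C * norm (\<theta> - \<theta>')"
    by blast
  obtain D where D: "0 \<le> D" "\<And>\<theta> \<theta>' g F x. \<theta> \<in> \<K> q \<Longrightarrow> \<theta>' \<in> \<K> q \<Longrightarrow> g \<in> borel_measurable \<pi> \<Longrightarrow>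
      \<forall>x\<in>space \<pi>. \<bar>g x\<bar> \<le> F \<Longrightarrow> x \<in> space \<pi> \<Longrightarrow>
      \<bar>kernel_app (P \<theta>) g x - kernel_app (P \<theta>') g x\<bar> \<le> D * F * norm (\<theta> - \<theta>')"
    using kernel_app_lipschitz[of q] by blast
  have F0: "0 \<le> F" using \<pi>.not_empty F by fastforce
  have "\<bar>iter h (Suc i) \<theta> x - iter h (Suc i) \<theta>' x\<bar> \<le> (C + D * F) * norm (\<theta> - \<theta>')"
    if \<theta>: "\<theta> \<in> \<K> q" "\<theta>' \<in> \<K> q" and x: "x \<in> space \<pi>" for \<theta> \<theta>' x
  proof -
    have \<Theta>: "\<theta> \<in> \<Theta>" "\<theta>' \<in> \<Theta>" using \<theta> \<K>(2) by auto
    interpret markov_kernel \<pi> "P \<theta>" by (rule kernel_P[OF \<Theta>(1)])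
    note it = iter_bounded[OF \<Theta>(1)] and it' = iter_bounded[OF \<Theta>(2)]
    have "kernel_app (P \<theta>) (iter h i \<theta>) x - kernel_app (P \<theta>) (iter h i \<theta>') x =
        kernel_app (P \<theta>) (\<lambda>y. iter h i \<theta> y - iter h i \<theta>' y) x"
      unfolding kernel_app_def
      using integrable_bounded_P[OF it x] integrable_bounded_P[OF it' x] by simp
    moreover have "\<bar>kernel_app (P \<theta>) (\<lambda>y. iter h i \<theta> y - iter h i \<theta>' y) x\<bar> \<le> C * norm (\<theta> - \<theta>')"
      using C(2)[OF \<theta>] x by (rule kernel_app_bounded)
    moreover have "\<bar>kernel_app (P \<theta>) (iter h i \<theta>') x - kernel_app (P \<theta>') (iter h i \<theta>') x\<bar> \<le> D * F * norm (\<theta> - \<theta>')"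
      using it' by (intro D(2)[OF \<theta> _ _ x]) auto
    ultimately show ?thesis
      unfolding iter_Suc distrib_right by linarith
  qed
  then show ?case using C(1) D(1) F0 by (intro exI[of _ "C + D * F"]) auto
qed

lemma poisson_bounded:
  assumes "\<theta> \<in> \<Theta>"
  shows "poisson h N \<theta> \<in> borel_measurable \<pi>" and "x \<in> space \<pi> \<Longrightarrow> \<bar>poisson h N \<theta> x\<bar> \<le> real N * F"
proof -
  have [measurable]: "iter h i \<theta> \<in> borel_measurable \<pi>" for i by (rule iter_bounded[OF assms])
  show "poisson h N \<theta> \<in> borel_measurable \<pi>" unfolding poisson_def[abs_def] by measurable
  show "\<bar>poisson h N \<theta> x\<bar> \<le> real N * F" if "x \<in> space \<pi>"
    unfolding poisson_def
    using sum_bounded_above[of "{..<N}" "\<lambda>i. \<bar>iter h i \<theta> x\<bar>" F] iter_bounded(2)[OF assms that]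
    by (intro order_trans[OF sum_abs]) simp
qed

lemma measurable_poisson_joint:
  "(\<lambda>p. poisson h N (fst p) (snd p)) \<in> borel_measurable (restrict_space borel \<Theta> \<Otimes>\<^sub>M \<pi>)"
  unfolding poisson_def by (intro borel_measurable_sum measurable_iter_joint)

lemma poisson_lipschitz:
  "\<exists>C\<ge>0. \<forall>\<theta>\<in>\<K> q. \<forall>\<theta>'\<in>\<K> q. \<forall>x\<in>space \<pi>. \<bar>poisson h N \<theta> x - poisson h N \<theta>' x\<bar> \<le> C * norm (\<theta> - \<theta>')"
proof -
  obtain C where C: "\<And>i. 0 \<le> C i"
    "\<And>i \<theta> \<theta>' x. \<theta> \<in> \<K> q \<Longrightarrow> \<theta>' \<in> \<K> q \<Longrightarrow> x \<in> space \<pi> \<Longrightarrow> \<bar>iter h i \<theta> x - iter h i \<theta>' x\<bar> \<le> C i * norm (\<theta> - \<theta>')"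
    using iter_lipschitz[of q] by metis
  have "\<bar>poisson h N \<theta> x - poisson h N \<theta>' x\<bar> \<le> (\<Sum>i<N. C i) * norm (\<theta> - \<theta>')"
    if "\<theta> \<in> \<K> q" "\<theta>' \<in> \<K> q" "x \<in> space \<pi>" for \<theta> \<theta>' x
    unfolding poisson_def sum_subtractf[symmetric] sum_distrib_right
    using C(2)[OF that] by (intro order_trans[OF sum_abs] sum_mono)
  then show ?thesis using C(1) by (intro exI[of _ "\<Sum>i<N. C i"]) (auto intro: sum_nonneg)
qed

text \<open>The telescoping identity (I - P)(I + P + ... + P^(N-1)) = I - P^N.\<close>

lemma poisson_equation:
  assumes \<theta>: "\<theta> \<in> \<Theta>" and x: "x \<in> space \<pi>"
  shows "h x = poisson h N \<theta> x - kernel_app (P \<theta>) (poisson h N \<theta>) x + iter h N \<theta> x"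
proof -
  interpret markov_kernel \<pi> "P \<theta>" by (rule kernel_P[OF \<theta>])
  have "kernel_app (P \<theta>) (poisson h N \<theta>) x = (\<Sum>i<N. iter h (Suc i) \<theta> x)"
    unfolding poisson_def kernel_app_def iter_Suc
    using integrable_bounded_P[OF iter_bounded[OF \<theta>] x] by (intro Bochner_Integration.integral_sum) auto
  also have "\<dots> = poisson h N \<theta> x + iter h N \<theta> x - h x"
    unfolding poisson_def by (induction N) (simp_all add: iter_0)
  finally show ?thesis by simp
qed

lemma AE_poisson_martingale:
  "AE \<omega> in law. \<forall>q N m. (\<forall>n\<ge>m. \<omega> n \<in> running q) \<longrightarrow>
    (\<lambda>n. (\<Sum>k<n. poisson_diff h N (\<omega> (m + k)) (\<omega> (Suc (m + k)))) / real n)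
    \<longlonglongrightarrow> 0"
proof -
  \<comment> \<open>Setting the function to 0 off \<open>running q\<close> makes it bounded and
    measurable on all pairs of states; along a path inside \<open>running q\<close> nothing
    changes.\<close>
  define u where "u q N p = (if fst p \<in> running q then poisson h N (state_theta (fst p)) (state_X (snd p)) else 0)"
    for q N and p :: "('x, 't) reproj_state \<times> ('x, 't) reproj_state"
  have F0: "0 \<le> F" using \<pi>.not_empty F by fastforce
  have theta: "state_theta z \<in> \<Theta>" if "z \<in> running q" for z q
    using that \<K>(2) by (auto elim!: runningE)
  have "AE \<omega> in law. \<forall>q N m. (\<lambda>n. (\<Sum>k<n. u q N (\<omega> (m + k), \<omega> (Suc (m + k))) -
      (\<integral>y. u q N (\<omega> (m + k), y) \<partial>R (\<omega> (m + k)))) / real n) \<longlonglongrightarrow> 0"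
  proof (rule AE_all_countable[THEN iffD2, rule_format], rule AE_all_countable[THEN iffD2, rule_format], rule slln_law_step)
    fix q N
    have "(\<lambda>p. (state_theta (fst p), state_X (snd p))) \<in> Z \<Otimes>\<^sub>M Z \<rightarrow>\<^sub>M restrict_space borel \<Theta> \<Otimes>\<^sub>M \<pi>"
      by measurable
    from measurable_compose[OF this measurable_poisson_joint]
    have [measurable]: "(\<lambda>p. poisson h N (state_theta (fst p)) (state_X (snd p))) \<in> borel_measurable (Z \<Otimes>\<^sub>M Z)" by simp
    show "u q N \<in> borel_measurable (Z \<Otimes>\<^sub>M Z)" unfolding u_def by measurable
    show "\<bar>u q N p\<bar> \<le> real N * F" if "p \<in> space (Z \<Otimes>\<^sub>M Z)" for p
    proof (cases "fst p \<in> running q")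
      case True
      have "state_X (snd p) \<in> space \<pi>"
        using that by (intro measurable_space[OF measurable_state_X]) (auto simp: space_pair_measure)
      with poisson_bounded(2)[OF theta[OF True]] True show ?thesis by (simp add: u_def)
    qed (use F0 in \<open>simp add: u_def\<close>)
  qed
  then show ?thesis
  proof eventually_elim
    fix \<omega> assume lim: "\<forall>q N m. (\<lambda>n. (\<Sum>k<n. u q N (\<omega> (m + k), \<omega> (Suc (m + k))) -
      (\<integral>y. u q N (\<omega> (m + k), y) \<partial>R (\<omega> (m + k)))) / real n) \<longlonglongrightarrow> 0"
    show "\<forall>q N m. (\<forall>n\<ge>m. \<omega> n \<in> running q) \<longrightarrow>
      (\<lambda>n. (\<Sum>k<n. poisson_diff h N (\<omega> (m + k)) (\<omega> (Suc (m + k)))) / real n)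
      \<longlonglongrightarrow> 0"
    proof (intro allI impI)
      fix q N m assume run: "\<forall>n\<ge>m. \<omega> n \<in> running q"
      have eq: "u q N (\<omega> (m + k), \<omega> (Suc (m + k))) - (\<integral>y. u q N (\<omega> (m + k), y) \<partial>R (\<omega> (m + k))) =
          poisson_diff h N (\<omega> (m + k)) (\<omega> (Suc (m + k)))" for k
      proof -
        have z: "\<omega> (m + k) \<in> running q" using run by simp
        show ?thesis
          using integral_state_X[OF z poisson_bounded(1)[OF theta[OF z]]] z by (simp add: u_def poisson_diff_def)
      qed
      have "(\<lambda>n. (\<Sum>k<n. u q N (\<omega> (m + k), \<omega> (Suc (m + k))) -
          (\<integral>y. u q N (\<omega> (m + k), y) \<partial>R (\<omega> (m + k)))) / real n) \<longlonglongrightarrow> 0"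
        using lim by blast
      then show "(\<lambda>n. (\<Sum>k<n. poisson_diff h N (\<omega> (m + k)) (\<omega> (Suc (m + k)))) / real n)
        \<longlonglongrightarrow> 0"
        unfolding eq .
    qed
  qed
qed

end

lemma AE_average_bounded:
  fixes h :: "'x \<Rightarrow> real"
  assumes h[measurable]: "h \<in> borel_measurable \<pi>" and F: "\<And>x. x \<in> space \<pi> \<Longrightarrow> \<bar>h x\<bar> \<le> F"
  shows "AE \<omega> in law. LLN h \<omega>"
proof -
  define g where "g x = h x - (\<integral>x. h x \<partial>\<pi>)" for x
  have g[measurable]: "g \<in> borel_measurable \<pi>" unfolding g_def by measurable
  have gF: "\<bar>g x\<bar> \<le> 2 * F" if "x \<in> space \<pi>" for x
    using F[OF that] \<pi>.abs_expectation_le_const[where X=h and c=F, OF F] unfolding g_def by linarith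
  then have gF': "\<forall>x\<in>space \<pi>. \<bar>g x\<bar> \<le> 2 * F" by blast
  have "integrable \<pi> h" using F by (intro \<pi>.integrable_const_bound[where B=F] AE_I2) auto
  then have g_int: "(\<integral>x. g x \<partial>\<pi>) = 0" by (simp add: g_def \<pi>.prob_space)
  have "\<exists>c\<ge>0. \<forall>\<theta>\<in>\<K> q. \<forall>x\<in>space \<pi>. norm (H \<theta> x) \<le> c * V x powr \<beta>" for q
    using W_Lipschitz_bound[OF lipschitz_H \<K>(1) \<K>(2), of q] V_pos by (metis powr_gt_zero order_less_irrefl)
  then obtain c where c: "\<And>q. 0 \<le> c q" "\<And>q \<theta> x. \<theta> \<in> \<K> q \<Longrightarrow> x \<in> space \<pi> \<Longrightarrow> norm (H \<theta> x) \<le> c q * V x powr \<beta>"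
    by metis
  have "AE \<omega> in law. \<forall>q n. \<omega> n \<in> running q \<longrightarrow> \<omega> (Suc n) \<in> running q \<longrightarrow>
      norm (state_theta (\<omega> (Suc n)) - state_theta (\<omega> n)) \<le> \<gamma> (q + state_nu (\<omega> n)) * (c q * V (state_X (\<omega> (Suc n))) powr \<beta>)"
    by (rule AE_all_countable[THEN iffD2, rule_format], rule AE_increments, rule c(2))
  \<comment> \<open>The exponent 1/2 dominates V^\<beta>, as \<beta> \<le> 1/2, and lies in the
    range where averages are bounded; the same bound also serves for the remainder of the Poisson
    equation.\<close>
  moreover have "AE \<omega> in law. \<forall>q m. (\<forall>n\<ge>m. \<omega> n \<in> running q) \<longrightarrow>
      (\<exists>B. \<forall>n. (\<Sum>k<n. V (state_X (\<omega> (m + k))) powr (1 / 2)) \<le> B * (real n + 1))"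
    by (rule AE_powr_averages) simp_all
  ultimately show ?thesis
    using AE_counter_step AE_poisson_martingale[OF g gF'] AE_space
  proof eventually_elim
    fix \<omega>
    assume incr: "\<forall>q n. \<omega> n \<in> running q \<longrightarrow> \<omega> (Suc n) \<in> running q \<longrightarrow>
        norm (state_theta (\<omega> (Suc n)) - state_theta (\<omega> n)) \<le> \<gamma> (q + state_nu (\<omega> n)) * (c q * V (state_X (\<omega> (Suc n))) powr \<beta>)"
      and avg: "\<forall>q m. (\<forall>n\<ge>m. \<omega> n \<in> running q) \<longrightarrow>
        (\<exists>B. \<forall>n. (\<Sum>k<n. V (state_X (\<omega> (m + k))) powr (1 / 2)) \<le> B * (real n + 1))"
      and cnt: "\<forall>n. counter_step (\<omega> n) (\<omega> (Suc n))"
      and mart: "\<forall>q N m. (\<forall>n\<ge>m. \<omega> n \<in> running q) \<longrightarrow>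
        (\<lambda>n. (\<Sum>k<n. poisson_diff g N (\<omega> (m + k)) (\<omega> (Suc (m + k)))) / real n)
        \<longlonglongrightarrow> 0"
      and \<omega>: "\<omega> \<in> space law"
    have "(\<lambda>n. (\<Sum>k<n. g (state_X (\<omega> (m + k)))) / real n) \<longlonglongrightarrow> 0" if run: "\<forall>n\<ge>m. \<omega> n \<in> running q" for q m
    proof (rule tendsto_0_if_limit_bounds)
      fix e :: real assume e: "0 < e"
      define X where "X k = state_X (\<omega> (m + k))" for k
      define T where "T k = state_theta (\<omega> (m + k))" for k
      define a where "a k = V (X k) powr (1 / 2)" for k
      have T: "T k \<in> \<K> q" for k using run unfolding T_def by (intro running_theta) simp
      then have T\<Theta>: "T k \<in> \<Theta>" for k using \<K>(2) by auto
      have X: "X k \<in> space \<pi>" for k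
        unfolding X_def by (intro measurable_space[OF measurable_state_X] space_law_coord \<omega>)
      \<comment> \<open>The counter increases by 1 at each step of the excursion, so the step size
        in force, at index q + \<nu>, is at most \<gamma>_k.\<close>
      have nu: "state_nu (\<omega> (m + k)) \<ge> k" for k
      proof (induction k)
        case (Suc k)
        have "state_kappa (\<omega> (m + k)) = q" "state_kappa (\<omega> (Suc (m + k))) = q"
          using run by (auto simp: running_def)
        then have "state_nu (\<omega> (Suc (m + k))) = Suc (state_nu (\<omega> (m + k)))"
          using cnt[rule_format, of "m + k"] by (auto simp: counter_step_def)
        with Suc show ?case by simp
      qed simp
      obtain B where B: "\<And>n. (\<Sum>k<n. a k) \<le> B * (real n + 1)"
        using avg run unfolding a_def X_def by blast
      have B0: "0 \<le> B" using B[of 0] by simp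
      define \<delta> where "\<delta> = e / (2 * (B + 1))"
      have \<delta>: "0 < \<delta>" using e B0 by (simp add: \<delta>_def)
      \<comment> \<open>One N works for all \<theta> in \<open>\<K> q\<close>, so it survives the
        change of parameter along the path. N depends on the path through B, which is harmless since
        the martingale limit holds for all N at once.\<close>
      obtain N where N: "\<And>\<theta> x. \<theta> \<in> \<K> q \<Longrightarrow> x \<in> space \<pi> \<Longrightarrow> \<bar>iter g N \<theta> x\<bar> \<le> \<delta> * V x powr (1 / 2)"
        using ergodicity[OF g gF, of "1 / 2" \<delta> q] \<delta> g_int by (auto simp: iter_def)
      obtain L where L: "0 \<le> L" "\<And>\<theta> \<theta>' x. \<theta> \<in> \<K> q \<Longrightarrow> \<theta>' \<in> \<K> q \<Longrightarrow> x \<in> space \<pi> \<Longrightarrow>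
          \<bar>poisson g N \<theta> x - poisson g N \<theta>' x\<bar> \<le> L * norm (\<theta> - \<theta>')"
        using poisson_lipschitz[OF g gF', of q N] by blast
      let ?G = "poisson g N" and ?C = "real N * (2 * F)"
      define D where "D k = ?G (T k) (X (Suc k)) - kernel_app (P (T k)) (?G (T k)) (X k)" for k
      define w where "w n = (\<Sum>k<n. \<gamma> k * a (Suc k)) / real n" for n
      have D_lim: "(\<lambda>n. (\<Sum>k<n. D k) / real n) \<longlonglongrightarrow> 0"
        using mart run unfolding D_def X_def T_def poisson_diff_def by simp
      have w_lim: "w \<longlonglongrightarrow> 0"
        unfolding w_def
      proof (rule weighted_average_tendsto_0[OF \<gamma>_lim])
        show "(\<Sum>k<n. a (Suc k)) \<le> (2 * B) * (real n + 1)" for n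
        proof -
          have "(\<Sum>k<n. a (Suc k)) \<le> (\<Sum>k<Suc n. a k)"
            unfolding sum.lessThan_Suc_shift by (simp add: a_def)
          also have "\<dots> \<le> B * (real (Suc n) + 1)" by (rule B)
          also have "\<dots> \<le> (2 * B) * (real n + 1)" using B0 by (simp add: algebra_simps)
          finally show ?thesis .
        qed
      qed (use \<gamma>_pos in \<open>auto simp: a_def less_imp_le\<close>)
      \<comment> \<open>The four parts are a telescoping term, the effect of moving \<theta> at a
        fixed position, the martingale increment and the remainder of the truncated series. Changing
        \<theta> only after moving to X (k + 1) makes the first part telescope.\<close>
      have split: "g (X k) = (?G (T k) (X k) - ?G (T (Suc k)) (X (Suc k))) +
          (?G (T (Suc k)) (X (Suc k)) - ?G (T k) (X (Suc k))) + D k + iter g N (T k) (X k)" for k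
        unfolding D_def using poisson_equation[OF g gF' T\<Theta>[of k] X[of k], of N] by linarith
      have drift_T: "\<bar>?G (T (Suc k)) (X (Suc k)) - ?G (T k) (X (Suc k))\<bar> \<le> L * c q * (\<gamma> k * a (Suc k))" for k
      proof -
        have "norm (T (Suc k) - T k) \<le> \<gamma> (q + state_nu (\<omega> (m + k))) * (c q * V (X (Suc k)) powr \<beta>)"
          using incr run unfolding T_def X_def by simp
        also have "\<dots> \<le> \<gamma> k * (c q * a (Suc k))"
        proof (intro mult_mono)
          show "\<gamma> (q + state_nu (\<omega> (m + k))) \<le> \<gamma> k"
            using nu[of k] by (intro decseqD[OF \<gamma>_dec]) simp
          show "V (X (Suc k)) powr \<beta> \<le> a (Suc k)"
            unfolding a_def using \<beta> V1[OF X] by (intro powr_mono) auto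
        qed (use c(1) \<gamma>_pos in \<open>auto simp: less_imp_le\<close>)
        finally have "L * norm (T (Suc k) - T k) \<le> L * (\<gamma> k * (c q * a (Suc k)))"
          using L(1) by (rule mult_left_mono)
        with L(2)[OF T[of "Suc k"] T[of k] X[of "Suc k"]] show ?thesis by (simp add: mult_ac)
      qed
      \<comment> \<open>Only the last summand, the remainder, fails to vanish; its limit \<delta> *
        B is below e by the choice of \<delta>.\<close>
      let ?t = "\<lambda>n. 2 * ?C / real n + L * c q * w n + \<bar>(\<Sum>k<n. D k) / real n\<bar> + \<delta> * B * (1 + 1 / real n)"
      have "?t \<longlonglongrightarrow> 0 + L * c q * 0 + \<bar>0\<bar> + \<delta> * B * (1 + 0)"
        by (intro tendsto_add tendsto_mult tendsto_const tendsto_rabs D_lim w_lim) real_asymp+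
      moreover have "\<delta> * B < e"
      proof -
        have "\<delta> * B \<le> \<delta> * (B + 1)" using \<delta> by simp
        also have "\<dots> = e / 2" using B0 by (simp add: \<delta>_def field_simps)
        finally show ?thesis using e by simp
      qed
      moreover have "\<bar>(\<Sum>k<n. g (state_X (\<omega> (m + k)))) / real n\<bar> \<le> ?t n" if n: "0 < n" for n
      proof -
        have "(\<Sum>k<n. g (X k)) = (\<Sum>k<n. ?G (T k) (X k) - ?G (T (Suc k)) (X (Suc k))) +
            (\<Sum>k<n. ?G (T (Suc k)) (X (Suc k)) - ?G (T k) (X (Suc k))) + (\<Sum>k<n. D k) + (\<Sum>k<n. iter g N (T k) (X k))"
          unfolding sum.distrib[symmetric] by (intro sum.cong refl split)
        moreover have "(\<Sum>k<n. ?G (T k) (X k) - ?G (T (Suc k)) (X (Suc k))) = ?G (T 0) (X 0) - ?G (T n) (X n)"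
          by (rule sum_lessThan_telescope')
        moreover have "\<bar>?G (T 0) (X 0) - ?G (T n) (X n)\<bar> \<le> 2 * ?C"
          using poisson_bounded(2)[OF g gF' T\<Theta>[of 0] X[of 0], of N] poisson_bounded(2)[OF g gF' T\<Theta>[of n] X[of n], of N]
          by linarith
        moreover have "\<bar>\<Sum>k<n. ?G (T (Suc k)) (X (Suc k)) - ?G (T k) (X (Suc k))\<bar> \<le> L * c q * (\<Sum>k<n. \<gamma> k * a (Suc k))"
          unfolding sum_distrib_left by (intro order_trans[OF sum_abs] sum_mono drift_T)
        moreover have "\<bar>\<Sum>k<n. iter g N (T k) (X k)\<bar> \<le> \<delta> * (B * (real n + 1))"
        proof -
          have "\<bar>\<Sum>k<n. iter g N (T k) (X k)\<bar> \<le> (\<Sum>k<n. \<delta> * a k)"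
            unfolding a_def by (intro order_trans[OF sum_abs] sum_mono N T X)
          also have "\<dots> \<le> \<delta> * (B * (real n + 1))"
            unfolding sum_distrib_left[symmetric] using B \<delta> by (intro mult_left_mono) auto
          finally show ?thesis .
        qed
        ultimately have "\<bar>\<Sum>k<n. g (X k)\<bar> \<le> 2 * ?C + L * c q * (\<Sum>k<n. \<gamma> k * a (Suc k)) + \<bar>\<Sum>k<n. D k\<bar> + \<delta> * (B * (real n + 1))"
          by linarith
        then have "\<bar>\<Sum>k<n. g (X k)\<bar> / real n \<le>
            (2 * ?C + L * c q * (\<Sum>k<n. \<gamma> k * a (Suc k)) + \<bar>\<Sum>k<n. D k\<bar> + \<delta> * (B * (real n + 1))) / real n"
          by (rule divide_right_mono) simp
        also have "\<dots> = ?t n"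
          using n by (simp add: w_def field_simps)
        finally show ?thesis by (simp add: X_def)
      qed
      ultimately show "\<exists>t L. t \<longlonglongrightarrow> L \<and> L < e \<and> (\<forall>n>0. \<bar>(\<Sum>k<n. g (state_X (\<omega> (m + k)))) / real n\<bar> \<le> t n)"
        by (intro exI[of _ ?t] exI[of _ "0 + L * c q * 0 + \<bar>0\<bar> + \<delta> * B * (1 + 0)"]) simp
    qed
    then show "LLN h \<omega>"
      unfolding g_def LLN_def by blast
  qed
qed

lemma AE_average_running:
  fixes f :: "'x \<Rightarrow> real"
  assumes f[measurable]: "f \<in> borel_measurable \<pi>" and c: "0 \<le> c" "\<And>x. x \<in> space \<pi> \<Longrightarrow> \<bar>f x\<bar> \<le> c * V x powr \<alpha>"
    and \<alpha>: "0 \<le> \<alpha>" "\<alpha> < 1"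
  shows "AE \<omega> in law. LLN f \<omega>"
proof -
  \<comment> \<open>r is the midpoint between \<alpha> and 1: below 1 for the averages of V^r to be
    bounded, above \<alpha> by s, so that where V > M the function V^\<alpha> is at most M^(-s) *
    V^r.\<close>
  define r where "r = (1 + \<alpha>) / 2"
  define s where "s = (1 - \<alpha>) / 2"
  have r: "1 / 2 \<le> r" "r < 1" and s: "0 < s" "\<alpha> = r - s" using \<alpha> by (auto simp: r_def s_def field_simps)
  define h where "h M x = (if V x \<le> real M then f x else 0)" for M :: nat and x
  have h[measurable]: "h M \<in> borel_measurable \<pi>" for M unfolding h_def by measurable
  have fV: "\<bar>f x\<bar> \<le> c * V x" if x: "x \<in> space \<pi>" for x
  proof -
    have "V x powr \<alpha> \<le> V x powr 1" using V1[OF x] \<alpha> by (intro powr_mono) auto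
    then have "c * V x powr \<alpha> \<le> c * V x" using c(1) V_pos[OF x] by (intro mult_left_mono) auto
    with c(2)[OF x] show ?thesis by linarith
  qed
  have h_bound: "\<bar>h M x\<bar> \<le> c * real M" if x: "x \<in> space \<pi>" for M x
    using fV[OF x] mult_left_mono[OF _ c(1), of "V x" "real M"] c(1) by (auto simp: h_def)
  have tail: "\<bar>f x - h M x\<bar> \<le> c * real M powr - s * V x powr r" if x: "x \<in> space \<pi>" and M: "0 < M" for M x
  proof (cases "V x \<le> real M")
    case False
    have "V x powr \<alpha> = V x powr - s * V x powr r" using V_pos[OF x] by (simp add: s(2) powr_add[symmetric])
    also have "\<dots> \<le> real M powr - s * V x powr r"
      using False M s(1) by (intro mult_right_mono powr_mono2') auto
    finally have "c * V x powr \<alpha> \<le> c * (real M powr - s * V x powr r)" using c(1) by (rule mult_left_mono)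
    with c(2)[OF x] False show ?thesis by (simp add: h_def mult.assoc)
  qed (use c(1) in \<open>simp add: h_def\<close>)
  define \<pi>V where "\<pi>V = (\<integral>x. V x \<partial>\<pi>)"
  have f_int: "integrable \<pi> f"
    using fV c(1) V_pos by (intro Bochner_Integration.integrable_bound[OF integrable_mult_right[OF integrable_V, of c]] AE_I2)
      (auto simp: abs_mult less_imp_le)
  have h_int: "integrable \<pi> (h M)" for M
    using h_bound by (intro \<pi>.integrable_const_bound[where B="c * real M"] AE_I2) auto
  have \<pi>_tail: "\<bar>(\<integral>x. f x \<partial>\<pi>) - (\<integral>x. h M x \<partial>\<pi>)\<bar> \<le> c * real M powr - s * \<pi>V" if M: "0 < M" for M
  proof -
    have "\<bar>(\<integral>x. f x \<partial>\<pi>) - (\<integral>x. h M x \<partial>\<pi>)\<bar> = \<bar>\<integral>x. f x - h M x \<partial>\<pi>\<bar>"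
      using f_int h_int by simp
    also have "\<dots> \<le> (\<integral>x. \<bar>f x - h M x\<bar> \<partial>\<pi>)" by (rule integral_abs_bound)
    also have "\<dots> \<le> (\<integral>x. c * real M powr - s * V x \<partial>\<pi>)"
    proof (rule integral_mono)
      fix x assume x: "x \<in> space \<pi>"
      have "V x powr r \<le> V x powr 1" using V1[OF x] r by (intro powr_mono) auto
      then have "c * real M powr - s * V x powr r \<le> c * real M powr - s * V x"
        using c(1) V_pos[OF x] by (intro mult_left_mono) auto
      with tail[OF x M] show "\<bar>f x - h M x\<bar> \<le> c * real M powr - s * V x" by linarith
    qed (use f_int h_int integrable_V in auto)
    finally show ?thesis by (simp add: \<pi>V_def)
  qed
  have "AE \<omega> in law. \<forall>M. LLN (h M) \<omega>"
    by (rule AE_all_countable[THEN iffD2, rule_format], rule AE_average_bounded[OF h h_bound])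
  then show ?thesis
    using AE_powr_averages[OF r] AE_space
  proof eventually_elim
    fix \<omega>
    assume lim: "\<forall>M. LLN (h M) \<omega>"
      and avg: "\<forall>q m. (\<forall>n\<ge>m. \<omega> n \<in> running q) \<longrightarrow>
        (\<exists>B. \<forall>n. (\<Sum>k<n. V (state_X (\<omega> (m + k))) powr r) \<le> B * (real n + 1))"
      and \<omega>: "\<omega> \<in> space law"
    have "(\<lambda>n. (\<Sum>k<n. f (state_X (\<omega> (m + k))) - (\<integral>x. f x \<partial>\<pi>)) / real n) \<longlonglongrightarrow> 0"
      if run: "\<forall>n\<ge>m. \<omega> n \<in> running q" for q m
    proof (rule tendsto_0_if_limit_bounds)
      fix e :: real assume e: "0 < e"
      define X where "X k = state_X (\<omega> (m + k))" for k
      have X: "X k \<in> space \<pi>" for k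
        unfolding X_def by (intro measurable_space[OF measurable_state_X] space_law_coord \<omega>)
      obtain B where B: "\<And>n. (\<Sum>k<n. V (X k) powr r) \<le> B * (real n + 1)"
        using avg run unfolding X_def by blast
      have "(\<lambda>M. real M powr - s * (c * (B + \<pi>V))) \<longlonglongrightarrow> 0 * (c * (B + \<pi>V))"
        using s(1) by (intro tendsto_mult tendsto_const tendsto_neg_powr filterlim_real_sequentially) auto
      then have "\<forall>\<^sub>F M in sequentially. real M powr - s * (c * (B + \<pi>V)) < e"
        using e by (intro order_tendstoD) auto
      then have "\<forall>\<^sub>F M in sequentially. real M powr - s * (c * (B + \<pi>V)) < e \<and> 0 < M"
        using eventually_gt_at_top[of 0] by (rule eventually_conj)
      \<comment> \<open>M depends on the path through B; the law for \<open>h M\<close> holds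
        simultaneously for all natural M, so the choice can be made path by path.\<close>
      then obtain M where M: "real M powr - s * (c * (B + \<pi>V)) < e" "0 < M"
        by (auto simp: eventually_sequentially)
      let ?\<delta> = "c * real M powr - s"
      have \<delta>: "0 \<le> ?\<delta>" using c(1) by simp
      let ?h = "\<lambda>n. (\<Sum>k<n. h M (X k) - (\<integral>x. h M x \<partial>\<pi>)) / real n"
      let ?t = "\<lambda>n. \<bar>?h n\<bar> + ?\<delta> * B * (1 + 1 / real n) + ?\<delta> * \<pi>V"
      have h_lim: "?h \<longlonglongrightarrow> 0" using lim run unfolding X_def LLN_def by blast
      have "?t \<longlonglongrightarrow> \<bar>0\<bar> + ?\<delta> * B * (1 + 0) + ?\<delta> * \<pi>V"
        by (intro tendsto_add tendsto_mult tendsto_const tendsto_rabs h_lim) real_asymp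
      moreover have "\<bar>0\<bar> + ?\<delta> * B * (1 + 0) + ?\<delta> * \<pi>V < e"
        using M(1) by (simp add: algebra_simps)
      moreover have "\<bar>(\<Sum>k<n. f (state_X (\<omega> (m + k))) - (\<integral>x. f x \<partial>\<pi>)) / real n\<bar> \<le> ?t n" if n: "0 < n" for n
      proof -
        let ?D = "(\<integral>x. f x \<partial>\<pi>) - (\<integral>x. h M x \<partial>\<pi>)"
        have "(\<Sum>k<n. f (X k) - (\<integral>x. f x \<partial>\<pi>)) =
            (\<Sum>k<n. h M (X k) - (\<integral>x. h M x \<partial>\<pi>)) + (\<Sum>k<n. f (X k) - h M (X k)) - real n * ?D"
          by (simp add: sum_subtractf algebra_simps)
        moreover have "\<bar>\<Sum>k<n. f (X k) - h M (X k)\<bar> \<le> ?\<delta> * (B * (real n + 1))"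
        proof -
          have "\<bar>\<Sum>k<n. f (X k) - h M (X k)\<bar> \<le> (\<Sum>k<n. ?\<delta> * V (X k) powr r)"
            by (intro order_trans[OF sum_abs] sum_mono tail X M)
          also have "\<dots> \<le> ?\<delta> * (B * (real n + 1))"
            unfolding sum_distrib_left[symmetric] using B \<delta> by (intro mult_left_mono) auto
          finally show ?thesis .
        qed
        moreover have "\<bar>real n * ?D\<bar> \<le> real n * (?\<delta> * \<pi>V)"
          unfolding abs_mult using \<pi>_tail[OF M(2)] by (simp add: mult_left_mono)
        ultimately have "\<bar>\<Sum>k<n. f (X k) - (\<integral>x. f x \<partial>\<pi>)\<bar> \<le>
            \<bar>\<Sum>k<n. h M (X k) - (\<integral>x. h M x \<partial>\<pi>)\<bar> + ?\<delta> * (B * (real n + 1)) + real n * (?\<delta> * \<pi>V)"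
          by linarith
        then have "\<bar>\<Sum>k<n. f (X k) - (\<integral>x. f x \<partial>\<pi>)\<bar> / real n \<le>
            (\<bar>\<Sum>k<n. h M (X k) - (\<integral>x. h M x \<partial>\<pi>)\<bar> + ?\<delta> * (B * (real n + 1)) + real n * (?\<delta> * \<pi>V)) / real n"
          by (rule divide_right_mono) simp
        also have "\<dots> = ?t n" using n by (simp add: field_simps)
        finally show ?thesis by (simp add: X_def)
      qed
      ultimately show "\<exists>t L. t \<longlonglongrightarrow> L \<and> L < e \<and>
          (\<forall>n>0. \<bar>(\<Sum>k<n. f (state_X (\<omega> (m + k))) - (\<integral>x. f x \<partial>\<pi>)) / real n\<bar> \<le> t n)"
        by (intro exI[of _ ?t] exI[of _ "\<bar>0\<bar> + ?\<delta> * B * (1 + 0) + ?\<delta> * \<pi>V"]) blast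
    qed
    then show "LLN f \<omega>"
      unfolding LLN_def by blast
  qed
qed

lemma AE_average:
  fixes f :: "'x \<Rightarrow> real"
  assumes f: "f \<in> borel_measurable \<pi>" "wnorm \<pi> (\<lambda>x. V x powr \<alpha>) f < \<infinity>" and \<alpha>: "0 \<le> \<alpha>" "\<alpha> < 1"
    and stable: "AE \<omega> in law. convergent (\<lambda>n. real (state_kappa (\<omega> n)))"
  shows "AE \<omega> in law. (\<lambda>n. (\<Sum>k=1..n. f (state_X (\<omega> k)) - (\<integral>x. f x \<partial>\<pi>)) / real n) \<longlonglongrightarrow> 0"
proof -
  obtain c where c: "0 \<le> c" "\<And>x. x \<in> space \<pi> \<Longrightarrow> norm (f x) \<le> c * V x powr \<alpha>"
    using wnorm_finiteE[OF f(2)] V_pos by (metis powr_gt_zero order_less_irrefl)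
  have "AE \<omega> in law. LLN f \<omega>"
    by (rule AE_average_running[OF f(1) c(1) _ \<alpha>]) (use c(2) in simp)
  then show ?thesis
    using stable AE_counter_step AE_space
  proof eventually_elim
    fix \<omega>
    assume lim: "LLN f \<omega>"
      and conv: "convergent (\<lambda>n. real (state_kappa (\<omega> n)))"
      and cnt: "\<forall>n. counter_step (\<omega> n) (\<omega> (Suc n))"
      and \<omega>: "\<omega> \<in> space law"
    have "Cauchy (\<lambda>n. real (state_kappa (\<omega> n)))" using conv by (simp add: Cauchy_convergent_iff)
    then obtain N where "\<forall>m\<ge>N. \<forall>n\<ge>N. dist (real (state_kappa (\<omega> m))) (real (state_kappa (\<omega> n))) < 1"
      unfolding Cauchy_def by (meson zero_less_one)
    then have const: "state_kappa (\<omega> n) = state_kappa (\<omega> N)" if "N \<le> n" for n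
      using that by (fastforce simp: dist_real_def)
    define q where "q = state_kappa (\<omega> N)"
    \<comment> \<open>At time N itself the counter \<nu> may still be 0. One further step without a
      change of \<kappa> forces the parameter into \<open>\<K> q\<close> and \<nu> \<ge> 1, hence
      the start at N + 1.\<close>
    have "\<omega> n \<in> running q" if n: "Suc N \<le> n" for n
    proof -
      obtain k where k: "n = Suc k" "N \<le> k" using n by (cases n) auto
      have "state_kappa (\<omega> (Suc k)) = q" "state_kappa (\<omega> k) = q"
        using const[of "Suc k"] const[of k] k by (auto simp: q_def)
      then show ?thesis
        using cnt[rule_format, of k] space_law_coord[OF \<omega>, of "Suc k"]
        unfolding k(1) running_def counter_step_def by auto
    qed
    with lim have "(\<lambda>n. (\<Sum>k<n. f (state_X (\<omega> (Suc N + k))) - (\<integral>x. f x \<partial>\<pi>)) / real n) \<longlonglongrightarrow> 0" 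
      unfolding LLN_def by blast
    then show "(\<lambda>n. (\<Sum>k=1..n. f (state_X (\<omega> k)) - (\<integral>x. f x \<partial>\<pi>)) / real n) \<longlonglongrightarrow> 0"
      by (rule average_from_shift)
  qed
qed

end

theorem theorem8:
  fixes \<pi> :: "(real ^ 'nx) measure"
    and \<Theta> :: "(real ^ 'nt) set"
    and P :: "real ^ 'nt \<Rightarrow> real ^ 'nx \<Rightarrow> (real ^ 'nx) measure"
    and H :: "real ^ 'nt \<Rightarrow> real ^ 'nx \<Rightarrow> real ^ 'nt"
    and KX :: "(real ^ 'nx) set"
    and \<K> :: "nat \<Rightarrow> (real ^ 'nt) set"
    and \<gamma> :: "nat \<Rightarrow> real"
    and proj :: "(real ^ 'nx) \<times> (real ^ 'nt) option \<Rightarrow> (real ^ 'nx) \<times> (real ^ 'nt)"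
    and V :: "real ^ 'nx \<Rightarrow> real"
    and \<beta> \<alpha> :: real
    and f :: "real ^ 'nx \<Rightarrow> real"
    and x\<^sub>0 :: "real ^ 'nx"
    and \<theta>\<^sub>0 :: "real ^ 'nt"
  assumes "prob_space \<pi>" and "countably_generated \<pi>"
    and "open \<Theta>"
    and "\<And>\<theta>. \<theta> \<in> \<Theta> \<Longrightarrow> P \<theta> \<in> \<pi> \<rightarrow>\<^sub>M prob_algebra \<pi>"
    and "\<And>\<theta>. \<theta> \<in> \<Theta> \<Longrightarrow> irreducible_kernel \<pi> (P \<theta>)"
    and "\<And>\<theta>. \<theta> \<in> \<Theta> \<Longrightarrow> \<pi> \<bind> P \<theta> = \<pi>"
    and "(\<lambda>(\<theta>, x). H \<theta> x) \<in> borel_measurable (restrict_space borel \<Theta> \<Otimes>\<^sub>M \<pi>)"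
    and "KX \<subseteq> space \<pi>"
    and "compact_coverage \<Theta> \<K>"
    and "proj \<in> \<pi> \<Otimes>\<^sub>M param_bar \<Theta> \<rightarrow>\<^sub>M restrict_space (\<pi> \<Otimes>\<^sub>M restrict_space borel \<Theta>) (KX \<times> \<K> 0)"
    and "\<And>k. \<gamma> k > 0" and "decseq \<gamma>"
    and "summable (\<lambda>k. \<gamma> (Suc k) / real (Suc k))"
    and "V \<in> borel_measurable \<pi>" and "\<And>x. x \<in> space \<pi> \<Longrightarrow> V x \<ge> 1" and "bdd_above (V ` KX)"
    and "\<And>K. compact K \<Longrightarrow> K \<subseteq> \<Theta> \<Longrightarrow>
       (\<exists>C\<in>sets \<pi>.
          (\<exists>\<epsilon>>0. \<exists>\<phi>. prob_space \<phi> \<and> sets \<phi> = sets \<pi> \<and> measure \<phi> C > 0 \<and>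
             (\<forall>A\<in>sets \<pi>. \<forall>\<theta>\<in>K. \<forall>x\<in>C. measure (P \<theta> x) A \<ge> \<epsilon> * measure \<phi> A)) \<and>
          (\<exists>l\<in>{0..<1}. \<exists>b>0. \<forall>\<theta>\<in>K.
             (\<forall>x\<in>space \<pi> - C. (\<integral>\<^sup>+y. ennreal (V y) \<partial>P \<theta> x) \<le> ennreal (l * V x)) \<and>
             (\<forall>x\<in>C. (\<integral>\<^sup>+y. ennreal (V y) \<partial>P \<theta> x) \<le> ennreal b)))"
    and "\<And>K r. compact K \<Longrightarrow> K \<subseteq> \<Theta> \<Longrightarrow> r \<in> {0..1} \<Longrightarrow>
       \<exists>C\<ge>0. \<forall>\<theta>\<in>K. \<forall>\<theta>'\<in>K. \<forall>g\<in>wspace \<pi> (\<lambda>x. V x powr r).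
         wnorm \<pi> (\<lambda>x. V x powr r) (\<lambda>x. kernel_app (P \<theta>) g x - kernel_app (P \<theta>') g x)
           \<le> ennreal C * wnorm \<pi> (\<lambda>x. V x powr r) g * ennreal (norm (\<theta> - \<theta>'))"
    and "\<beta> \<in> {0..1/2}" and "W_Lipschitz \<pi> \<Theta> (\<lambda>x. V x powr \<beta>) H"
    and "\<alpha> \<in> {0..<1 - \<beta>}"
    and "f \<in> borel_measurable \<pi>" and "wnorm \<pi> (\<lambda>x. V x powr \<alpha>) f < \<infinity>"
    and "x\<^sub>0 \<in> space \<pi>" and "\<theta>\<^sub>0 \<in> \<Theta>"
    and "AE \<omega> in reproj_law \<pi> \<Theta> P H \<gamma> \<K> proj x\<^sub>0 \<theta>\<^sub>0. convergent (\<lambda>n. real (state_kappa (\<omega> n)))"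
  shows "AE \<omega> in reproj_law \<pi> \<Theta> P H \<gamma> \<K> proj x\<^sub>0 \<theta>\<^sub>0.
    (\<lambda>n. (\<Sum>k=1..n. (f (state_X (\<omega> k)) - (\<integral>x. f x \<partial>\<pi>))) / real n) \<longlonglongrightarrow> 0"
proof -
  have "reprojected_chain \<pi> \<Theta> P H (KX \<times> \<K> 0) \<K> \<gamma> proj V \<beta> x\<^sub>0 \<theta>\<^sub>0"
  proof (rule reprojected_chain.intro, goal_cases)
    \<comment> \<open>This goal is the convergence of the step sizes to 0, obtained from
      monotonicity and summability.\<close>
    case 10
    show ?case using assms(11-13) by (rule decseq_tendsto_0_of_summable_over_Suc)
  next
    case 13
    then show ?case by (rule assms(17))
  next
    case 14
    then show ?case by (rule assms(18))
  qed (use assms(1,3,4,6,7,9-12,14,15,19,20,24,25) in simp_all)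
  then interpret reprojected_chain \<pi> \<Theta> P H "KX \<times> \<K> 0" \<K> \<gamma> proj V \<beta> x\<^sub>0 \<theta>\<^sub>0 .
  show ?thesis
    unfolding reproj_law_def
  proof (rule AE_average[OF assms(22,23)])
    show "0 \<le> \<alpha>" "\<alpha> < 1" using assms(19,21) by auto
    show "AE \<omega> in law. convergent (\<lambda>n. real (state_kappa (\<omega> n)))"
      using assms(26) by (simp only: reproj_law_def)
  qed
qed

end
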